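(* Let $D=2r+1\ge 3$ be odd and let $n\ge D+1$ be an integer. Let $M=n-2r-2$, $s=\lceil r/2\rceil$, $q_-=\max\{1,\lfloor M/s\rfloor\}$ and $q_+=\lceil M/s\rceil$. If $M=0$, then the unique tree maximizing $\lambda_2$ among all trees with $n$ vertices and diameter $D$ is the path $P_{D+1}$. Assume $M\ge 1$, and write $M=q_-c_-+t_-$ with $0\le t_-<q_-$ and $M=q_+c_++t_+$ with $0\le t_+<q_+$ (integers $c_\pm$, $t_\pm$). Then every tree $T$ with $|V(T)|=n$ and $\operatorname{diam}(T)=D$ that maximizes $\lambda_2(T)$ among all trees with $n$ vertices and diameter $D$ is isomorphic to one of the two trees $$\mathrm{AS}(r,q_-+2,c_-,t_-),\qquad \mathrm{AS}(r,q_++2,c_+,t_+).$$ In particular, if these two trees have distinct values of $\lambda_2$, then the maximizer is unique (up to isomorphism). Moreover, for each fixed odd diameter $D\ge3$, the maximizer is unique (up to isomorphism) for all sufficiently large $n$.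
   Context: Let $T=(V,E)$ be a finite tree with at least two vertices and let $\delta\Omega\subset V$ be its set of leaves (vertices of degree $1$), regarded as the boundary. For $g\colon\delta\Omega\to\mathbb R$, its harmonic extension $\widehat g$ is the unique function on $V$ with $\widehat g=g$ on $\delta\Omega$ and $\sum_{w\sim v}(\widehat g(v)-\widehat g(w))=0$ for every $v\in V\setminus\delta\Omega$. The first nonzero Steklov eigenvalue is $$\lambda_2(T)=\min_{\substack{g\in\mathbb R^{\delta\Omega}\setminus\{0\}\\ \sum_\omega g(\omega)=0}}\frac{\sum_{xy\in E}(\widehat g(x)-\widehat g(y))^2}{\sum_{\omega\in\delta\Omega}g(\omega)^2}$$ (equivalently, the second smallest eigenvalue, with multiplicity, of the Dirichlet-to-Neumann map $g\mapsto(\widehat g(\omega)-\widehat g(\omega'))_{\omega\in\delta\Omega}$, where $\omega'$ is the unique neighbor of $\omega$). For integers $b\ge2$ and $\ell_1,\dots,\ell_b\ge1$, the spider $S(\ell_1,\dots,\ell_b)$ is the tree obtained by taking $b$ paths of lengths (numbers of edges) $\ell_1,\dots,\ell_b$ and identifying one endpoint of each into a single common vertex (the center), the paths being otherwise disjoint. For integers $r\ge1$, $b\ge2$, $c\ge1$ and $0\le t\le b-2$, the generalized almost seesaw tree $\mathrm{AS}(r,b,c,t)$ is the spider with $b$ branches of lengths $r+1$, $r$, $t$ branches of length $c+1$ and $b-2-t$ branches of length $c$. $P_{m}$ denotes the path with $m$ vertices. *)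

theory Defs
  imports Complex_Main "HOL-Library.FuncSet" "Graph_Theory.Graph_Theory"
begin

text \<open>
  Finite simple graphs are symmetric loop-free finite digraphs (\<^locale>\<open>pair_graph\<close>), so each
  edge \<open>xy\<close> is present as the two arcs \<open>(x, y)\<close> and \<open>(y, x)\<close>.
  The constant \<^const>\<open>tree\<close> of the library forbids directed cycles, among them \<open>x, y, x\<close>,
  and hence rejects every symmetric digraph with an arc. For undirected trees only the cycles
  of length at least 3 have to be excluded.
\<close>

definition undirected_tree :: "'a pair_pre_digraph \<Rightarrow> bool" where
  "undirected_tree T \<longleftrightarrow> pair_graph T \<and> connected (with_proj T) \<and>
     \<not> (\<exists>p. pre_digraph.cycle (with_proj T) p \<and> length p \<ge> 3)"

definition graph_isomorphic :: "'a pair_pre_digraph \<Rightarrow> 'b pair_pre_digraph \<Rightarrow> bool" where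
  "graph_isomorphic S T \<longleftrightarrow> digraph_iso (with_proj S) (with_proj T)"

definition diameter_of :: "'a pair_pre_digraph \<Rightarrow> ereal" where
  "diameter_of T =
     (SUP (u, v) \<in> pverts T \<times> pverts T. wf_digraph.\<mu> (with_proj T) (\<lambda>_. 1) u v)"

definition leaves :: "'a pair_pre_digraph \<Rightarrow> 'a set" where
  "leaves T = {v \<in> pverts T. out_degree (with_proj T) v = 1}"

text \<open>
  Boundary data \<open>g\<close> matter only on the leaves. The harmonic extension is unique on the vertices;
  \<^const>\<open>extensional\<close> fixes its irrelevant values elsewhere.
\<close>

definition harmonic_extension :: "'a pair_pre_digraph \<Rightarrow> ('a \<Rightarrow> real) \<Rightarrow> 'a \<Rightarrow> real" where
  "harmonic_extension T g = (THE f. f \<in> extensional (pverts T) \<and>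
     (\<forall>v \<in> leaves T. f v = g v) \<and>
     (\<forall>v \<in> pverts T - leaves T. (\<Sum>w | (v, w) \<in> parcs T. f v - f w) = 0))"

text \<open>The factor 1/2 makes every undirected edge count once.\<close>

definition dirichlet_energy :: "'a pair_pre_digraph \<Rightarrow> ('a \<Rightarrow> real) \<Rightarrow> real" where
  "dirichlet_energy T f = (\<Sum>(x, y) \<in> parcs T. (f x - f y)\<^sup>2) / 2"

text \<open>
  The infimum is a minimum: the quotient is continuous and invariant under scaling \<open>g\<close>, so the
  unit sphere of a finite-dimensional space suffices.
\<close>

definition steklov_lambda2 :: "'a pair_pre_digraph \<Rightarrow> real" where
  "steklov_lambda2 T =
     Inf {dirichlet_energy T (harmonic_extension T g) / (\<Sum>v \<in> leaves T. (g v)\<^sup>2) | g.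
            (\<exists>v \<in> leaves T. g v \<noteq> 0) \<and> (\<Sum>v \<in> leaves T. g v) = 0}"

definition tree_class :: "nat \<Rightarrow> nat \<Rightarrow> 'a pair_pre_digraph \<Rightarrow> bool" where
  "tree_class n D T \<longleftrightarrow>
     undirected_tree T \<and> card (pverts T) = n \<and> diameter_of T = ereal (real D)"

text \<open>
  The competitors have natural numbers as vertices. Every finite graph is isomorphic to such a
  graph, so \<open>T\<close> is compared with all trees, whatever the vertex type of \<open>T\<close>.
\<close>

definition lambda2_maximizer :: "nat \<Rightarrow> nat \<Rightarrow> 'a pair_pre_digraph \<Rightarrow> bool" where
  "lambda2_maximizer n D T \<longleftrightarrow> tree_class n D T \<and>
     (\<forall>S :: nat pair_pre_digraph. tree_class n D S \<longrightarrow> steklov_lambda2 S \<le> steklov_lambda2 T)"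

definition path_graph :: "nat \<Rightarrow> nat pair_pre_digraph" where
  "path_graph m =
     (let A = {(i, Suc i) | i. Suc i < m} in \<lparr>pverts = {..<m}, parcs = A \<union> A\<inverse>\<rparr>)"

text \<open>
  \<open>spider_vertex i j\<close> is the vertex at distance \<open>j\<close> from the center on branch \<open>i\<close>;
  the endpoints \<open>j = 0\<close> of all branches are identified.
\<close>

definition spider_vertex :: "nat \<Rightarrow> nat \<Rightarrow> nat \<times> nat" where
  "spider_vertex i j = (if j = 0 then (0, 0) else (i, j))"

definition spider :: "nat list \<Rightarrow> (nat \<times> nat) pair_pre_digraph" where
  "spider ls =
     (let A = {(spider_vertex i j, spider_vertex i (Suc j)) | i j. i < length ls \<and> j < ls ! i}
      in \<lparr>pverts = {spider_vertex i j | i j. i < length ls \<and> j \<le> ls ! i}, parcs = A \<union> A\<inverse>\<rparr>)"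

text \<open>Only meaningful for \<open>r \<ge> 1\<close>, \<open>b \<ge> 2\<close>, \<open>c \<ge> 1\<close> and \<open>t \<le> b - 2\<close>.\<close>

definition almost_seesaw :: "nat \<Rightarrow> nat \<Rightarrow> nat \<Rightarrow> nat \<Rightarrow> (nat \<times> nat) pair_pre_digraph" where
  "almost_seesaw r b c t = spider ([r + 1, r] @ replicate t (c + 1) @ replicate (b - 2 - t) c)"

end

(*
A tree of diameter 2r+1 consists of two rooted subtrees of height r joined by its central edge.
For a trial value rho a subtree enters only through the sum of the leaf values of the solution
with value 1 at the root (series-parallel recursion). Detaching all but the longest path from the
top of an edge decreases this sum, so among subtrees with a given number of edges spiders are
best; by convexity of 1/x it is best to let one side of the central edge be a bare path. Hence
lambda_2 is at most the value of a spider with branches r+1, r and l_1, ..., l_k <= r, with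
equality only for such spiders. There the task is to minimize the sum of 1/(1 - rho l_i) for a
given sum of the l_i, where 1/(r+1) < rho < 1/r. Convexity in l makes the l_i differ by at most
one, and 1/(l (1 - rho l)) is minimal at l = s, which leaves two values for the number of branches.
When both tie, rho is a root of a quadratic polynomial that depends only on M mod s, while rho
tends to 1/(r+1) from above as M grows; so for large n there are no ties.
*)
theory Submission
  imports Defs "HOL-Library.Multiset" "HOL-Computational_Algebra.Polynomial"
begin

section \<open>Rooted trees\<close>

text \<open>An arbitrary tree is only ever bounded from above: at a trial value \<rho> a test
  function suffices, and it may violate the exact equations in the favourable direction. The
  eigenvalue itself is computed for spiders alone. If \<phi> and \<psi> are the leaf sums of the two
  halves for root value 1, scaling them to leaf sums 1 and -1 makes the jump over the central edge
  \<open>1/\<phi> + 1/\<psi>\<close>, and a jump of at most \<rho> bounds the eigenvalue by \<rho>.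
  For a bare path \<open>1/\<phi> = 1 - \<rho> * r\<close>, so that path and central edge merge into
  a branch of length \<open>r + 1\<close>, whose gain is negative. Spiders are compared without
  solving for their eigenvalues: the gains of both are compared at the eigenvalue of one of them.
  Origin of \<open>s\<close>: the product \<open>l * (1 - \<rho> * l)\<close> grows from
  \<open>l = c\<close> to \<open>l = c + 1\<close> iff \<open>\<rho> * (2 * c + 1) < 1\<close>. As
  \<rho> lies strictly between \<open>1/(r + 1)\<close> and \<open>1/r\<close>, this means
  \<open>2 * c + 1 \<le> r\<close>, whatever \<rho> is. The integer optimum is therefore independent
  of \<rho>, and both candidates can be named in advance.\<close>

text \<open>
  \<open>Join s t\<close> hangs \<open>t\<close> below the apex of \<open>s\<close> by one new link, so a tree is
  built child by child; \<open>links\<close> are directed from parent to child.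
\<close>

datatype 'a rtree = Vertex 'a | Join "'a rtree" "'a rtree"

primrec apex :: "'a rtree \<Rightarrow> 'a" where
  "apex (Vertex a) = a"
| "apex (Join s t) = apex s"

primrec vset :: "'a rtree \<Rightarrow> 'a set" where
  "vset (Vertex a) = {a}"
| "vset (Join s t) = vset s \<union> vset t"

primrec links :: "'a rtree \<Rightarrow> 'a rel" where
  "links (Vertex a) = {}"
| "links (Join s t) = insert (apex s, apex t) (links s \<union> links t)"

primrec good :: "'a rtree \<Rightarrow> bool" where
  "good (Vertex a) \<longleftrightarrow> True"
| "good (Join s t) \<longleftrightarrow> good s \<and> good t \<and> vset s \<inter> vset t = {}"

primrec height :: "'a rtree \<Rightarrow> nat" where
  "height (Vertex a) = 0"
| "height (Join s t) = max (height s) (height t + 1)"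

primrec diam :: "'a rtree \<Rightarrow> nat" where
  "diam (Vertex a) = 0"
| "diam (Join s t) = max (max (diam s) (diam t)) (height s + height t + 1)"

definition slinks :: "'a rtree \<Rightarrow> 'a rel" where
  "slinks t = links t \<union> (links t)\<inverse>"

definition graph_of :: "'a rtree \<Rightarrow> 'a pair_pre_digraph" where
  "graph_of t = \<lparr>pverts = vset t, parcs = slinks t\<rparr>"

lemma graph_of_sel [simp]: "pverts (graph_of t) = vset t" "parcs (graph_of t) = slinks t"
  by (simp_all add: graph_of_def)

lemma graph_of_eq_iff: "graph_of s = graph_of t \<longleftrightarrow> vset s = vset t \<and> slinks s = slinks t"
  by (simp add: graph_of_def)

lemma graph_of_eqI: "vset s = vset t \<Longrightarrow> links s = links t \<Longrightarrow> graph_of s = graph_of t"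
  by (simp add: graph_of_def slinks_def)

lemma slinks_simps [simp]:
  "slinks (Vertex a) = {}"
  "slinks (Join s t) = {(apex s, apex t), (apex t, apex s)} \<union> slinks s \<union> slinks t"
  by (auto simp: slinks_def)

lemma apex_in_vset [simp]: "apex t \<in> vset t"
  by (induction t) auto

lemma vset_nonempty [simp]: "vset t \<noteq> {}"
  using apex_in_vset by fastforce

lemma finite_vset [simp]: "finite (vset t)"
  by (induction t) auto

lemma finite_links [simp]: "finite (links t)"
  by (induction t) auto

lemma finite_slinks [simp]: "finite (slinks t)"
  by (simp add: slinks_def)

lemma links_in_vset: "(x, y) \<in> links t \<Longrightarrow> x \<in> vset t \<and> y \<in> vset t"
  by (induction t) auto

lemma slinks_in_vset: "(x, y) \<in> slinks t \<Longrightarrow> x \<in> vset t \<and> y \<in> vset t"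
  by (auto simp: slinks_def dest: links_in_vset)

lemma sym_slinks: "sym (slinks t)"
  by (auto simp: slinks_def sym_def)

lemma slinks_commute: "(x, y) \<in> slinks t \<longleftrightarrow> (y, x) \<in> slinks t"
  by (auto simp: slinks_def)

lemma apex_neq: "vset s \<inter> vset t = {} \<Longrightarrow> apex s \<noteq> apex t"
  by (metis apex_in_vset disjoint_iff)

lemma slinks_irrefl: "good t \<Longrightarrow> (x, y) \<in> slinks t \<Longrightarrow> x \<noteq> y"
  by (induction t) (auto dest: apex_neq)

lemma pair_graph_graph_of: "good t \<Longrightarrow> pair_graph (graph_of t)"
proof unfold_locales
  assume "good t"
  show "symmetric (with_proj (graph_of t))"
    by (simp add: symmetric_def sym_slinks)
  show "fst e \<noteq> snd e" if "e \<in> parcs (graph_of t)" for e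
    using that slinks_irrefl[OF \<open>good t\<close>, of "fst e" "snd e"] by simp
qed (auto dest: slinks_in_vset)

section \<open>Walks, heights and distances\<close>

definition walk :: "'a rel \<Rightarrow> 'a \<Rightarrow> ('a \<times> 'a) list \<Rightarrow> 'a \<Rightarrow> bool" where
  "walk A u p v \<longleftrightarrow> set p \<subseteq> A \<and> pcas u p v"

lemma pcas_append: "pcas u p v \<Longrightarrow> pcas v q w \<Longrightarrow> pcas u (p @ q) w"
  by (induction p arbitrary: u) auto

lemma walk_append: "walk A u p v \<Longrightarrow> walk A v q w \<Longrightarrow> walk A u (p @ q) w"
  by (auto simp: walk_def intro: pcas_append)

lemma walk_mono: "walk A u p v \<Longrightarrow> A \<subseteq> B \<Longrightarrow> walk B u p v"
  by (auto simp: walk_def)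

lemma walk_Nil [simp]: "walk A u [] v \<longleftrightarrow> u = v"
  by (simp add: walk_def)

lemma walk_Cons [simp]: "walk A u (e # p) v \<longleftrightarrow> e \<in> A \<and> fst e = u \<and> walk A (snd e) p v"
  by (auto simp: walk_def)

lemma walk_reverse:
  assumes "sym A" "walk A u p v"
  shows "\<exists>q. walk A v q u \<and> length q = length p"
  using assms(2)
proof (induction p arbitrary: u)
  case (Cons e p)
  then obtain q where q: "walk A v q (snd e)" "length q = length p"
    by auto
  moreover have "(snd e, u) \<in> A"
    using Cons.prems \<open>sym A\<close> by (cases e) (auto dest: symD)
  ultimately have "walk A v (q @ [(snd e, u)]) u"
    by (intro walk_append[OF q(1)]) auto
  then show ?case
    using q(2) by (intro exI[of _ "q @ [(snd e, u)]"]) auto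
qed (auto intro: exI[of _ "[]"])

lemma awalk_graph_of: "pre_digraph.awalk (with_proj (graph_of t)) u p v \<longleftrightarrow> u \<in> vset t \<and> walk (slinks t) u p v"
  by (simp add: pre_digraph.awalk_def cas_with_proj_eq walk_def)

lemma walk_from_apex:
  "x \<in> vset t \<Longrightarrow> \<exists>p. walk (slinks t) (apex t) p x \<and> length p \<le> height t"
proof (induction t)
  case (Join s t)
  show ?case
  proof (cases "x \<in> vset s")
    case True
    then obtain p where "walk (slinks s) (apex s) p x" "length p \<le> height s"
      using Join.IH by auto
    then show ?thesis
      by (intro exI[of _ p]) (force simp: walk_def)
  next
    case False
    then obtain p where p: "walk (slinks t) (apex t) p x" "length p \<le> height t"
      using Join by auto
    have "walk (slinks (Join s t)) (apex t) p x"
      using p(1) by (rule walk_mono) auto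
    then show ?thesis
      using p(2) by (intro exI[of _ "(apex s, apex t) # p"]) auto
  qed
qed (auto intro: exI[of _ "[]"])

lemma walk_across:
  assumes "x \<in> vset s" "y \<in> vset t"
  shows "\<exists>p. walk (slinks (Join s t)) x p y \<and> length p \<le> height s + height t + 1"
proof -
  obtain p where p: "walk (slinks s) (apex s) p x" "length p \<le> height s"
    using walk_from_apex[OF assms(1)] by auto
  obtain q where q: "walk (slinks t) (apex t) q y" "length q \<le> height t"
    using walk_from_apex[OF assms(2)] by auto
  obtain p' where p': "walk (slinks s) x p' (apex s)" "length p' = length p"
    using walk_reverse[OF sym_slinks p(1)] by blast
  have a: "walk (slinks (Join s t)) x p' (apex s)"
    using p'(1) by (rule walk_mono) auto
  have b: "walk (slinks (Join s t)) (apex t) q y"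
    using q(1) by (rule walk_mono) auto
  have "walk (slinks (Join s t)) x (p' @ [(apex s, apex t)] @ q) y"
    by (rule walk_append[OF a]) (simp add: b del: slinks_simps, simp)
  then show ?thesis
    using p(2) q(2) p'(2) by (intro exI[of _ "p' @ [(apex s, apex t)] @ q"] conjI) simp_all
qed

lemma short_walk:
  "x \<in> vset t \<Longrightarrow> y \<in> vset t \<Longrightarrow> \<exists>p. walk (slinks t) x p y \<and> length p \<le> diam t"
proof (induction t)
  case (Join s t)
  consider "x \<in> vset s" "y \<in> vset s" | "x \<in> vset t" "y \<in> vset t"
    | "x \<in> vset s" "y \<in> vset t" | "x \<in> vset t" "y \<in> vset s"
    using Join.prems by auto
  then show ?case
  proof cases
    case 1
    then obtain p where "walk (slinks s) x p y" "length p \<le> diam s"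
      using Join.IH by auto
    then show ?thesis
      by (intro exI[of _ p]) (force simp: walk_def)
  next
    case 2
    then obtain p where "walk (slinks t) x p y" "length p \<le> diam t"
      using Join.IH by auto
    then show ?thesis
      by (intro exI[of _ p]) (force simp: walk_def)
  next
    case 3
    then show ?thesis
      using walk_across[of x s y t] by fastforce
  next
    case 4
    then obtain p where p: "walk (slinks (Join s t)) y p x" "length p \<le> height s + height t + 1"
      using walk_across[of y s x t] by blast
    then show ?thesis
      using walk_reverse[OF sym_slinks p(1)] by fastforce
  qed
qed (auto intro: exI[of _ "[]"])

text \<open>An integer potential that changes by at most 1 along every arc bounds walk lengths from
  below. A suitable potential thus certifies a distance without an analysis of shortest
  walks.\<close>

definition unit_steps :: "'a rel \<Rightarrow> ('a \<Rightarrow> int) \<Rightarrow> bool" where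
  "unit_steps A h \<longleftrightarrow> (\<forall>(x, y) \<in> A. \<bar>h x - h y\<bar> \<le> 1)"

lemma unit_steps_walk:
  "unit_steps A h \<Longrightarrow> walk A u p v \<Longrightarrow> h v - h u \<le> int (length p)"
proof (induction p arbitrary: u)
  case (Cons e p)
  have "\<bar>h (fst e) - h (snd e)\<bar> \<le> 1"
    using Cons.prems by (auto simp: unit_steps_def split: prod.splits)
  moreover have "h v - h (snd e) \<le> int (length p)"
    using Cons by simp
  ultimately show ?case
    using Cons.prems by simp
qed simp

lemma unit_steps_slinks: "unit_steps (slinks t) h \<longleftrightarrow> unit_steps (links t) h"
  by (auto simp: unit_steps_def slinks_def)

lemma unit_steps_cong:
  assumes "unit_steps (links s) h" "\<And>x. x \<in> vset s \<Longrightarrow> h' x = h x + c"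
  shows "unit_steps (links s) h'"
  using assms by (fastforce simp: unit_steps_def dest: links_in_vset)

lemma unit_steps_cong_minus:
  assumes "unit_steps (links s) h" "\<And>x. x \<in> vset s \<Longrightarrow> h' x = - h x"
  shows "unit_steps (links s) h'"
  using assms by (fastforce simp: unit_steps_def dest: links_in_vset)

lemma unit_steps_insert: "unit_steps (insert (x, y) A) h \<longleftrightarrow> \<bar>h x - h y\<bar> \<le> 1 \<and> unit_steps A h"
  by (auto simp: unit_steps_def)

lemma unit_steps_Un: "unit_steps (A \<union> B) h \<longleftrightarrow> unit_steps A h \<and> unit_steps B h"
  by (auto simp: unit_steps_def)

text \<open>The depth below the apex serves as the potential; in a child it is the child's own depth
  shifted by 1.\<close>

lemma height_potential:
  "good t \<Longrightarrow> \<exists>h. unit_steps (links t) h \<and> h (apex t) = 0 \<and> (\<exists>x \<in> vset t. h x = int (height t))"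
proof (induction t)
  case (Vertex a)
  then show ?case
    by (auto simp: unit_steps_def intro: exI[of _ "\<lambda>_. 0"])
next
  case (Join s t)
  then obtain h1 x1 h2 x2 where
    h1: "unit_steps (links s) h1" "h1 (apex s) = 0" "x1 \<in> vset s" "h1 x1 = int (height s)" and
    h2: "unit_steps (links t) h2" "h2 (apex t) = 0" "x2 \<in> vset t" "h2 x2 = int (height t)"
    by auto
  define h where "h x = (if x \<in> vset t then h2 x + 1 else h1 x)" for x
  have disj: "x \<notin> vset t" if "x \<in> vset s" for x
    using that Join.prems by auto
  have hs: "h x = h1 x" if "x \<in> vset s" for x
    using disj[OF that] by (simp add: h_def)
  have ht: "h x = h2 x + 1" if "x \<in> vset t" for x
    using that by (simp add: h_def)
  have "unit_steps (links s) h"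
    using h1(1) by (rule unit_steps_cong[where c = 0]) (simp add: hs)
  moreover have "unit_steps (links t) h"
    using h2(1) by (rule unit_steps_cong[where c = 1]) (simp add: ht)
  ultimately have "unit_steps (links (Join s t)) h"
    using h1(2) h2(2) by (simp add: unit_steps_insert unit_steps_Un hs ht)
  moreover have "\<exists>x \<in> vset (Join s t). h x = int (height (Join s t))"
  proof (cases "height s \<ge> height t + 1")
    case True
    then show ?thesis
      using h1(3,4) by (intro bexI[of _ x1]) (auto simp: hs max_def)
  next
    case False
    then show ?thesis
      using h2(3,4) by (intro bexI[of _ x2]) (auto simp: ht max_def)
  qed
  moreover have "h (apex (Join s t)) = 0"
    using h1(2) by (simp add: hs)
  ultimately show ?case
    by blast
qed

text \<open>If the longest path crosses the top link, the potential is the depth in \<open>t\<close>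
  plus 1 on one side and minus the depth in \<open>s\<close> on the other. If it stays in one part,
  the potential of that part is continued to the other by a constant.\<close>

lemma diam_potential:
  "good t \<Longrightarrow> \<exists>h. unit_steps (links t) h \<and> (\<exists>x \<in> vset t. \<exists>y \<in> vset t. h y - h x = int (diam t))"
proof (induction t)
  case (Vertex a)
  then show ?case
    by (auto simp: unit_steps_def)
next
  case (Join s t)
  have disj: "x \<notin> vset t" if "x \<in> vset s" for x
    using that Join.prems by auto
  consider "diam (Join s t) = diam s" | "diam (Join s t) = diam t"
    | "diam (Join s t) = height s + height t + 1"
    by (metis diam.simps(2) max_def)
  then show ?case
  proof cases
    case 1
    obtain h x y where h: "unit_steps (links s) h" "x \<in> vset s" "y \<in> vset s" "h y - h x = int (diam s)"
      using Join by auto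
    define g where "g z = (if z \<in> vset t then h (apex s) else h z)" for z
    have "unit_steps (links s) g"
      using h(1) by (rule unit_steps_cong[where c = 0]) (auto simp: g_def disj)
    moreover have "unit_steps (links t) g"
      by (auto simp: unit_steps_def g_def dest: links_in_vset)
    ultimately have "unit_steps (links (Join s t)) g"
      by (simp add: unit_steps_insert unit_steps_Un g_def disj)
    moreover have "g y - g x = int (diam s)"
      using h by (simp add: g_def disj)
    ultimately show ?thesis
      using h 1 by (intro exI[of _ g]) auto
  next
    case 2
    obtain h x y where h: "unit_steps (links t) h" "x \<in> vset t" "y \<in> vset t" "h y - h x = int (diam t)"
      using Join by auto
    define g where "g z = (if z \<in> vset t then h z else h (apex t))" for z
    have "unit_steps (links t) g"
      using h(1) by (rule unit_steps_cong[where c = 0]) (auto simp: g_def)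
    moreover have "unit_steps (links s) g"
      by (auto simp: unit_steps_def g_def disj dest!: links_in_vset)
    ultimately have "unit_steps (links (Join s t)) g"
      by (simp add: unit_steps_insert unit_steps_Un g_def disj)
    moreover have "g y - g x = int (diam t)"
      using h by (simp add: g_def)
    ultimately show ?thesis
      using h 2 by (intro exI[of _ g]) auto
  next
    case 3
    obtain h1 x1 where
      h1: "unit_steps (links s) h1" "h1 (apex s) = 0" "x1 \<in> vset s" "h1 x1 = int (height s)"
      using Join.prems height_potential[of s] by auto
    obtain h2 x2 where
      h2: "unit_steps (links t) h2" "h2 (apex t) = 0" "x2 \<in> vset t" "h2 x2 = int (height t)"
      using Join.prems height_potential[of t] by auto
    define h where "h x = (if x \<in> vset t then h2 x + 1 else - h1 x)" for x
    have hs: "h x = - h1 x" if "x \<in> vset s" for x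
      using disj[OF that] by (simp add: h_def)
    have ht: "h x = h2 x + 1" if "x \<in> vset t" for x
      using that by (simp add: h_def)
    have "unit_steps (links s) h"
      using h1(1) by (rule unit_steps_cong_minus) (simp add: hs)
    moreover have "unit_steps (links t) h"
      using h2(1) by (rule unit_steps_cong[where c = 1]) (simp add: ht)
    ultimately have "unit_steps (links (Join s t)) h"
      using h1(2) h2(2) by (simp add: unit_steps_insert unit_steps_Un hs ht)
    moreover have "h x2 - h x1 = int (diam (Join s t))"
      unfolding 3 using h1 h2 by (simp add: hs ht)
    ultimately show ?thesis
      using h1(3) h2(3) by (metis UnI1 UnI2 vset.simps(2))
  qed
qed

lemma (in wf_digraph) awalk_cost_one: "awalk_cost (\<lambda>_. 1) p = real (length p)"
  by (simp add: awalk_cost_def sum_list_triv)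

lemma diameter_of_graph_of:
  assumes "good t"
  shows "diameter_of (graph_of t) = ereal (real (diam t))"
proof -
  interpret pair_graph "graph_of t"
    by (rule pair_graph_graph_of[OF assms])
  have mu: "\<mu> (\<lambda>_. 1) u v = (INF p \<in> {p. u \<in> vset t \<and> walk (slinks t) u p v}. ereal (real (length p)))" for u v
    unfolding \<mu>_def awalk_graph_of awalk_cost_one ..
  have "\<mu> (\<lambda>_. 1) u v \<le> ereal (real (diam t))" if "u \<in> vset t" "v \<in> vset t" for u v
  proof -
    obtain p where "walk (slinks t) u p v" "length p \<le> diam t"
      using short_walk[OF \<open>u \<in> vset t\<close> \<open>v \<in> vset t\<close>] by blast
    then show ?thesis
      unfolding mu using that by (intro INF_lower2[of p]) auto
  qed
  moreover obtain h x y where h: "unit_steps (links t) h" "x \<in> vset t" "y \<in> vset t" "h y - h x = int (diam t)"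
    using diam_potential[OF assms] by blast
  have "ereal (real (diam t)) \<le> \<mu> (\<lambda>_. 1) x y"
    unfolding mu
  proof (rule INF_greatest)
    fix p assume "p \<in> {p. x \<in> vset t \<and> walk (slinks t) x p y}"
    then have "h y - h x \<le> int (length p)"
      by (intro unit_steps_walk[of "slinks t"]) (use h(1) in \<open>auto simp: unit_steps_slinks\<close>)
    then show "ereal (real (diam t)) \<le> ereal (real (length p))"
      using h(4) by simp
  qed
  ultimately show ?thesis
    unfolding diameter_of_def using h(2,3)
    by (intro antisym SUP_least) (auto intro: SUP_upper2[of "(x, y)"])
qed

text \<open>A single link joins \<open>s\<close> and \<open>t\<close>. A closed sequence that meets
  both must pass it in both directions, and as the vertices at positions 1 to \<open>k\<close> are
  distinct, the two passages are adjacent along the cycle; this leaves only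
  \<open>k \<le> 2\<close>.\<close>

lemma no_long_cycle:
  "good t \<Longrightarrow> 3 \<le> k \<Longrightarrow> \<forall>i<k. (x i, x (Suc i)) \<in> slinks t \<Longrightarrow> x k = x 0 \<Longrightarrow> inj_on x {1..k} \<Longrightarrow> False"
proof (induction t)
  case (Join s t)
  note steps = Join.prems(3) and closed = Join.prems(4) and inj = Join.prems(5)
  have disj: "vset s \<inter> vset t = {}" and gs: "good s" "good t"
    using Join.prems by auto
  have below: "x i \<in> vset s \<union> vset t" if "i < k" for i
    using steps[rule_format, OF that] slinks_in_vset[of "x i" "x (Suc i)" "Join s t"]
    by (simp del: slinks_simps)
  have in_vset: "x i \<in> vset s \<union> vset t" if "i \<le> k" for i
    using below[of i] below[of 0] closed that Join.prems(2) by (cases "i = k") auto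
  have step_cases: "(x i \<in> vset s \<and> x (Suc i) \<in> vset s \<longrightarrow> (x i, x (Suc i)) \<in> slinks s) \<and>
      (x i \<in> vset t \<and> x (Suc i) \<in> vset t \<longrightarrow> (x i, x (Suc i)) \<in> slinks t) \<and>
      (x i \<in> vset s \<and> x (Suc i) \<in> vset t \<longrightarrow> x i = apex s \<and> x (Suc i) = apex t) \<and>
      (x i \<in> vset t \<and> x (Suc i) \<in> vset s \<longrightarrow> x i = apex t \<and> x (Suc i) = apex s)" if "i < k" for i
  proof -
    have "apex s \<notin> vset t" "apex t \<notin> vset s"
      using disj apex_in_vset[of s] apex_in_vset[of t] by blast+
    then show ?thesis
      using steps[rule_format, OF that] disj slinks_in_vset[of "x i" "x (Suc i)" s]
        slinks_in_vset[of "x i" "x (Suc i)" t]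
      by auto
  qed
  have cross: "\<exists>i<k. x i \<in> A \<and> x (Suc i) \<in> B"
    if "a \<le> k" "x a \<in> A" "b \<le> k" "x b \<in> B" "A \<inter> B = {}" "A \<union> B = vset s \<union> vset t" for A B a b
  proof (rule ccontr)
    assume neg: "\<not> ?thesis"
    have AB: "x i \<in> A \<Longrightarrow> i < k \<Longrightarrow> x (Suc i) \<in> A" for i
      using neg in_vset[of "Suc i"] that(6) by auto
    have up: "x (i + j) \<in> A" if "x i \<in> A" "i + j \<le> k" for i j
      using that by (induction j) (auto intro: AB)
    \<comment> \<open>Since \<open>b\<close> may precede \<open>a\<close>, membership is carried on
      to position \<open>k\<close> and, as the sequence is closed, from position 0 up to
      \<open>b\<close>.\<close>
    have "x k \<in> A"
      using up[of a "k - a"] that by simp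
    then have "x 0 \<in> A"
      using closed by simp
    then have "x b \<in> A"
      using up[of 0 b] that by simp
    then show False
      using that by auto
  qed
  consider "\<forall>i\<le>k. x i \<in> vset s" | "\<forall>i\<le>k. x i \<in> vset t"
    | a b where "a \<le> k" "x a \<in> vset s" "b \<le> k" "x b \<in> vset t"
    using in_vset by auto
  then show False
  proof cases
    case 1
    then have "(x i, x (Suc i)) \<in> slinks s" if "i < k" for i
      using step_cases[OF that] that by simp
    then show False
      using Join.IH(1)[OF gs(1) Join.prems(2) _ closed inj] by simp
  next
    case 2
    then have "(x i, x (Suc i)) \<in> slinks t" if "i < k" for i
      using step_cases[OF that] that by simp
    then show False
      using Join.IH(2)[OF gs(2) Join.prems(2) _ closed inj] by simp
  next
    case 3
    obtain i where i: "i < k" "x i \<in> vset s" "x (Suc i) \<in> vset t"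
      using cross[of a "vset s" b "vset t"] 3 disj by auto
    obtain j where j: "j < k" "x j \<in> vset t" "x (Suc j) \<in> vset s"
      using cross[of b "vset t" a "vset s"] 3 disj by auto
    have e: "x (Suc i) = x j" "x (Suc j) = x i"
    proof -
      have "x i = apex s" "x (Suc i) = apex t"
        using step_cases[OF i(1)] i(2,3) by blast+
      moreover have "x j = apex t" "x (Suc j) = apex s"
        using step_cases[OF j(1)] j(2,3) by blast+
      ultimately show "x (Suc i) = x j" "x (Suc j) = x i"
        by (simp_all only:)
    qed
    \<comment> \<open>Injectivity covers the positions 1 to \<open>k\<close> only, so position 0 is
      read as position \<open>k\<close>.\<close>
    have "Suc i = j \<or> j = 0 \<and> Suc i = k"
    proof (cases "j = 0")
      case True
      then show ?thesis
        using e(1) closed i(1) inj_onD[OF inj, of "Suc i" k] by auto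
    next
      case False
      then show ?thesis
        using e(1) i(1) j(1) inj_onD[OF inj, of "Suc i" j] by auto
    qed
    moreover have "Suc j = i \<or> i = 0 \<and> Suc j = k"
    proof (cases "i = 0")
      case True
      then show ?thesis
        using e(2) closed j(1) inj_onD[OF inj, of "Suc j" k] by auto
    next
      case False
      then show ?thesis
        using e(2) i(1) j(1) inj_onD[OF inj, of "Suc j" i] by auto
    qed
    ultimately show False
      using Join.prems(2) by auto
  qed
qed (auto dest: spec[of _ 0])

lemma pcas_nth:
  "pcas u p v \<Longrightarrow> i < length p \<Longrightarrow> p ! i = (pawalk_verts u p ! i, pawalk_verts u p ! Suc i)"
proof (induction p arbitrary: u i)
  case (Cons e p)
  then show ?case
    by (cases i; cases e; cases p) auto
qed simp

lemma length_pawalk_verts: "length (pawalk_verts u p) = Suc (length p)"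
  by (induction p arbitrary: u) auto

lemma pawalk_verts_nth_0: "pcas u p v \<Longrightarrow> pawalk_verts u p ! 0 = u"
  by (cases p) auto

lemma pawalk_verts_nth_last: "pcas u p v \<Longrightarrow> pawalk_verts u p ! length p = v"
  by (induction p arbitrary: u) auto

lemma pawalk_verts_nth_tl: "1 \<le> i \<Longrightarrow> i \<le> length p \<Longrightarrow> tl (pawalk_verts u p) ! (i - 1) = pawalk_verts u p ! i"
  by (subst nth_tl) (simp_all add: length_pawalk_verts)

lemma no_cycle_graph_of:
  assumes "good t" "pre_digraph.cycle (with_proj (graph_of t)) p" "length p \<ge> 3"
  shows False
proof -
  obtain u where u: "walk (slinks t) u p u" "distinct (tl (pawalk_verts u p))"
    using assms(2) by (auto simp: pre_digraph.cycle_def awalk_graph_of awalk_verts_with_proj_eq)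
  define x where "x = nth (pawalk_verts u p)"
  have "\<forall>i<length p. (x i, x (Suc i)) \<in> slinks t"
    using u(1) by (metis nth_mem pcas_nth subset_eq walk_def x_def)
  moreover have "x (length p) = x 0"
    using u(1) pawalk_verts_nth_0[of u p u] pawalk_verts_nth_last[of u p u]
    by (simp add: walk_def x_def)
  moreover have "inj_on x {1..length p}"
  proof (rule inj_onI)
    fix i j assume ij: "i \<in> {1..length p}" "j \<in> {1..length p}" "x i = x j"
    have "tl (pawalk_verts u p) ! (i - 1) = tl (pawalk_verts u p) ! (j - 1)"
      using ij pawalk_verts_nth_tl[of i p u] pawalk_verts_nth_tl[of j p u] by (simp add: x_def)
    then have "i - 1 = j - 1"
      using ij by (intro nth_eq_iff_index_eq[THEN iffD1, OF u(2)]) (auto simp: length_pawalk_verts)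
    then show "i = j"
      using ij by auto
  qed
  ultimately show False
    using no_long_cycle[OF assms(1,3)] by blast
qed

lemma reachable_graph_of:
  assumes "good t" "x \<in> vset t" "y \<in> vset t"
  shows "x \<rightarrow>\<^sup>*\<^bsub>with_proj (graph_of t)\<^esub> y"
proof -
  interpret pair_graph "graph_of t"
    by (rule pair_graph_graph_of[OF assms(1)])
  show ?thesis
    using short_walk[OF assms(2,3)] assms(2) by (auto simp: reachable_awalk awalk_graph_of)
qed

lemma mk_symmetric_pair_sym:
  assumes "sym (parcs T)"
  shows "mk_symmetric (with_proj T) = T"
proof -
  have "(\<Union>e\<in>parcs T. {(fst e, snd e), (snd e, fst e)}) = parcs T"
    using assms by (auto dest: symD)
  then show ?thesis
    by (simp add: mk_symmetric_def)
qed

lemma undirected_tree_graph_of: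
  assumes "good t"
  shows "undirected_tree (graph_of t)"
proof -
  have "connected (with_proj (graph_of t))"
    using reachable_graph_of[OF assms]
    by (auto simp: connected_def strongly_connected_def mk_symmetric_pair_sym sym_slinks)
  then show ?thesis
    using pair_graph_graph_of[OF assms] no_cycle_graph_of[OF assms]
    by (auto simp: undirected_tree_def)
qed

section \<open>Undirected trees as rooted trees\<close>

primrec attach :: "'a rtree \<Rightarrow> 'a \<Rightarrow> 'a rtree \<Rightarrow> 'a rtree" where
  "attach (Vertex a) z w = Join (Vertex a) w"
| "attach (Join s t) z w = (if z \<in> vset s then Join (attach s z w) t else Join s (attach t z w))"

lemma vset_attach: "vset (attach t z w) = vset t \<union> vset w"
  by (induction t) auto

lemma apex_attach [simp]: "apex (attach t z w) = apex t"
  by (induction t) auto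

lemma links_attach: "z \<in> vset t \<Longrightarrow> links (attach t z w) = insert (z, apex w) (links t \<union> links w)"
  by (induction t) auto

lemma good_attach: "good t \<Longrightarrow> good w \<Longrightarrow> vset t \<inter> vset w = {} \<Longrightarrow> good (attach t z w)"
  by (induction t) (auto simp: vset_attach)

lemma card_vset_Join: "good (Join s t) \<Longrightarrow> card (vset (Join s t)) = card (vset s) + card (vset t)"
  by (simp add: card_Un_disjoint)

text \<open>A rooted subtree of \<open>T\<close> with as many vertices as possible spans
  \<open>T\<close>, since an arc leaving it would allow another vertex to be attached. An arc of
  \<open>T\<close> missing from it would close a cycle with the path between its ends, which has at
  least two arcs.\<close>

lemma rtree_of_undirected_tree:
  assumes "undirected_tree T"
  shows "\<exists>t. good t \<and> T = graph_of t"
proof -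
  interpret pair_graph T
    using assms by (simp add: undirected_tree_def)
  have sym: "sym (parcs T)"
    using sym_arcs by (simp add: symmetric_def)
  have conn: "pverts T \<noteq> {}" "\<And>u v. u \<in> pverts T \<Longrightarrow> v \<in> pverts T \<Longrightarrow> u \<rightarrow>\<^sup>*\<^bsub>with_proj T\<^esub> v"
    using assms by (auto simp: undirected_tree_def connected_def strongly_connected_def mk_symmetric_pair_sym[OF sym])
  define P where "P t \<longleftrightarrow> good t \<and> vset t \<subseteq> pverts T \<and> links t \<subseteq> parcs T" for t
  obtain o' where "o' \<in> pverts T"
    using conn by auto
  then have "P (Vertex o')"
    by (simp add: P_def)
  moreover have "\<forall>t. P t \<longrightarrow> card (vset t) \<le> card (pverts T)"
    by (auto simp: P_def intro: card_mono)
  ultimately obtain t where t: "P t" and max: "\<And>s. P s \<Longrightarrow> card (vset s) \<le> card (vset t)"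
    using ex_has_greatest_nat[of P "Vertex o'" "\<lambda>t. card (vset t)" "card (pverts T) + 1"]
    by (auto simp: less_Suc_eq_le)
  have gt: "good t" and sub: "vset t \<subseteq> pverts T" "slinks t \<subseteq> parcs T"
    using t sym by (auto simp: P_def slinks_def dest: symD)
  have step: "y \<in> vset t" if "x \<in> vset t" "(x, y) \<in> parcs T" for x y
  proof (rule ccontr)
    assume "y \<notin> vset t"
    then have "P (attach t x (Vertex y))"
      using t that in_arcsD2 by (auto simp: P_def vset_attach links_attach good_attach)
    then have "card (vset (attach t x (Vertex y))) \<le> card (vset t)"
      by (rule max)
    then show False
      using \<open>y \<notin> vset t\<close> by (simp add: vset_attach)
  qed
  have stay: "pcas x p y \<Longrightarrow> set p \<subseteq> parcs T \<Longrightarrow> x \<in> vset t \<Longrightarrow> y \<in> vset t" for p x y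
    by (induction p arbitrary: x) (auto dest: step[rotated])
  have "pverts T \<subseteq> vset t"
  proof
    fix y assume "y \<in> pverts T"
    moreover have "apex t \<in> pverts T"
      using sub(1) by auto
    ultimately obtain p where "awalk (apex t) p y"
      using conn(2) reachable_awalk by blast
    then show "y \<in> vset t"
      using stay[of "apex t" p y] by (simp add: awalk_def)
  qed
  with sub have V: "vset t = pverts T"
    by simp
  have "parcs T \<subseteq> slinks t"
  proof (rule ccontr)
    assume "\<not> ?thesis"
    then obtain x y where xy: "(x, y) \<in> parcs T" "(x, y) \<notin> slinks t"
      by auto
    have neq: "x \<noteq> y"
      using pair_no_loops[OF xy(1)] by simp
    have xyV: "x \<in> vset t" "y \<in> vset t"
      using xy(1) in_arcsD1 in_arcsD2 V by auto
    interpret S: pair_graph "graph_of t"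
      by (rule pair_graph_graph_of[OF gt])
    obtain p where p: "S.apath x p y"
      using reachable_graph_of[OF gt xyV] S.reachable_apath by blast
    then have walk: "walk (slinks t) x p y" and dist: "distinct (pawalk_verts x p)"
      by (auto simp: S.apath_def awalk_graph_of)
    have "p \<noteq> []"
      using walk neq by auto
    moreover have "length p \<noteq> 1"
      using walk xy(2) by (auto simp: length_Suc_conv)
    ultimately have "length ((y, x) # p) \<ge> 3"
      by (cases p; cases "tl p") auto
    moreover have "cycle ((y, x) # p)"
      unfolding cycle_def using walk dist sub xy(1) sym xyV V
      by (intro exI[of _ y]) (auto simp: awalk_def walk_def dest: symD)
    ultimately show False
      using assms by (auto simp: undirected_tree_def)
  qed
  with sub have "parcs T = slinks t"
    by simp
  then show ?thesis
    using gt V by (intro exI[of _ t]) (simp add: graph_of_def)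
qed

section \<open>The central edge\<close>

lemma diam_le_height: "diam t \<le> 2 * height t"
  by (induction t) (auto simp: max_def)

text \<open>Children may be joined in any order without changing the graph. A deepest one is moved
  to the end, where its link can serve as the new top link.\<close>

lemma deepest_child:
  "good t \<Longrightarrow> height t > 0 \<Longrightarrow> \<exists>a b. good (Join a b) \<and> vset (Join a b) = vset t \<and>
     links (Join a b) = links t \<and> apex a = apex t \<and> height b + 1 = height t"
proof (induction t)
  case (Join s t)
  show ?case
  proof (cases "height t + 1 = height (Join s t)")
    case True
    then show ?thesis
      using Join.prems by (intro exI[of _ s] exI[of _ t]) auto
  next
    case False
    then have "height (Join s t) = height s" "height s > 0"
      by auto
    then obtain a b where ab: "good (Join a b)" "vset (Join a b) = vset s"
      "links (Join a b) = links s" "apex a = apex s" "height b + 1 = height s"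
      using Join.IH(1) Join.prems by auto
    have "good (Join (Join a t) b)"
      using ab(1,2) Join.prems by auto
    moreover have "vset (Join (Join a t) b) = vset (Join s t)"
      using ab(2) by auto
    moreover have "links (Join (Join a t) b) = links (Join s t)"
      using ab(3,4) by auto
    ultimately show ?thesis
      using ab(4,5) \<open>height (Join s t) = height s\<close>
      by (intro exI[of _ "Join a t"] exI[of _ b]) auto
  qed
qed simp

lemma diam_invariant:
  "good s \<Longrightarrow> good t \<Longrightarrow> graph_of s = graph_of t \<Longrightarrow> diam s = diam t"
  using diameter_of_graph_of[of s] diameter_of_graph_of[of t] by simp

lemma graph_of_Join_commute: "graph_of (Join s t) = graph_of (Join t s)"
  by (auto simp: graph_of_eq_iff)

text \<open>Among all splits of the graph at a link, one with the smallest larger height is chosen.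
  If one side were higher, passing to the link into its deepest child would lower the larger height,
  unless two paths of that full height meet in one vertex; but then the diameter would be
  even.\<close>

lemma central_link:
  assumes "good t" "diam t = 2 * r + 1"
  shows "\<exists>a b. good (Join a b) \<and> graph_of (Join a b) = graph_of t \<and> height a = r \<and> height b = r"
proof -
  define P where "P = (\<lambda>(a, b). good (Join a b) \<and> graph_of (Join a b) = graph_of t)"
  obtain a0 b0 where "t = Join a0 b0"
    using assms(2) by (cases t) auto
  then have "P (a0, b0)"
    using assms by (simp add: P_def)
  then obtain x where x: "P x" "\<And>y. P y \<Longrightarrow> max (height (fst x)) (height (snd x)) \<le> max (height (fst y)) (height (snd y))"
    using ex_has_least_nat[of P "(a0, b0)" "\<lambda>x. max (height (fst x)) (height (snd x))"] by blast
  define a b where "a = fst x" and "b = snd x"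
  have ab: "P (a, b)" and min: "\<And>c d. P (c, d) \<Longrightarrow> max (height a) (height b) \<le> max (height c) (height d)"
    using x(1) x(2)[of "(c, d)" for c d] by (simp_all add: a_def b_def)
  have key: False
    if ab: "P (a, b)" and lt: "height a < height b"
      and min: "\<And>c d. P (c, d) \<Longrightarrow> max (height a) (height b) \<le> max (height c) (height d)" for a b
  proof -
    have gab: "good a" "good b" "vset a \<inter> vset b = {}" "graph_of (Join a b) = graph_of t"
      using ab by (auto simp: P_def)
    obtain c d where cd: "good (Join c d)" "vset (Join c d) = vset b"
      "links (Join c d) = links b" "apex c = apex b" "height d + 1 = height b"
      using deepest_child[OF gab(2)] lt by auto
    have g: "good (Join (Join c a) d)"
      using cd(1,2) gab by auto
    have "slinks (Join c d) = slinks b"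
      using cd(3) by (simp add: slinks_def)
    then have "slinks (Join (Join c a) d) = slinks (Join a b)"
      using cd(4) by auto
    moreover have "vset (Join (Join c a) d) = vset (Join a b)"
      using cd(2) by auto
    ultimately have gr: "graph_of (Join (Join c a) d) = graph_of t"
      using gab(4) by (simp add: graph_of_def)
    have bcd: "diam b = diam (Join c d)"
      using cd by (intro diam_invariant gab graph_of_eqI) auto
    have dab: "diam (Join a b) = 2 * r + 1"
      using diam_invariant[OF _ assms(1) gab(4)] assms(2) gab by simp
    have "P (Join c a, d)"
      using g gr by (simp add: P_def)
    then have "height b \<le> max (max (height c) (height a + 1)) (height d)"
      using min[of "Join c a" d] lt by auto
    then have "height c = height b \<or> height a + 1 = height b \<or> height c > height b"
      using cd(5) lt by auto
    then have "diam (Join a b) \<ge> 2 * height b"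
      using cd(5) bcd by auto
    moreover have "diam (Join a b) \<le> 2 * height b"
      using diam_le_height[of a] diam_le_height[of b] lt by simp
    ultimately have "2 * r + 1 = 2 * height b"
      unfolding dab[symmetric] by (rule antisym[rotated])
    then show False
      by presburger
  qed
  have "P (b, a)"
    using ab graph_of_Join_commute[of a b] by (auto simp: P_def)
  then have "height a = height b"
    using key[OF ab _ min] key[of b a] min by (metis linorder_neqE_nat max.commute)
  moreover have "diam (Join a b) = 2 * r + 1"
    using ab assms diam_invariant[of "Join a b" t] by (auto simp: P_def)
  ultimately have "height a = r"
    using diam_le_height[of a] diam_le_height[of b] by auto
  then show ?thesis
    using ab \<open>height a = height b\<close> by (auto simp: P_def)
qed

section \<open>Branches and spiders\<close>

text \<open>
  Long-path decomposition: of the paths that come up from the leaves and meet in a vertex,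
  only one of maximal length continues through the link above. The branches are the lengths of
  the resulting paths, which partition the links.
\<close>

primrec branches :: "'a rtree \<Rightarrow> nat multiset" where
  "branches (Vertex a) = {#}"
| "branches (Join s t) = branches s + add_mset (height t + 1) (branches t - {#height t#})"

text \<open>\<open>size (branches t) \<le> 1\<close> says that the child is a bare path, so these
  are the spiders rooted at their center, including the single vertex and the path rooted at its
  end.\<close>

primrec spidery :: "'a rtree \<Rightarrow> bool" where
  "spidery (Vertex a) \<longleftrightarrow> True"
| "spidery (Join s t) \<longleftrightarrow> spidery s \<and> spidery t \<and> size (branches t) \<le> 1"

lemma height_in_branches: "height t > 0 \<Longrightarrow> height t \<in># branches t"
  by (induction t) (auto simp: max_def)

lemma height_eq_0_iff: "height t = 0 \<longleftrightarrow> (\<exists>a. t = Vertex a)"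
  by (cases t) auto

lemma branches_bounds: "l \<in># branches t \<Longrightarrow> 1 \<le> l \<and> l \<le> height t"
  by (induction t) (fastforce dest: in_diffD)+

lemma sum_branches: "good t \<Longrightarrow> Suc (sum_mset (branches t)) = card (vset t)"
proof (induction t)
  case (Join s t)
  have "sum_mset (branches t - {#height t#}) + height t = sum_mset (branches t)"
  proof (cases "height t = 0")
    case True
    then show ?thesis
      by (auto simp: height_eq_0_iff)
  next
    case False
    then show ?thesis
      using height_in_branches[of t] by (simp add: sum_mset.remove)
  qed
  then show ?case
    using Join by (simp add: card_Un_disjoint)
qed simp

lemma branches_path:
  assumes "size (branches t) \<le> 1"
  shows "branches t - {#height t#} = {#}" "branches t = (if height t = 0 then {#} else {#height t#})"
proof -
  show *: "branches t = (if height t = 0 then {#} else {#height t#})"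
  proof (cases "height t = 0")
    case True
    then show ?thesis
      by (auto simp: height_eq_0_iff)
  next
    case False
    then show ?thesis
      using height_in_branches[of t] assms by (auto dest!: multi_member_split)
  qed
  show "branches t - {#height t#} = {#}"
    by (subst *) auto
qed

text \<open>The legs of a spider may be joined in any order. Bringing a leg of given length to the
  end drives the induction in \<open>spidery_iso\<close> and the choice of the central edge in
  \<open>spidery_central\<close>.\<close>

lemma branch_as_child:
  "good t \<Longrightarrow> spidery t \<Longrightarrow> l \<in># branches t \<Longrightarrow>
     \<exists>a b. good (Join a b) \<and> vset (Join a b) = vset t \<and> links (Join a b) = links t \<and> apex a = apex t \<and>
       spidery (Join a b) \<and> height b + 1 = l \<and> branches (Join a b) = branches t"
proof (induction t)
  case (Join s t)
  show ?case
  proof (cases "l = height t + 1")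
    case True
    then show ?thesis
      using Join.prems by (intro exI[of _ s] exI[of _ t]) simp
  next
    case False
    then have "l \<in># branches s"
      using Join.prems branches_path(1)[of t] by auto
    then obtain a b where ab: "good (Join a b)" "vset (Join a b) = vset s"
      "links (Join a b) = links s" "apex a = apex s" "spidery (Join a b)" "height b + 1 = l"
      "branches (Join a b) = branches s"
      using Join.IH(1) Join.prems by auto
    have "good (Join (Join a t) b)"
      using ab(1,2) Join.prems by auto
    moreover have "vset (Join (Join a t) b) = vset (Join s t)"
      using ab(2) by auto
    moreover have "links (Join (Join a t) b) = links (Join s t)"
      using ab(3,4) by auto
    moreover have "spidery (Join (Join a t) b)"
      using ab(5) Join.prems by auto
    moreover have "branches (Join (Join a t) b) = branches (Join s t)"
      using ab(7) by auto
    ultimately show ?thesis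
      using ab(4,6) by (intro exI[of _ "Join a t"] exI[of _ b]) auto
  qed
qed simp

lemma branches_spidery_Join:
  assumes "spidery (Join s t)"
  shows "branches (Join s t) = add_mset (height t + 1) (branches s)"
  using assms branches_path(1)[of t] by simp

section \<open>Isomorphism of spiders\<close>

lemma links_map_prod_cong:
  assumes "\<And>x. x \<in> vset t \<Longrightarrow> f x = g x"
  shows "map_prod f f ` links t = map_prod g g ` links t"
  using assms by (intro image_cong) (auto dest!: links_in_vset)

text \<open>The last leg of \<open>s\<close> is matched with a leg of the same length in
  \<open>t\<close>, moved to the end. The isomorphisms of the legs and of the remainders can be
  glued because the vertex sets are disjoint.\<close>

lemma spidery_iso:
  "good s \<Longrightarrow> good t \<Longrightarrow> spidery s \<Longrightarrow> spidery t \<Longrightarrow> branches s = branches t \<Longrightarrow>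
     \<exists>f. inj_on f (vset s) \<and> f ` vset s = vset t \<and> f (apex s) = apex t \<and>
       map_prod f f ` links s = links t"
proof (induction s arbitrary: t)
  case (Vertex x)
  then have "t = Vertex (apex t)"
    by (cases t) auto
  then show ?case
    by (intro exI[of _ "\<lambda>_. apex t"]) (metis apex.simps(1) image_empty image_insert inj_on_def
        links.simps(1) singletonD vset.simps(1))
next
  case (Join s1 s2)
  have "height s2 + 1 \<in># branches t"
    using Join.prems(5) by (auto simp flip: Join.prems(5))
  then obtain t1 t2 where t': "good (Join t1 t2)" "vset (Join t1 t2) = vset t"
    "links (Join t1 t2) = links t" "apex t1 = apex t" "spidery (Join t1 t2)"
    "height t2 + 1 = height s2 + 1" "branches (Join t1 t2) = branches t"
    using branch_as_child[OF Join.prems(2,4)] by blast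
  have "branches s1 = branches t1"
    using Join.prems(5) branches_spidery_Join[OF Join.prems(3)] branches_spidery_Join[OF t'(5)] t'(6,7)
    by simp
  moreover have "branches s2 = branches t2"
    using branches_path(2)[of s2] branches_path(2)[of t2] Join.prems(3) t'(5,6) by simp
  ultimately obtain f g where
    f: "inj_on f (vset s1)" "f ` vset s1 = vset t1" "f (apex s1) = apex t1" "map_prod f f ` links s1 = links t1" and
    g: "inj_on g (vset s2)" "g ` vset s2 = vset t2" "g (apex s2) = apex t2" "map_prod g g ` links s2 = links t2"
    using Join.IH(1)[of t1] Join.IH(2)[of t2] Join.prems t' by auto
  define h where "h x = (if x \<in> vset s2 then g x else f x)" for x
  have h1: "h x = f x" if "x \<in> vset s1" for x
    using that Join.prems(1) by (auto simp: h_def)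
  have h2: "h x = g x" if "x \<in> vset s2" for x
    using that by (simp add: h_def)
  have im: "h ` vset s1 = vset t1" "h ` vset s2 = vset t2"
    using f(2) g(2) h1 h2 by (simp_all cong: image_cong)
  have "inj_on h (vset s1)" "inj_on h (vset s2)"
    using f(1) g(1) h1 h2 by (simp_all cong: inj_on_cong)
  then have "inj_on h (vset (Join s1 s2))"
    using im t'(1) by (auto simp: inj_on_Un)
  moreover have "h ` vset (Join s1 s2) = vset t"
    using im t'(2) by (auto simp: image_Un)
  moreover have "h (apex (Join s1 s2)) = apex t"
    using f(3) t'(4) h1 by simp
  moreover have "map_prod h h ` links (Join s1 s2) = links t"
    using f(3,4) g(3,4) h1 h2 t'(3) links_map_prod_cong[of s1 h f] links_map_prod_cong[of s2 h g]
    by (simp add: image_Un flip: t'(3))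
  ultimately show ?case
    by blast
qed

lemma graph_isomorphicI:
  assumes "pair_wf_digraph S" "inj_on f (pverts S)" "f ` pverts S = pverts T" "map_prod f f ` parcs S = parcs T"
  shows "graph_isomorphic S T"
proof -
  interpret pair_wf_digraph S
    by (rule assms(1))
  define hom where "hom = \<lparr>iso_verts = f, iso_arcs = map_prod f f, iso_head = snd, iso_tail = fst\<rparr>"
  have "inj_on (map_prod f f) (parcs S)"
  proof (rule inj_onI)
    fix d e assume "d \<in> parcs S" "e \<in> parcs S" "map_prod f f d = map_prod f f e"
    then show "d = e"
      using inj_onD[OF assms(2)] arc_fst_in_verts arc_snd_in_verts
      by (metis fst_map_prod snd_map_prod prod_eqI)
  qed
  then have "digraph_isomorphism hom"
    using assms(2) wf_digraph_axioms by (auto simp: digraph_isomorphism_def hom_def)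
  moreover have "with_proj T = app_iso hom (with_proj S)"
    using assms(3,4) by (auto simp: app_iso_def hom_def with_proj_def)
  ultimately show ?thesis
    by (auto simp: graph_isomorphic_def digraph_iso_def)
qed

lemma spidery_graph_isomorphic:
  assumes "good s" "good t" "spidery s" "spidery t" "branches s = branches t"
  shows "graph_isomorphic (graph_of s) (graph_of t)"
proof -
  obtain f where f: "inj_on f (vset s)" "f ` vset s = vset t" "map_prod f f ` links s = links t"
    using spidery_iso[OF assms] by auto
  have "map_prod f f ` slinks s = slinks t"
    unfolding slinks_def f(3)[symmetric] by (force simp: image_Un)
  then show ?thesis
    using f(1,2) pair_graph_graph_of[OF assms(1)]
    by (intro graph_isomorphicI[of _ f]) (auto simp: pair_graph_def pair_digraph_def pair_fin_digraph_def)
qed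

lemma vset_map_rtree: "vset (map_rtree f t) = f ` vset t"
  by (induction t) auto

lemma good_map_rtree: "good t \<Longrightarrow> inj_on f (vset t) \<Longrightarrow> good (map_rtree f t)"
  by (induction t) (auto simp: vset_map_rtree inj_on_Un)

lemma height_map_rtree [simp]: "height (map_rtree f t) = height t"
  by (induction t) auto

lemma branches_map_rtree [simp]: "branches (map_rtree f t) = branches t"
  by (induction t) auto

lemma spidery_map_rtree [simp]: "spidery (map_rtree f t) = spidery t"
  by (induction t) auto

lemma tree_class_graph_of:
  "good t \<Longrightarrow> tree_class n D (graph_of t) \<longleftrightarrow> card (vset t) = n \<and> diam t = D"
  by (simp add: tree_class_def undirected_tree_graph_of diameter_of_graph_of)

section \<open>Concrete spiders and paths as rooted trees\<close>

primrec stem :: "'a \<Rightarrow> 'a list \<Rightarrow> 'a rtree" where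
  "stem x [] = Vertex x"
| "stem x (y # ys) = Join (Vertex x) (stem y ys)"

lemma apex_stem [simp]: "apex (stem x ys) = x"
  by (cases ys) auto

lemma vset_stem [simp]: "vset (stem x ys) = insert x (set ys)"
  by (induction ys arbitrary: x) auto

lemma good_stem [simp]: "good (stem x ys) \<longleftrightarrow> distinct (x # ys)"
  by (induction ys arbitrary: x) auto

lemma height_stem [simp]: "height (stem x ys) = length ys"
  by (induction ys arbitrary: x) auto

lemma branches_stem [simp]: "branches (stem x ys) = (if ys = [] then {#} else {#length ys#})"
  by (induction ys arbitrary: x) auto

lemma spidery_stem [simp]: "spidery (stem x ys)"
  by (induction ys arbitrary: x) auto

lemma links_stem: "links (stem x ys) = (\<lambda>i. ((x # ys) ! i, ys ! i)) ` {..<length ys}"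
proof (induction ys arbitrary: x)
  case (Cons y ys)
  then show ?case
    by (simp add: lessThan_Suc_eq_insert_0 image_image)
qed simp

text \<open>A leg without the center: it starts at distance 1, so for \<open>l \<ge> 1\<close> it
  has \<open>l\<close> vertices but only \<open>l - 1\<close> links. The remaining link comes from
  the \<open>Join\<close> with the center.\<close>

definition ray :: "nat \<Rightarrow> nat \<Rightarrow> (nat \<times> nat) rtree" where
  "ray k l = stem (k, 1) (map (\<lambda>j. (k, j + 2)) [0..<l - 1])"

lemma apex_ray [simp]: "apex (ray k l) = (k, 1)"
  by (simp add: ray_def)

lemma height_ray [simp]: "height (ray k l) = l - 1"
  by (simp add: ray_def)

lemma branches_ray: "branches (ray k l) - {#l - Suc 0#} = {#}"
  by (simp add: ray_def)

lemma spidery_ray [simp]: "spidery (ray k l)" "size (branches (ray k l)) \<le> Suc 0"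
  by (simp_all add: ray_def)

lemma good_ray [simp]: "good (ray k l)"
  by (auto simp: ray_def distinct_map inj_on_def)

lemma vset_ray:
  assumes "1 \<le> l"
  shows "vset (ray k l) = Pair k ` {1..l}"
proof -
  have "set (map (\<lambda>j. (k, j + 2)) [0..<l - 1]) = Pair k ` (\<lambda>j. j + 2) ` {0..<l - 1}"
    by (simp add: image_image)
  also have "(\<lambda>j. j + 2) ` {0..<l - 1} = {2..<l - 1 + 2}"
    by (simp only: image_add_atLeastLessThan' add_0)
  finally have "vset (ray k l) = Pair k ` insert 1 {2..<l - 1 + 2}"
    by (simp add: ray_def)
  also have "insert 1 {2..<l - 1 + 2} = {1..l}"
    using assms by auto
  finally show ?thesis .
qed

lemma links_ray:
  "links (ray k l) = (\<lambda>i. (spider_vertex k (i + 1), spider_vertex k (i + 2))) ` {..<l - 1}"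
  unfolding ray_def links_stem
  by (intro image_cong) (auto simp: spider_vertex_def nth_Cons split: nat.splits)

primrec spider_tree :: "nat list \<Rightarrow> nat \<Rightarrow> (nat \<times> nat) rtree" where
  "spider_tree ls 0 = Vertex (0, 0)"
| "spider_tree ls (Suc i) = Join (spider_tree ls i) (ray i (ls ! i))"

lemma apex_spider_tree [simp]: "apex (spider_tree ls k) = (0, 0)"
  by (induction k) auto

lemma vset_spider_tree:
  "k \<le> length ls \<Longrightarrow> \<forall>l \<in> set ls. 1 \<le> l \<Longrightarrow>
     vset (spider_tree ls k) = insert (0, 0) (Sigma {..<k} (\<lambda>i. {1..ls ! i}))"
  by (induction k) (auto simp: vset_ray less_Suc_eq)

lemma good_spider_tree:
  "k \<le> length ls \<Longrightarrow> \<forall>l \<in> set ls. 1 \<le> l \<Longrightarrow> good (spider_tree ls k)"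
  by (induction k) (auto simp: vset_spider_tree vset_ray)

lemma spidery_spider_tree [simp]: "spidery (spider_tree ls k)"
  by (induction k) auto

lemma branches_spider_tree:
  "k \<le> length ls \<Longrightarrow> \<forall>l \<in> set ls. 1 \<le> l \<Longrightarrow> branches (spider_tree ls k) = mset (take k ls)"
proof (induction k)
  case (Suc k)
  have "1 \<le> ls ! k"
    using Suc.prems by auto
  then obtain m where "ls ! k = Suc m"
    by (cases "ls ! k") auto
  then show ?case
    using Suc branches_ray[of k "Suc m"] by (simp add: take_Suc_conv_app_nth)
qed simp

lemma links_spider_tree:
  "k \<le> length ls \<Longrightarrow> \<forall>l \<in> set ls. 1 \<le> l \<Longrightarrow>
     links (spider_tree ls k) = (\<Union>i<k. (\<lambda>j. (spider_vertex i j, spider_vertex i (Suc j))) ` {..<ls ! i})"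
proof (induction k)
  case (Suc k)
  have "1 \<le> ls ! k"
    using Suc.prems by auto
  then have "{..<ls ! k} = insert 0 (Suc ` {..<ls ! k - 1})"
    using lessThan_Suc_eq_insert_0[of "ls ! k - 1"] by simp
  then have "(\<lambda>j. (spider_vertex k j, spider_vertex k (Suc j))) ` {..<ls ! k} =
      insert ((0, 0), (k, 1)) (links (ray k (ls ! k)))"
    by (simp add: image_image links_ray) (simp add: spider_vertex_def)
  then show ?case
    using Suc by (simp add: lessThan_Suc Un_commute)
qed simp

lemma spider_eq_graph_of:
  assumes "\<forall>l \<in> set ls. 1 \<le> l" "ls \<noteq> []"
  shows "spider ls = graph_of (spider_tree ls (length ls))"
proof -
  have "{spider_vertex i j |i j. i < length ls \<and> j \<le> ls ! i} =
      insert (0, 0) (Sigma {..<length ls} (\<lambda>i. {1..ls ! i}))" (is "?A = ?B")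
  proof
    show "?A \<subseteq> ?B"
      by (auto simp: spider_vertex_def)
    have "(0, 0) = spider_vertex 0 0" "0 < length ls"
      using assms(2) by (auto simp: spider_vertex_def)
    moreover have "(i, j) = spider_vertex i j" if "1 \<le> j" for i j
      using that by (simp add: spider_vertex_def)
    ultimately show "?B \<subseteq> ?A"
      by fastforce
  qed
  moreover have "{(spider_vertex i j, spider_vertex i (Suc j)) |i j. i < length ls \<and> j < ls ! i} =
      links (spider_tree ls (length ls))"
    using assms by (subst links_spider_tree) auto
  ultimately show ?thesis
    using assms by (simp add: spider_def graph_of_def slinks_def vset_spider_tree Let_def)
qed

text \<open>The path is cut at its central edge: one stem runs from \<open>r\<close> down to 0, the
  other from \<open>r + 1\<close> up to \<open>2 * r + 1\<close>.\<close>

lemma path_graph_eq_graph_of: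
  "path_graph (2 * r + 2) =
     graph_of (Join (stem r (map (\<lambda>i. r - Suc i) [0..<r])) (stem (r + 1) (map (\<lambda>i. r + 2 + i) [0..<r])))"
    (is "_ = graph_of (Join ?a ?b)")
proof -
  have "links ?a = (\<lambda>i. (r - i, r - Suc i)) ` {..<r}"
    unfolding links_stem by (intro image_cong) (auto simp: nth_Cons split: nat.splits)
  also have "\<dots> = (\<lambda>i. (Suc i, i)) ` {..<r}"
  proof (intro equalityI subsetI)
    fix e assume "e \<in> (\<lambda>i. (Suc i, i)) ` {..<r}"
    then obtain j where "e = (Suc j, j)" "j < r"
      by auto
    then show "e \<in> (\<lambda>i. (r - i, r - Suc i)) ` {..<r}"
      by (intro image_eqI[of _ _ "r - Suc j"]) auto
  qed (auto simp: image_iff Suc_diff_Suc)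
  finally have a: "links ?a = (\<lambda>i. (Suc i, i)) ` {..<r}" .
  have "links ?b = (\<lambda>i. (r + 1 + i, r + 2 + i)) ` {..<r}"
    unfolding links_stem by (intro image_cong) (auto simp: nth_Cons split: nat.splits)
  also have "\<dots> = (\<lambda>i. (i, Suc i)) ` {r + 1..<2 * r + 1}"
  proof (intro equalityI subsetI)
    fix e assume "e \<in> (\<lambda>i. (i, Suc i)) ` {r + 1..<2 * r + 1}"
    then obtain j where "e = (j, Suc j)" "r + 1 \<le> j" "j < 2 * r + 1"
      by auto
    then show "e \<in> (\<lambda>i. (r + 1 + i, r + 2 + i)) ` {..<r}"
      by (intro image_eqI[of _ _ "j - r - 1"]) auto
  qed auto
  finally have b: "links ?b = (\<lambda>i. (i, Suc i)) ` {r + 1..<2 * r + 1}" .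
  have "{..<2 * r + 1} = insert r ({..<r} \<union> {r + 1..<2 * r + 1})"
    by auto
  then have "{(i, Suc i) | i. Suc i < 2 * r + 2} = (\<lambda>i. (i, Suc i)) ` insert r ({..<r} \<union> {r + 1..<2 * r + 1})"
    by (auto simp flip: \<open>{..<2 * r + 1} = _\<close>)
  then have "{(i, Suc i) | i. Suc i < 2 * r + 2} = insert (r, Suc r) ((links ?a)\<inverse> \<union> links ?b)"
    unfolding a b image_insert image_Un by auto
  then have slinks: "slinks (Join ?a ?b) = {(i, Suc i) | i. Suc i < 2 * r + 2} \<union> {(i, Suc i) | i. Suc i < 2 * r + 2}\<inverse>"
    by (auto simp: slinks_def)
  have vset: "vset (Join ?a ?b) = {..<2 * r + 2}"
  proof -
    have "vset ?a = {..r}"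
    proof (intro equalityI subsetI)
      fix x assume "x \<in> {..r}"
      then show "x \<in> vset ?a"
        by (cases "x = r") (auto intro!: image_eqI[of _ _ "r - Suc x"])
    qed auto
    moreover have "vset ?b = insert (r + 1) {r + 2..<2 * r + 2}"
      using image_add_atLeastLessThan[of "r + 2" 0 r] by (simp add: mult_2 add.commute add.left_commute)
    ultimately show ?thesis
      by auto
  qed
  show ?thesis
    unfolding path_graph_def graph_of_def Let_def slinks vset ..
qed

text \<open>A spider is rooted at its center, while the analysis splits a tree at its central edge.
  That edge is the first link of the leg of length \<open>r + 1\<close>: a bare path of height
  \<open>r\<close> remains below it, and another leg of length \<open>r\<close> gives the other side
  the same height.\<close>

lemma spidery_central:
  assumes "good t" "spidery t" "branches t = add_mset (r + 1) C" "r \<in># C" "\<forall>l \<in># C. l \<le> r" "r \<ge> 1"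
  shows "\<exists>a b. good (Join a b) \<and> graph_of (Join a b) = graph_of t \<and> spidery (Join a b) \<and>
    height a = r \<and> height b = r \<and> branches a = C \<and> branches b = {#r#}"
proof -
  obtain a b where ab: "good (Join a b)" "vset (Join a b) = vset t" "links (Join a b) = links t"
    "spidery (Join a b)" "height b + 1 = r + 1" "branches (Join a b) = branches t"
    using branch_as_child[OF assms(1,2), of "r + 1"] assms(3) by auto
  have C: "branches a = C"
    using branches_spidery_Join[OF ab(4)] ab(5,6) assms(3) by simp
  have "height a \<ge> r"
    using branches_bounds[of r a] C assms(4) by simp
  moreover from this have "height a \<le> r"
    using height_in_branches[of a] C assms(5,6) by simp
  moreover have "branches b = {#r#}"
    using branches_path(2)[of b] ab(4,5) assms(6) by simp
  ultimately show ?thesis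
    using ab C by (intro exI[of _ a] exI[of _ b]) (auto intro: graph_of_eqI)
qed

lemma spidery_tree_class:
  assumes "good t" "spidery t" "branches t = add_mset (r + 1) C" "r \<in># C" "\<forall>l \<in># C. l \<le> r" "r \<ge> 1"
  shows "tree_class (sum_mset C + r + 2) (2 * r + 1) (graph_of t)"
proof -
  obtain a b where ab: "good (Join a b)" "graph_of (Join a b) = graph_of t" "spidery (Join a b)"
    "height a = r" "height b = r" "branches a = C" "branches b = {#r#}"
    using spidery_central[OF assms] by blast
  have "diam (Join a b) = 2 * r + 1"
    using ab(4,5) diam_le_height[of a] diam_le_height[of b] by simp
  moreover have "card (vset t) = sum_mset C + r + 2"
    using sum_branches[OF assms(1)] assms(3) by simp
  ultimately show ?thesis
    using assms(1) ab(1,2) diam_invariant[of "Join a b" t] by (simp add: tree_class_graph_of)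
qed

text \<open>The competitors have natural numbers as vertices, so the spider is carried over by
  \<open>prod_encode\<close>.\<close>

lemma nat_spidery_tree:
  assumes "\<forall>l \<in> set ls. 1 \<le> l"
  shows "\<exists>t :: nat rtree. good t \<and> spidery t \<and> branches t = mset ls"
proof -
  define t where "t = map_rtree prod_encode (spider_tree ls (length ls))"
  have "good t"
    unfolding t_def using assms by (intro good_map_rtree good_spider_tree inj_prod_encode) auto
  moreover have "spidery t" "branches t = mset ls"
    using assms by (simp_all add: t_def branches_spider_tree)
  ultimately show ?thesis
    by blast
qed

section \<open>Dirichlet energy and the Steklov quotient\<close>

declare slinks_simps(2) [simp del]

section \<open>Leaves and degrees\<close>

lemma apex_notin_vset:
  assumes "vset s \<inter> vset t = {}"
  shows "apex s \<notin> vset t" "apex t \<notin> vset s"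
  using assms apex_in_vset by (metis disjoint_iff)+

text \<open>The root never counts as a leaf here, and a single vertex becomes one only when it is
  joined below another vertex. In the whole tree the root is no leaf either once it has a second
  neighbour, which \<open>height s > 0\<close> provides in \<open>leaves_graph_of\<close>.\<close>

primrec ends :: "'a rtree \<Rightarrow> 'a set" where
  "ends (Vertex a) = {}"
| "ends (Join s t) = ends s \<union> (if height t = 0 then vset t else ends t)"

lemma ends_subset: "ends t \<subseteq> vset t"
  by (induction t) auto

lemma ends_in_vset: "x \<in> ends t \<Longrightarrow> x \<in> vset t"
  using ends_subset by fastforce

lemma finite_ends [simp]: "finite (ends t)"
  by (rule finite_subset[OF ends_subset finite_vset])

lemma ends_nonempty: "height t > 0 \<Longrightarrow> ends t \<noteq> {}"
  by (induction t) auto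

lemma apex_notin_ends: "good t \<Longrightarrow> apex t \<notin> ends t"
  by (induction t) (auto simp: apex_notin_vset dest: ends_in_vset)

definition nbrs :: "'a rel \<Rightarrow> 'a \<Rightarrow> 'a set" where
  "nbrs A x = {y. (x, y) \<in> A}"

lemma nbrs_Join:
  "nbrs (slinks (Join s t)) x = nbrs (slinks s) x \<union> nbrs (slinks t) x \<union>
     (if x = apex s then {apex t} else {}) \<union> (if x = apex t then {apex s} else {})"
  by (auto simp: nbrs_def slinks_simps)

lemma nbrs_subset: "nbrs (slinks t) x \<subseteq> vset t"
  by (auto simp: nbrs_def dest: slinks_in_vset)

lemma finite_nbrs [simp]: "finite (nbrs (slinks t) x)"
  by (rule finite_subset[OF nbrs_subset finite_vset])

lemma nbrs_outside: "x \<notin> vset t \<Longrightarrow> nbrs (slinks t) x = {}"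
  by (auto simp: nbrs_def dest: slinks_in_vset)

lemma nbrs_apex_empty_iff: "nbrs (slinks t) (apex t) = {} \<longleftrightarrow> height t = 0"
proof (cases t)
  case (Join a b)
  then show ?thesis
    by (auto simp: nbrs_Join)
qed (simp add: nbrs_def)

lemma card_nbrs_eq_1_iff:
  "good t \<Longrightarrow> x \<in> vset t \<Longrightarrow> x \<noteq> apex t \<Longrightarrow> card (nbrs (slinks t) x) = 1 \<longleftrightarrow> x \<in> ends t"
proof (induction t)
  case (Join s t)
  have disj: "vset s \<inter> vset t = {}" "good s" "good t"
    using Join.prems by auto
  consider "x \<in> vset s" "x \<noteq> apex s" | "x \<in> vset t" "x \<noteq> apex t" | "x = apex t"
    using Join.prems by auto
  then show ?case
  proof cases
    case 1
    then have x: "x \<notin> vset t"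
      using disj by auto
    then have "x \<noteq> apex t" "x \<notin> ends t"
      by (auto dest: ends_in_vset)
    then show ?thesis
      using Join.IH(1) 1 x disj by (simp add: nbrs_Join nbrs_outside)
  next
    case 2
    then have x: "x \<notin> vset s"
      using disj by auto
    then have "x \<noteq> apex s" "x \<notin> ends s"
      by (auto dest: ends_in_vset)
    moreover have "height t \<noteq> 0"
      using 2 by (auto simp: height_eq_0_iff)
    ultimately show ?thesis
      using Join.IH(2) 2 x disj by (simp add: nbrs_Join nbrs_outside)
  next
    case 3
    have x: "apex t \<notin> vset s" "apex s \<notin> vset t"
      using apex_notin_vset[OF disj(1)] by simp_all
    then have "apex t \<notin> ends s" "apex t \<noteq> apex s" "apex s \<notin> nbrs (slinks t) (apex t)"
      using nbrs_subset[of t "apex t"] by (auto dest: ends_in_vset)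
    then show ?thesis
      using 3 x apex_notin_ends[OF disj(3)]
      by (simp add: nbrs_Join nbrs_outside card_insert_if nbrs_apex_empty_iff)
  qed
qed simp

lemma out_degree_graph_of: "out_degree (with_proj (graph_of t)) x = card (nbrs (slinks t) x)"
proof -
  have "out_arcs (with_proj (graph_of t)) x = Pair x ` nbrs (slinks t) x"
    by (auto simp: out_arcs_def nbrs_def)
  then show ?thesis
    by (simp add: out_degree_def card_image inj_on_def)
qed

lemma leaves_graph_of:
  assumes "good (Join s t)" "height s > 0"
  shows "leaves (graph_of (Join s t)) = ends (Join s t)"
proof -
  have x: "apex t \<notin> vset s" "apex s \<notin> vset t"
    using assms(1) apex_notin_vset[of s t] by simp_all
  then have "apex t \<noteq> apex s" "apex t \<notin> nbrs (slinks s) (apex s)"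
    using nbrs_subset[of s "apex s"] by auto
  then have "card (nbrs (slinks (Join s t)) (apex s)) \<noteq> 1"
    using assms(2) x by (simp add: nbrs_Join nbrs_outside card_insert_if nbrs_apex_empty_iff)
  then have "card (nbrs (slinks (Join s t)) x) = 1 \<longleftrightarrow> x \<in> ends (Join s t)" if "x \<in> vset (Join s t)" for x
    using card_nbrs_eq_1_iff[OF assms(1) that] apex_notin_ends[OF assms(1)] by (metis apex.simps(2))
  then show ?thesis
    using ends_subset[of "Join s t"]
    unfolding leaves_def out_degree_graph_of graph_of_sel by blast
qed

section \<open>Energy, Laplacian and harmonic extensions\<close>

definition energy :: "'a rtree \<Rightarrow> ('a \<Rightarrow> real) \<Rightarrow> real" where
  "energy t f = (\<Sum>(x, y) \<in> links t. (f x - f y)\<^sup>2)"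

lemma energy_Vertex [simp]: "energy (Vertex a) f = 0"
  by (simp add: energy_def)

lemma energy_Join:
  assumes "good (Join s t)"
  shows "energy (Join s t) f = energy s f + energy t f + (f (apex s) - f (apex t))\<^sup>2"
proof -
  have "(apex s, apex t) \<notin> links s \<union> links t" "links s \<inter> links t = {}"
    using assms apex_notin_vset[of s t] by (auto dest: links_in_vset)
  then show ?thesis
    by (simp add: energy_def sum.union_disjoint)
qed

lemma energy_nonneg [simp]: "0 \<le> energy t f"
  by (auto simp: energy_def intro: sum_nonneg)

lemma energy_cong:
  assumes "\<And>x. x \<in> vset t \<Longrightarrow> f x = g x"
  shows "energy t f = energy t g"
  unfolding energy_def using assms by (intro sum.cong) (auto dest: links_in_vset)

lemma energy_scale: "energy t (\<lambda>x. c * f x) = c\<^sup>2 * energy t f"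
  by (simp add: energy_def sum_distrib_left case_prod_unfold power_mult_distrib flip: right_diff_distrib)

lemma links_asym: "good t \<Longrightarrow> links t \<inter> (links t)\<inverse> = {}"
proof (induction t)
  case (Join s t)
  have "apex t \<notin> vset s" "apex s \<notin> vset t" "vset s \<inter> vset t = {}"
    using Join.prems apex_notin_vset[of s t] by simp_all
  then show ?case
    using Join by (auto dest: links_in_vset)
qed simp

lemma sum_slinks:
  assumes "good t" "\<And>x y. F (x, y) = F (y, x)"
  shows "sum F (slinks t) = 2 * sum (F :: 'a \<times> 'a \<Rightarrow> real) (links t)"
proof -
  have "sum F ((links t)\<inverse>) = sum F (links t)"
    using assms(2) by (intro sum.reindex_bij_witness[of _ prod.swap prod.swap]) auto
  then show ?thesis
    using links_asym[OF assms(1)] by (simp add: slinks_def sum.union_disjoint)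
qed

lemma dirichlet_energy_graph_of: "good t \<Longrightarrow> dirichlet_energy (graph_of t) f = energy t f"
  by (simp add: dirichlet_energy_def energy_def sum_slinks power2_commute)

definition laplace :: "'a rel \<Rightarrow> ('a \<Rightarrow> real) \<Rightarrow> 'a \<Rightarrow> real" where
  "laplace A f v = (\<Sum>w | (v, w) \<in> A. f v - f w)"

lemma laplace_nbrs: "laplace A f v = (\<Sum>w \<in> nbrs A v. f v - f w)"
  by (simp add: laplace_def nbrs_def)

text \<open>Summation by parts: every link occurs in both orientations, and exchanging them turns
  the terms with \<open>g y\<close> into those with \<open>g x\<close>.\<close>

lemma green:
  assumes "good t"
  shows "(\<Sum>(x, y) \<in> links t. (f x - f y) * (g x - g y)) = (\<Sum>x \<in> vset t. g x * laplace (slinks t) f x)"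
proof -
  have swap: "(\<Sum>(x, y) \<in> slinks t. (f x - f y) * g y) = - (\<Sum>(x, y) \<in> slinks t. (f x - f y) * g x)"
    unfolding sum_negf[symmetric]
    by (intro sum.reindex_bij_witness[of _ prod.swap prod.swap])
      (auto simp: algebra_simps intro: slinks_commute[THEN iffD1])
  have "2 * (\<Sum>(x, y) \<in> links t. (f x - f y) * (g x - g y)) = (\<Sum>(x, y) \<in> slinks t. (f x - f y) * (g x - g y))"
    by (subst sum_slinks[OF assms]) (auto simp: algebra_simps)
  also have "\<dots> = (\<Sum>(x, y) \<in> slinks t. (f x - f y) * g x) - (\<Sum>(x, y) \<in> slinks t. (f x - f y) * g y)"
    by (simp add: sum_subtractf case_prod_unfold right_diff_distrib)
  also have "\<dots> = 2 * (\<Sum>(x, y) \<in> slinks t. (f x - f y) * g x)"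
    using swap by simp
  also have "(\<Sum>(x, y) \<in> slinks t. (f x - f y) * g x) =
      (\<Sum>x \<in> vset t. \<Sum>y \<in> nbrs (slinks t) x. (f x - f y) * g x)"
  proof -
    have "slinks t = Sigma (vset t) (nbrs (slinks t))"
      by (auto simp: nbrs_def dest: slinks_in_vset)
    then have "(\<Sum>(x, y) \<in> slinks t. (f x - f y) * g x) =
        (\<Sum>(x, y) \<in> Sigma (vset t) (nbrs (slinks t)). (f x - f y) * g x)"
      by simp
    also have "\<dots> = (\<Sum>x \<in> vset t. \<Sum>y \<in> nbrs (slinks t) x. (f x - f y) * g x)"
      by (rule sum.Sigma[symmetric]) auto
    finally show ?thesis .
  qed
  also have "\<dots> = (\<Sum>x \<in> vset t. g x * laplace (slinks t) f x)"
    by (simp add: laplace_nbrs sum_distrib_left mult.commute)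
  finally show ?thesis
    by simp
qed

lemma laplace_cong:
  assumes "\<And>x. x \<in> vset t \<Longrightarrow> f x = g x" "v \<in> vset t"
  shows "laplace (slinks t) f v = laplace (slinks t) g v"
  unfolding laplace_nbrs using assms nbrs_subset[of t v] by (intro sum.cong) auto

lemma laplace_Join:
  assumes "good (Join s t)"
  shows "v \<in> vset s \<Longrightarrow> v \<noteq> apex s \<Longrightarrow> laplace (slinks (Join s t)) f v = laplace (slinks s) f v"
    and "v \<in> vset t \<Longrightarrow> v \<noteq> apex t \<Longrightarrow> laplace (slinks (Join s t)) f v = laplace (slinks t) f v"
    and "laplace (slinks (Join s t)) f (apex s) = laplace (slinks s) f (apex s) + (f (apex s) - f (apex t))"
    and "laplace (slinks (Join s t)) f (apex t) = laplace (slinks t) f (apex t) + (f (apex t) - f (apex s))"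
proof -
  have x: "apex t \<notin> vset s" "apex s \<notin> vset t" "vset s \<inter> vset t = {}"
    using assms apex_notin_vset[of s t] by simp_all
  then have y: "apex t \<noteq> apex s" "apex t \<notin> nbrs (slinks s) v" "apex s \<notin> nbrs (slinks t) v" for v
    using nbrs_subset[of s v] nbrs_subset[of t v] by auto
  show "v \<in> vset s \<Longrightarrow> v \<noteq> apex s \<Longrightarrow> laplace (slinks (Join s t)) f v = laplace (slinks s) f v"
    using x y by (subgoal_tac "v \<noteq> apex t \<and> v \<notin> vset t") (auto simp: laplace_nbrs nbrs_Join nbrs_outside)
  show "v \<in> vset t \<Longrightarrow> v \<noteq> apex t \<Longrightarrow> laplace (slinks (Join s t)) f v = laplace (slinks t) f v"
    using x y by (subgoal_tac "v \<noteq> apex s \<and> v \<notin> vset s") (auto simp: laplace_nbrs nbrs_Join nbrs_outside)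
  show "laplace (slinks (Join s t)) f (apex s) = laplace (slinks s) f (apex s) + (f (apex s) - f (apex t))"
    using x y by (simp add: laplace_nbrs nbrs_Join nbrs_outside)
  show "laplace (slinks (Join s t)) f (apex t) = laplace (slinks t) f (apex t) + (f (apex t) - f (apex s))"
    using x y(1) y(3)[of "apex t"] by (simp add: laplace_nbrs nbrs_Join nbrs_outside)
qed

text \<open>
  With the value \<open>h\<close> at the apex prescribed, the flow out of the apex is an affine function
  of \<open>h\<close> with positive slope \<open>c\<close>; its zero yields the harmonic extension.
\<close>

lemma harmonic_below_apex:
  "good t \<Longrightarrow> \<exists>c d. 0 \<le> c \<and> (height t > 0 \<longrightarrow> 0 < c) \<and> (\<forall>h. \<exists>f. f (apex t) = h \<and> (\<forall>v \<in> ends t. f v = g v) \<and>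
     (\<forall>v \<in> vset t - ends t - {apex t}. laplace (slinks t) f v = 0) \<and> laplace (slinks t) f (apex t) = c * h - d)"
proof (induction t)
  case (Vertex a)
  have "\<exists>f. f a = h" for h :: real
    by (rule exI[of _ "\<lambda>_. h"]) simp
  then show ?case
    by (intro exI[of _ 0]) (simp add: laplace_def)
next
  case (Join s t)
  have disj: "vset s \<inter> vset t = {}" "good s" "good t"
    using Join.prems by auto
  obtain c1 d1 where c1: "0 \<le> c1" and "\<forall>h. \<exists>f. f (apex s) = h \<and> (\<forall>v \<in> ends s. f v = g v) \<and>
     (\<forall>v \<in> vset s - ends s - {apex s}. laplace (slinks s) f v = 0) \<and> laplace (slinks s) f (apex s) = c1 * h - d1"
    using Join.IH(1)[OF disj(2)] by blast
  then obtain F1 where F1: "\<And>h. F1 h (apex s) = h" "\<And>h v. v \<in> ends s \<Longrightarrow> F1 h v = g v"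
     "\<And>h v. v \<in> vset s - ends s - {apex s} \<Longrightarrow> laplace (slinks s) (F1 h) v = 0"
     "\<And>h. laplace (slinks s) (F1 h) (apex s) = c1 * h - d1"
    by metis
  obtain c2 d2 where c2: "0 \<le> c2" "height t > 0 \<longrightarrow> 0 < c2" and "\<forall>h. \<exists>f. f (apex t) = h \<and> (\<forall>v \<in> ends t. f v = g v) \<and>
     (\<forall>v \<in> vset t - ends t - {apex t}. laplace (slinks t) f v = 0) \<and> laplace (slinks t) f (apex t) = c2 * h - d2"
    using Join.IH(2)[OF disj(3)] by (elim exE conjE) (rule that)
  then obtain F2 where F2: "\<And>h. F2 h (apex t) = h" "\<And>h v. v \<in> ends t \<Longrightarrow> F2 h v = g v"
     "\<And>h v. v \<in> vset t - ends t - {apex t} \<Longrightarrow> laplace (slinks t) (F2 h) v = 0"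
     "\<And>h. laplace (slinks t) (F2 h) (apex t) = c2 * h - d2"
    by metis
  \<comment> \<open>At an inner apex, \<open>y h\<close> is the zero of the total flow
    \<open>c2 * y - d2 + (y - h)\<close>. A child that is a single vertex carries the prescribed
    boundary value.\<close>
  define y where "y h = (if height t = 0 then g (apex t) else (h + d2) / (c2 + 1))" for h
  define f where "f h v = (if v \<in> vset t then F2 (y h) v else F1 h v)" for h v
  have ft: "f h v = F2 (y h) v" if "v \<in> vset t" for h v
    using that by (simp add: f_def)
  have fs: "f h v = F1 h v" if "v \<in> vset s" for h v
    using that disj(1) by (auto simp: f_def)
  have lt: "laplace (slinks t) (f h) v = laplace (slinks t) (F2 (y h)) v" if "v \<in> vset t" for h v
    using that by (intro laplace_cong ft)
  have ls: "laplace (slinks s) (f h) v = laplace (slinks s) (F1 h) v" if "v \<in> vset s" for h v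
    using that by (intro laplace_cong fs)
  \<comment> \<open>Slope \<open>c2\<close> in series with a link of conductance 1 yields
    \<open>c2 / (c2 + 1)\<close>; a boundary vertex contributes the link alone.\<close>
  define c d where "c = (if height t = 0 then c1 + 1 else c1 + c2 / (c2 + 1))"
    and "d = (if height t = 0 then d1 + g (apex t) else d1 + d2 / (c2 + 1))"
  have "0 < c"
    using c1 c2 by (auto simp: c_def intro!: add_nonneg_pos divide_pos_pos)
  have apex_s: "f h (apex s) = h" for h
    by (simp add: fs F1)
  have ends: "f h v = g v" if "v \<in> ends (Join s t)" for h v
  proof (cases "v \<in> ends s")
    case True
    then show ?thesis
      using ends_subset[of s] by (subst fs) (auto simp: F1)
  next
    case False
    show ?thesis
    proof (cases "height t = 0")
      case True
      then have "v = apex t"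
        using that False by (auto simp: height_eq_0_iff)
      then show ?thesis
        using True by (simp add: ft F2(1) y_def)
    next
      case height: False
      then have "v \<in> ends t"
        using that False by simp
      then show ?thesis
        using ends_subset[of t] by (subst ft) (auto simp: F2)
    qed
  qed
  have inner: "laplace (slinks (Join s t)) (f h) v = 0" if "v \<in> vset (Join s t) - ends (Join s t) - {apex (Join s t)}" for h v
  proof -
    have "v \<in> vset s \<union> vset t" "v \<noteq> apex s"
      using that by simp_all
    then consider "v \<in> vset s" "v \<noteq> apex s" | "v \<in> vset t" "v \<noteq> apex t" | "v = apex t"
      by blast
    then show ?thesis
    proof cases
      case 1
      then show ?thesis
        using that F1(3) by (simp add: laplace_Join(1)[OF Join.prems] ls)
    next
      case 2
      then have "height t \<noteq> 0"
        by (auto simp: height_eq_0_iff)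
      then show ?thesis
        using 2 that F2(3) by (simp add: laplace_Join(2)[OF Join.prems] lt)
    next
      case 3
      then have "height t \<noteq> 0"
        using that by (auto split: if_splits)
      then have "c2 > 0" "y h = (h + d2) / (c2 + 1)"
        using c2 by (auto simp: y_def)
      then have "c2 * y h - d2 + (y h - h) = 0"
        by (simp add: field_simps)
      then show ?thesis
        using 3 by (simp add: laplace_Join(4)[OF Join.prems] lt F2 ft apex_s)
    qed
  qed
  have "laplace (slinks (Join s t)) (f h) (apex s) = c * h - d" for h
  proof -
    have "laplace (slinks (Join s t)) (f h) (apex s) = c1 * h - d1 + (h - y h)"
      by (simp add: laplace_Join(3)[OF Join.prems] ls F1(4) apex_s ft F2(1))
    also have "\<dots> = c * h - d"
    proof (cases "height t = 0")
      case False
      have "(h - y h) * (c2 + 1) = c2 * h - d2"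
        using c2 False by (simp add: y_def left_diff_distrib) (simp add: algebra_simps)
      then have "h - y h = c2 / (c2 + 1) * h - d2 / (c2 + 1)"
        using c2 by (simp add: eq_divide_eq flip: diff_divide_distrib)
      then show ?thesis
        using False by (simp add: c_def d_def distrib_right)
    qed (simp add: y_def c_def d_def algebra_simps)
    finally show ?thesis .
  qed
  then show ?case
    using \<open>0 < c\<close> apex_s ends inner
    by (intro exI[of _ c] exI[of _ d] conjI allI, simp, simp) (rule_tac x = "f h" in exI, simp del: ends.simps vset.simps)
qed

lemma harmonic_exists:
  assumes "good t" "height t > 0"
  shows "\<exists>f. (\<forall>v \<in> ends t. f v = g v) \<and> (\<forall>v \<in> vset t - ends t. laplace (slinks t) f v = 0)"
proof -
  obtain c d where cd: "0 < c" "\<forall>h. \<exists>f. f (apex t) = h \<and> (\<forall>v \<in> ends t. f v = g v) \<and>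
     (\<forall>v \<in> vset t - ends t - {apex t}. laplace (slinks t) f v = 0) \<and> laplace (slinks t) f (apex t) = c * h - d"
    using harmonic_below_apex[OF assms(1), of g] assms(2) by blast
  obtain f where f: "\<forall>v \<in> ends t. f v = g v" "\<forall>v \<in> vset t - ends t - {apex t}. laplace (slinks t) f v = 0"
      "laplace (slinks t) f (apex t) = c * (d / c) - d"
    using cd(2) by blast
  have "laplace (slinks t) f (apex t) = 0"
    using f(3) cd(1) by simp
  then show ?thesis
    using f(1,2) by blast
qed

text \<open>Orthogonality in the energy form: at every vertex either \<open>e\<close> or the
  Laplacian of \<open>u\<close> vanishes, so \<open>green\<close> removes the mixed term. Both the
  uniqueness and the minimum property of harmonic extensions come from this.\<close>

lemma energy_harmonic_plus:
  assumes "good t" "\<forall>v \<in> vset t - ends t. laplace (slinks t) u v = 0" "\<forall>v \<in> ends t. e v = 0"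
  shows "energy t (\<lambda>x. u x + e x) = energy t u + energy t e"
proof -
  have "(\<Sum>(x, y) \<in> links t. (u x - u y) * (e x - e y)) = (\<Sum>x \<in> vset t. e x * laplace (slinks t) u x)"
    by (rule green[OF assms(1)])
  also have "\<dots> = 0"
    using assms(2,3) by (intro sum.neutral) auto
  finally have "(\<Sum>(x, y) \<in> links t. 2 * ((u x - u y) * (e x - e y))) = 0"
    by (simp add: case_prod_unfold flip: sum_distrib_left)
  moreover have "energy t (\<lambda>x. u x + e x) =
      energy t u + energy t e + (\<Sum>(x, y) \<in> links t. 2 * ((u x - u y) * (e x - e y)))"
    unfolding energy_def case_prod_unfold sum.distrib[symmetric]
    by (intro sum.cong) (auto simp: power2_eq_square algebra_simps)
  ultimately show ?thesis
    by simp
qed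

lemma energy_eq_0_imp_constant:
  assumes "energy t f = 0" "x \<in> vset t" "y \<in> vset t"
  shows "f x = f y"
proof -
  have "f a = f b" if "(a, b) \<in> links t" for a b
    using assms(1) that unfolding energy_def by (subst (asm) sum_nonneg_eq_0_iff) auto
  then have edge: "f a = f b" if "(a, b) \<in> slinks t" for a b
    using that by (auto simp: slinks_def)
  have "f u = f v" if "set p \<subseteq> slinks t" "pcas u p v" for u v p
    using that by (induction p arbitrary: u) (auto dest: edge)
  then show ?thesis
    using short_walk[OF assms(2,3)] by (auto simp: walk_def)
qed

lemma harmonic_extension_minimizes:
  assumes "good t" "height t > 0" "leaves (graph_of t) = ends t"
  shows "\<And>v. v \<in> ends t \<Longrightarrow> harmonic_extension (graph_of t) g v = g v"
    and "\<And>f. (\<And>v. v \<in> ends t \<Longrightarrow> f v = g v) \<Longrightarrow> energy t (harmonic_extension (graph_of t) g) \<le> energy t f"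
proof -
  define H where "H f \<longleftrightarrow> f \<in> extensional (vset t) \<and> (\<forall>v \<in> ends t. f v = g v) \<and>
      (\<forall>v \<in> vset t - ends t. laplace (slinks t) f v = 0)" for f
  obtain f where f: "\<forall>v \<in> ends t. f v = g v" "\<forall>v \<in> vset t - ends t. laplace (slinks t) f v = 0"
    using harmonic_exists[OF assms(1,2)] by blast
  have "H (restrict f (vset t))"
    using f ends_subset[of t] laplace_cong[of t "restrict f (vset t)" f] by (auto simp: H_def)
  \<comment> \<open>Uniqueness justifies the definite description. Orthogonality with the two
    solutions in either role gives their difference energy 0; it is then constant, and it vanishes
    at the leaves.\<close>
  moreover have unique: "f1 = f2" if "H f1" "H f2" for f1 f2
  proof -
    define e where "e = (\<lambda>x. f2 x - f1 x)"
    have h: "\<forall>v \<in> vset t - ends t. laplace (slinks t) f1 v = 0" "\<forall>v \<in> ends t. e v = 0"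
      "\<forall>v \<in> vset t - ends t. laplace (slinks t) f2 v = 0" "\<forall>v \<in> ends t. - e v = 0"
      using that by (auto simp: H_def e_def)
    have "energy t f2 = energy t f1 + energy t e"
      using energy_harmonic_plus[OF assms(1) h(1,2)] by (simp add: e_def)
    moreover have "energy t f1 = energy t f2 + energy t (\<lambda>x. - e x)"
      using energy_harmonic_plus[OF assms(1) h(3,4)] by (simp add: e_def)
    moreover have "energy t (\<lambda>x. - e x) \<ge> 0"
      by simp
    ultimately have "energy t e = 0"
      using energy_nonneg[of t e] by linarith
    moreover obtain w where "w \<in> ends t"
      using ends_nonempty[OF assms(2)] by blast
    ultimately have "e x = 0" if "x \<in> vset t" for x
      using energy_eq_0_imp_constant[of t e x w] that h(2) ends_subset[of t] by auto
    then show ?thesis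
      using that by (auto simp: H_def e_def intro!: extensionalityI[of _ "vset t"])
  qed
  ultimately have "\<exists>!f. H f"
    by blast
  then have "H (THE f. H f)"
    by (rule theI')
  moreover have "harmonic_extension (graph_of t) g = (THE f. H f)"
    by (simp add: harmonic_extension_def H_def laplace_def assms(3))
  ultimately have u: "H (harmonic_extension (graph_of t) g)"
    by simp
  then show "harmonic_extension (graph_of t) g v = g v" if "v \<in> ends t" for v
    using that by (simp add: H_def)
  show "energy t (harmonic_extension (graph_of t) g) \<le> energy t f" if "\<And>v. v \<in> ends t \<Longrightarrow> f v = g v" for f
  proof -
    let ?u = "harmonic_extension (graph_of t) g"
    have "energy t (\<lambda>x. ?u x + (f x - ?u x)) = energy t ?u + energy t (\<lambda>x. f x - ?u x)"
      using u that by (intro energy_harmonic_plus assms(1)) (auto simp: H_def)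
    then show ?thesis
      using energy_nonneg[of t "\<lambda>x. f x - ?u x"] by simp
  qed
qed

text \<open>By the Dirichlet principle the harmonic extension has the least energy for its leaf
  values, so any function on the vertices is allowed as a test function.\<close>

lemma steklov_le_quotient:
  assumes "good t" "height t > 0" "leaves (graph_of t) = ends t"
    and "\<exists>v \<in> ends t. f v \<noteq> 0" "sum f (ends t) = 0"
  shows "steklov_lambda2 (graph_of t) \<le> energy t f / (\<Sum>v \<in> ends t. (f v)\<^sup>2)"
proof -
  let ?S = "\<Sum>v \<in> ends t. (f v)\<^sup>2"
  have "steklov_lambda2 (graph_of t) \<le> energy t (harmonic_extension (graph_of t) f) / ?S"
    unfolding steklov_lambda2_def assms(3) dirichlet_energy_graph_of[OF assms(1)]
    using assms(4,5)
    by (intro cInf_lower bdd_belowI[of _ 0]) (auto intro!: divide_nonneg_nonneg sum_nonneg)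
  also have "\<dots> \<le> energy t f / ?S"
    using harmonic_extension_minimizes(2)[OF assms(1-3), of f f]
    by (intro divide_right_mono) (auto intro: sum_nonneg)
  finally show ?thesis .
qed

text \<open>The data \<open>e\<close> ensure that the infimum is taken over a nonempty set;
  \<open>Inf\<close> of the empty set would carry no information.\<close>

lemma steklov_ge:
  assumes "good t" "height t > 0" "leaves (graph_of t) = ends t"
    and "\<exists>v \<in> ends t. e v \<noteq> (0 :: real)" "sum e (ends t) = 0"
    and "\<And>f. sum f (ends t) = 0 \<Longrightarrow> \<rho> * (\<Sum>v \<in> ends t. (f v)\<^sup>2) \<le> energy t f"
  shows "\<rho> \<le> steklov_lambda2 (graph_of t)"
  unfolding steklov_lambda2_def assms(3) dirichlet_energy_graph_of[OF assms(1)]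
proof (rule cInf_greatest)
  fix x assume "x \<in> {energy t (harmonic_extension (graph_of t) g) / (\<Sum>v\<in>ends t. (g v)\<^sup>2) |g.
      (\<exists>v\<in>ends t. g v \<noteq> 0) \<and> sum g (ends t) = 0}"
  then obtain g where g: "\<exists>v \<in> ends t. g v \<noteq> 0" "sum g (ends t) = 0"
    "x = energy t (harmonic_extension (graph_of t) g) / (\<Sum>v\<in>ends t. (g v)\<^sup>2)"
    by auto
  let ?u = "harmonic_extension (graph_of t) g"
  have u: "?u v = g v" if "v \<in> ends t" for v
    using harmonic_extension_minimizes(1)[OF assms(1-3) that] .
  have "(\<Sum>v\<in>ends t. (g v)\<^sup>2) > 0"
    using g(1) by (auto intro: sum_pos2)
  moreover have "\<rho> * (\<Sum>v\<in>ends t. (?u v)\<^sup>2) \<le> energy t ?u"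
    using g(2) u by (intro assms(6)) simp
  ultimately show "\<rho> \<le> x"
    using u by (simp add: g(3) pos_le_divide_eq)
qed (use assms(4,5) in auto)

section \<open>Test functions and the reduction to spiders\<close>

text \<open>
  On a path of length \<open>l\<close> with value 1 at its inner end, \<open>gain \<rho> l\<close> is the value at
  the leaf of the harmonic function whose flow out of the leaf is \<open>\<rho>\<close> times that value.
\<close>

definition gain :: "real \<Rightarrow> nat \<Rightarrow> real" where
  "gain \<rho> l = 1 / (1 - \<rho> * real l)"

definition gains :: "real \<Rightarrow> nat multiset \<Rightarrow> real" where
  "gains \<rho> N = (\<Sum>l \<in># N. gain \<rho> l)"

lemma gains_simps [simp]:
  "gains \<rho> {#} = 0"
  "gains \<rho> (add_mset l N) = gain \<rho> l + gains \<rho> N"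
  "gains \<rho> (M + N) = gains \<rho> M + gains \<rho> N"
  by (simp_all add: gains_def)

lemma below_one_mono: "0 < \<rho> \<Longrightarrow> \<rho> * real h < 1 \<Longrightarrow> l \<le> h \<Longrightarrow> \<rho> * real l < 1"
  by (meson le_less_trans mult_left_mono less_imp_le of_nat_mono)

lemma gain_pos: "\<rho> * real l < 1 \<Longrightarrow> 0 < gain \<rho> l"
  by (simp add: gain_def)

lemma gains_nonneg: "(\<And>l. l \<in># N \<Longrightarrow> \<rho> * real l < 1) \<Longrightarrow> 0 \<le> gains \<rho> N"
  by (induction N) (auto intro: add_nonneg_nonneg less_imp_le[OF gain_pos])

lemma gains_pos: "(\<And>l. l \<in># N \<Longrightarrow> \<rho> * real l < 1) \<Longrightarrow> N \<noteq> {#} \<Longrightarrow> 0 < gains \<rho> N"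
  by (cases N) (auto intro!: add_pos_nonneg gain_pos gains_nonneg)

text \<open>A link is put on top of a subtree with leaf sum \<open>\<phi>\<close> for root value 1,
  and the subtree is rescaled by \<open>y\<close>. The flow \<open>y - 1\<close> through the link
  has to be \<open>\<rho>\<close> times the new leaf sum, which gives
  \<open>y = 1 / (1 - \<rho> * \<phi>)\<close>. This factor grows with \<open>\<phi>\<close>: the
  paths collected in \<open>R\<close> increase it and are themselves multiplied by it, whereas
  detached they would only contribute \<open>R\<close>.\<close>

lemma stretch:
  fixes \<rho> \<phi> R :: real
  assumes "0 < \<rho>" "\<rho> * real (h + 1) < 1" "0 \<le> R" "gain \<rho> h + R \<le> \<phi>"
  shows "\<exists>y \<ge> 1. y - 1 \<le> \<rho> * \<phi> * y \<and> gain \<rho> (h + 1) + R \<le> y * \<phi> \<and>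
    (0 < R \<or> gain \<rho> h + R < \<phi> \<longrightarrow> gain \<rho> (h + 1) + R < y * \<phi>)"
proof -
  have h: "\<rho> * real h < 1"
    using below_one_mono[OF assms(1,2), of h] by simp
  have k: "0 < gain \<rho> h" "0 < gain \<rho> (h + 1)"
    using gain_pos h assms(2) by blast+
  then have \<phi>: "0 < \<phi>"
    using assms by linarith
  show ?thesis
  proof (cases "\<rho> * \<phi> < 1")
    case True
    \<comment> \<open>\<open>z\<close> is the factor for the bare path and turns its length from
      \<open>h\<close> into \<open>h + 1\<close>; monotonicity in the leaf sum gives
      \<open>z \<le> y\<close>.\<close>
    define y z where "y = 1 / (1 - \<rho> * \<phi>)" and "z = 1 / (1 - \<rho> * gain \<rho> h)"
    have "\<rho> * gain \<rho> h \<le> \<rho> * \<phi>"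
      using assms by (intro mult_left_mono) auto
    then have zy: "z \<le> y" "0 < z"
      using True by (auto simp: y_def z_def intro!: divide_left_mono mult_pos_pos)
    have "0 < \<rho> * \<phi>"
      using assms(1) \<phi> by simp
    then have y: "1 < y" "y - 1 = \<rho> * \<phi> * y"
      using True by (simp_all add: y_def field_simps)
    have "1 - \<rho> * gain \<rho> h = (1 - \<rho> * real (h + 1)) / (1 - \<rho> * real h)"
      using h by (simp add: gain_def field_simps)
    then have "z * gain \<rho> h = gain \<rho> (h + 1)"
      using h assms(2) by (simp add: z_def gain_def)
    moreover have "z * gain \<rho> h \<le> y * gain \<rho> h"
      using zy k by (intro mult_right_mono) auto
    ultimately have a: "gain \<rho> (h + 1) \<le> y * gain \<rho> h"
      by linarith
    have b: "1 * R \<le> y * R"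
      using y assms(3) by (intro mult_right_mono) auto
    have c: "1 * R < y * R" if "0 < R"
      using y that by (intro mult_strict_right_mono) auto
    have d: "y * (gain \<rho> h + R) \<le> y * \<phi>" "gain \<rho> h + R < \<phi> \<Longrightarrow> y * (gain \<rho> h + R) < y * \<phi>"
      using y assms(4) by auto
    have "gain \<rho> (h + 1) + R < y * \<phi>" if "0 < R \<or> gain \<rho> h + R < \<phi>"
    proof (cases "0 < R")
      case True
      then show ?thesis
        using a c d(1) unfolding distrib_left by linarith
    next
      case False
      then show ?thesis
        using that a b d(2) unfolding distrib_left by linarith
    qed
    moreover have "gain \<rho> (h + 1) + R \<le> y * \<phi>"
      using a b d(1) unfolding distrib_left by linarith
    ultimately show ?thesis
      using y by (intro exI[of _ y]) auto
  next
    case False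
    \<comment> \<open>In the absence of a positive solution every \<open>y \<ge> 1\<close> satisfies
      the link inequality, so \<open>y\<close> is taken large enough for \<open>y * \<phi>\<close>
      to exceed the bound, namely by \<open>\<phi>\<close>.\<close>
    define y where "y = 1 + (gain \<rho> (h + 1) + R) / \<phi>"
    have "y * \<phi> = \<phi> + gain \<rho> (h + 1) + R"
      using \<phi> by (simp add: y_def field_simps)
    moreover have "1 \<le> y"
      using \<phi> k assms(3) by (simp add: y_def)
    moreover have "y - 1 \<le> \<rho> * \<phi> * y"
    proof -
      have "1 * y \<le> \<rho> * \<phi> * y"
        using False \<open>1 \<le> y\<close> by (intro mult_right_mono) auto
      then show ?thesis
        by linarith
    qed
    ultimately show ?thesis
      using \<phi> by (intro exI[of _ y]) auto
  qed
qed

text \<open>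
  The difference \<open>energy - \<rho> * sum of squares\<close> of an exact solution with value 1 at the apex
  is \<open>- \<rho>\<close> times the sum of its leaf values. Only inequalities are asserted, because beyond the
  first Dirichlet eigenvalue of a subtree there is no positive solution; there the subtree is
  scaled up as much as needed.
\<close>

lemma test_function:
  assumes "0 < \<rho>"
  shows "good t \<Longrightarrow> \<rho> * real (height t) < 1 \<Longrightarrow>
    \<exists>f. f (apex t) = 1 \<and>
      energy t f - \<rho> * (\<Sum>v \<in> ends t. (f v)\<^sup>2) \<le> - \<rho> * sum f (ends t) \<and>
      gains \<rho> (branches t) \<le> sum f (ends t) \<and>
      (\<not> spidery t \<longrightarrow> gains \<rho> (branches t) < sum f (ends t))"
proof (induction t)
  case (Vertex a)
  then show ?case
    by (intro exI[of _ "\<lambda>_. 1"]) simp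
next
  case (Join s t)
  have disj: "vset s \<inter> vset t = {}" "good s" "good t"
    using Join.prems by auto
  have hs: "\<rho> * real (height s) < 1" and ht1: "\<rho> * real (height t + 1) < 1"
    by (rule below_one_mono[OF assms Join.prems(2)], simp)+
  have ht: "\<rho> * real (height t) < 1"
    using below_one_mono[OF assms ht1] by simp
  \<comment> \<open>The leaves that the child contributes: a child without links is a leaf itself,
    and its value 1 agrees with \<open>gain \<rho> 0 = 1\<close>.\<close>
  define E where "E = (if height t = 0 then vset t else ends t)"
  define R where "R = gains \<rho> (branches t - {#height t#})"
  have E: "E \<subseteq> vset t" "finite E"
    using ends_subset[of t] by (auto simp: E_def)
  have below: "\<rho> * real l < 1" if "l \<in># branches t - {#height t#}" for l
    using that branches_bounds[of l t] below_one_mono[OF assms ht] by (auto dest: in_diffD)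
  have R: "0 \<le> R"
    unfolding R_def using below by (rule gains_nonneg)
  obtain f1 where f1: "f1 (apex s) = 1"
      "energy s f1 - \<rho> * (\<Sum>v \<in> ends s. (f1 v)\<^sup>2) \<le> - \<rho> * sum f1 (ends s)"
      "gains \<rho> (branches s) \<le> sum f1 (ends s)"
      "\<not> spidery s \<Longrightarrow> gains \<rho> (branches s) < sum f1 (ends s)"
    using Join.IH(1)[OF disj(2) hs] by blast
  have "\<exists>f2. f2 (apex t) = 1 \<and> energy t f2 - \<rho> * (\<Sum>v \<in> E. (f2 v)\<^sup>2) \<le> - \<rho> * sum f2 E \<and>
      gain \<rho> (height t) + R \<le> sum f2 E \<and> (\<not> spidery t \<longrightarrow> gain \<rho> (height t) + R < sum f2 E)"
  proof (cases "height t = 0")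
    case True
    then show ?thesis
      by (intro exI[of _ "\<lambda>_. 1"]) (auto simp: E_def R_def height_eq_0_iff gain_def)
  next
    case False
    then have "gains \<rho> (branches t) = gain \<rho> (height t) + R"
      using height_in_branches[of t] by (auto simp: R_def dest!: multi_member_split)
    then show ?thesis
      using Join.IH(2)[OF disj(3) ht] False by (simp add: E_def)
  qed
  then obtain f2 where f2: "f2 (apex t) = 1"
      "energy t f2 - \<rho> * (\<Sum>v \<in> E. (f2 v)\<^sup>2) \<le> - \<rho> * sum f2 E"
      "gain \<rho> (height t) + R \<le> sum f2 E"
      "\<not> spidery t \<Longrightarrow> gain \<rho> (height t) + R < sum f2 E"
    by blast
  obtain y where y: "1 \<le> y" "y - 1 \<le> \<rho> * sum f2 E * y" "gain \<rho> (height t + 1) + R \<le> y * sum f2 E"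
      "0 < R \<or> gain \<rho> (height t) + R < sum f2 E \<Longrightarrow> gain \<rho> (height t + 1) + R < y * sum f2 E"
    using stretch[OF assms ht1 R f2(3)] by blast
  define f where "f x = (if x \<in> vset t then y * f2 x else f1 x)" for x
  have fs: "f x = f1 x" if "x \<in> vset s" for x
    using that disj(1) by (auto simp: f_def)
  have ft: "f x = y * f2 x" if "x \<in> vset t" for x
    using that by (simp add: f_def)
  have un: "ends (Join s t) = ends s \<union> E" "ends s \<inter> E = {}"
    using E(1) ends_subset[of s] disj(1) by (simp add: E_def, blast)
  have sums: "sum f (ends s) = sum f1 (ends s)" "sum f E = y * sum f2 E"
      "(\<Sum>v \<in> ends s. (f v)\<^sup>2) = (\<Sum>v \<in> ends s. (f1 v)\<^sup>2)" "(\<Sum>v \<in> E. (f v)\<^sup>2) = y\<^sup>2 * (\<Sum>v \<in> E. (f2 v)\<^sup>2)"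
    using E(1) by (simp_all add: sum_distrib_left fs ft ends_in_vset subset_iff flip: power_mult_distrib cong: sum.cong)
  have "energy s f = energy s f1"
    using fs by (rule energy_cong)
  moreover have "energy t f = y\<^sup>2 * energy t f2"
    using energy_cong[of t f "\<lambda>x. y * f2 x"] ft energy_scale[of t y f2] by simp
  ultimately have "energy (Join s t) f = energy s f1 + y\<^sup>2 * energy t f2 + (1 - y)\<^sup>2"
    using energy_Join[OF Join.prems(1), of f] f1(1) f2(1) by (simp add: fs ft)
  moreover have "y\<^sup>2 * (energy t f2 - \<rho> * (\<Sum>v \<in> E. (f2 v)\<^sup>2)) \<le> y\<^sup>2 * (- \<rho> * sum f2 E)"
    using f2(2) by (intro mult_left_mono) auto
  \<comment> \<open>With \<open>\<phi> = sum f2 E\<close>, adding this bound for the link energy to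
    \<open>- \<rho> * \<phi> * y^2\<close> gives exactly \<open>- \<rho> * \<phi> * y\<close>, the
    bound required for the scaled child.\<close>
  moreover have "(y - 1) * (y - 1) \<le> (y - 1) * (\<rho> * sum f2 E * y)"
    using y(1,2) by (intro mult_left_mono) auto
  ultimately have le: "energy (Join s t) f - \<rho> * (\<Sum>v \<in> ends (Join s t). (f v)\<^sup>2) \<le> - \<rho> * sum f (ends (Join s t))"
    using f1(2) un E(2) sums by (simp add: sum.union_disjoint power2_eq_square algebra_simps)
  have sum_f: "sum f (ends (Join s t)) = sum f1 (ends s) + y * sum f2 E"
    using un E(2) sums by (simp add: sum.union_disjoint)
  have tot: "gains \<rho> (branches (Join s t)) = gains \<rho> (branches s) + (gain \<rho> (height t + 1) + R)"
    by (simp add: R_def)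
  have strict: "gains \<rho> (branches s) + (gain \<rho> (height t + 1) + R) < sum f1 (ends s) + y * sum f2 E"
    if "\<not> spidery (Join s t)"
  proof -
    have "\<not> spidery s \<or> \<not> spidery t \<or> size (branches t) > 1"
      using that by auto
    then consider "\<not> spidery s" | "\<not> spidery t" | "size (branches t) > 1"
      by blast
    then show ?thesis
    proof cases
      case 1
      then show ?thesis
        using f1(4) y(3) by linarith
    next
      case 2
      then show ?thesis
        using f1(3) y(4) f2(4) by fastforce
    next
      case 3
      have "height t > 0"
        using 3 by (cases "height t") (auto simp: height_eq_0_iff)
      then have "size (branches t - {#height t#}) \<noteq> 0"
        using 3 height_in_branches[of t] by (simp add: size_Diff_singleton)
      then have "branches t - {#height t#} \<noteq> {#}"
        by (metis size_empty)
      then have "0 < R"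
        unfolding R_def using below by (intro gains_pos)
      then show ?thesis
        using f1(3) y(4) by fastforce
    qed
  qed
  have "f (apex (Join s t)) = 1"
    using f1(1) fs by simp
  moreover have "gains \<rho> (branches (Join s t)) \<le> sum f (ends (Join s t))"
    unfolding sum_f tot using f1(3) y(3) by linarith
  moreover have "\<not> spidery (Join s t) \<longrightarrow> gains \<rho> (branches (Join s t)) < sum f (ends (Join s t))"
    unfolding sum_f tot using strict by blast
  ultimately show ?case
    using le by blast
qed

text \<open>The factors \<open>1 / \<phi>\<close> and \<open>- 1 / \<psi>\<close> make the total
  leaf sum 0. The halves then contribute at most \<open>- \<rho> * S\<close> with
  \<open>S = 1 / \<phi> + 1 / \<psi>\<close>, and the central edge contributes \<open>S^2\<close>,
  so the energy exceeds \<open>\<rho>\<close> times the sum of squares by at most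
  \<open>S * (S - \<rho>)\<close>.\<close>

lemma steklov_upper:
  assumes "good (Join a b)" "height a = r" "height b = r" "1 \<le> r" "0 < \<rho>" "\<rho> * real r < 1"
    and le: "1 / gains \<rho> (branches a) + 1 / gains \<rho> (branches b) \<le> \<rho>"
  shows "steklov_lambda2 (graph_of (Join a b)) \<le> \<rho>"
    and "1 / gains \<rho> (branches a) + 1 / gains \<rho> (branches b) < \<rho> \<or> \<not> spidery a \<or> \<not> spidery b \<Longrightarrow>
      steklov_lambda2 (graph_of (Join a b)) < \<rho>"
proof -
  have disj: "vset a \<inter> vset b = {}" "good a" "good b"
    using assms(1) by auto
  have pos: "0 < gains \<rho> (branches t)" if "height t = r" for t :: "'a rtree"
  proof (rule gains_pos)
    show "\<rho> * real l < 1" if "l \<in># branches t" for l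
      using branches_bounds[OF that] \<open>height t = r\<close> below_one_mono[OF assms(5,6)] by simp
    show "branches t \<noteq> {#}"
      using height_in_branches[of t] that assms(4) by auto
  qed
  obtain fa where fa: "fa (apex a) = 1"
      "energy a fa - \<rho> * (\<Sum>v \<in> ends a. (fa v)\<^sup>2) \<le> - \<rho> * sum fa (ends a)"
      "gains \<rho> (branches a) \<le> sum fa (ends a)"
      "\<not> spidery a \<Longrightarrow> gains \<rho> (branches a) < sum fa (ends a)"
    using test_function[OF assms(5) disj(2)] assms(2,6) by auto
  obtain fb where fb: "fb (apex b) = 1"
      "energy b fb - \<rho> * (\<Sum>v \<in> ends b. (fb v)\<^sup>2) \<le> - \<rho> * sum fb (ends b)"
      "gains \<rho> (branches b) \<le> sum fb (ends b)"
      "\<not> spidery b \<Longrightarrow> gains \<rho> (branches b) < sum fb (ends b)"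
    using test_function[OF assms(5) disj(3)] assms(3,6) by auto
  have ta: "0 < gains \<rho> (branches a)" and tb: "0 < gains \<rho> (branches b)"
    using pos assms(2,3) by blast+
  define \<phi> \<psi> where "\<phi> = sum fa (ends a)" and "\<psi> = sum fb (ends b)"
  have \<phi>: "0 < \<phi>" and \<psi>: "0 < \<psi>"
    using ta tb fa(3) fb(3) by (simp_all add: \<phi>_def \<psi>_def)
  define S where "S = 1 / \<phi> + 1 / \<psi>"
  have inv: "1 / \<phi> \<le> 1 / gains \<rho> (branches a)" "1 / \<psi> \<le> 1 / gains \<rho> (branches b)"
    using ta tb fa(3) fb(3) by (auto simp: \<phi>_def \<psi>_def intro!: divide_left_mono)
  have "\<not> spidery a \<Longrightarrow> 1 / \<phi> < 1 / gains \<rho> (branches a)"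
    "\<not> spidery b \<Longrightarrow> 1 / \<psi> < 1 / gains \<rho> (branches b)"
    using ta tb fa(4) fb(4) by (auto simp: \<phi>_def \<psi>_def intro!: divide_strict_left_mono)
  then have S: "0 < S" "S \<le> \<rho>"
    and strict: "1 / gains \<rho> (branches a) + 1 / gains \<rho> (branches b) < \<rho> \<or> \<not> spidery a \<or> \<not> spidery b \<Longrightarrow> S < \<rho>"
    using inv le \<phi> \<psi> by (auto simp: S_def intro!: add_pos_pos)
  define f where "f x = (if x \<in> vset b then (- 1 / \<psi>) * fb x else (1 / \<phi>) * fa x)" for x
  have f_a: "f x = (1 / \<phi>) * fa x" if "x \<in> vset a" for x
    using that disj(1) by (auto simp: f_def)
  have f_b: "f x = (- 1 / \<psi>) * fb x" if "x \<in> vset b" for x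
    using that by (simp add: f_def)
  have un: "ends (Join a b) = ends a \<union> ends b" "ends a \<inter> ends b = {}"
    using ends_subset[of a] ends_subset[of b] disj(1) assms(3,4) by auto
  have sums: "sum f (ends a) = (1 / \<phi>) * sum fa (ends a)" "sum f (ends b) = (- 1 / \<psi>) * sum fb (ends b)"
      "(\<Sum>v \<in> ends a. (f v)\<^sup>2) = (1 / \<phi>)\<^sup>2 * (\<Sum>v \<in> ends a. (fa v)\<^sup>2)"
      "(\<Sum>v \<in> ends b. (f v)\<^sup>2) = (- 1 / \<psi>)\<^sup>2 * (\<Sum>v \<in> ends b. (fb v)\<^sup>2)"
    unfolding sum_distrib_left power_mult_distrib[symmetric]
    by (simp_all only: f_a f_b ends_in_vset cong: sum.cong)
  have "sum f (ends a) = 1" "sum f (ends b) = - 1"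
    using \<phi> \<psi> unfolding sums \<phi>_def \<psi>_def by auto
  then have sum0: "sum f (ends (Join a b)) = 0" and nz: "\<exists>v \<in> ends (Join a b). f v \<noteq> 0"
    using un by (auto simp: sum.union_disjoint)
  let ?Q = "\<Sum>v \<in> ends (Join a b). (f v)\<^sup>2"
  have Q: "0 < ?Q"
    using nz by (auto simp del: ends.simps intro: sum_pos2)
  have "energy a f = (1 / \<phi>)\<^sup>2 * energy a fa"
    using energy_cong[of a f "\<lambda>x. (1 / \<phi>) * fa x"] f_a energy_scale[of a "1 / \<phi>" fa] by simp
  moreover have "energy b f = (- 1 / \<psi>)\<^sup>2 * energy b fb"
    using energy_cong[of b f "\<lambda>x. (- 1 / \<psi>) * fb x"] f_b energy_scale[of b "- 1 / \<psi>" fb] by simp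
  moreover have "f (apex a) - f (apex b) = S"
    using f_a[of "apex a"] f_b[of "apex b"] fa(1) fb(1) by (simp add: S_def)
  ultimately have "energy (Join a b) f = (1 / \<phi>)\<^sup>2 * energy a fa + (- 1 / \<psi>)\<^sup>2 * energy b fb + S\<^sup>2"
    using energy_Join[OF assms(1), of f] by simp
  moreover have "?Q = (1 / \<phi>)\<^sup>2 * (\<Sum>v \<in> ends a. (fa v)\<^sup>2) + (- 1 / \<psi>)\<^sup>2 * (\<Sum>v \<in> ends b. (fb v)\<^sup>2)"
    using un sums(3,4) by (simp add: sum.union_disjoint del: ends.simps)
  ultimately have "energy (Join a b) f - \<rho> * ?Q =
      (1 / \<phi>)\<^sup>2 * (energy a fa - \<rho> * (\<Sum>v \<in> ends a. (fa v)\<^sup>2)) +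
      (- 1 / \<psi>)\<^sup>2 * (energy b fb - \<rho> * (\<Sum>v \<in> ends b. (fb v)\<^sup>2)) + S\<^sup>2"
    by (simp only: distrib_left right_diff_distrib) (simp only: mult.left_commute)
  also have "\<dots> \<le> (1 / \<phi>)\<^sup>2 * (- \<rho> * \<phi>) + (- 1 / \<psi>)\<^sup>2 * (- \<rho> * \<psi>) + S\<^sup>2"
    using fa(2) fb(2) unfolding \<phi>_def \<psi>_def by (intro add_mono mult_left_mono) auto
  also have "\<dots> = S * (S - \<rho>)"
    using \<phi> \<psi> by (simp add: S_def power2_eq_square algebra_simps)
  finally have key: "energy (Join a b) f \<le> \<rho> * ?Q + S * (S - \<rho>)"
    by simp
  have "height (Join a b) > 0" "height a > 0"
    using assms by simp_all
  then have lam: "steklov_lambda2 (graph_of (Join a b)) \<le> energy (Join a b) f / ?Q"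
    using leaves_graph_of[OF assms(1)] nz sum0 by (intro steklov_le_quotient assms(1)) auto
  have "S * (S - \<rho>) \<le> 0"
    using S by (intro mult_nonneg_nonpos) auto
  then have "energy (Join a b) f / ?Q \<le> \<rho>"
    using key Q by (simp add: pos_divide_le_eq del: ends.simps)
  then show "steklov_lambda2 (graph_of (Join a b)) \<le> \<rho>"
    using lam by linarith
  show "steklov_lambda2 (graph_of (Join a b)) < \<rho>"
    if "1 / gains \<rho> (branches a) + 1 / gains \<rho> (branches b) < \<rho> \<or> \<not> spidery a \<or> \<not> spidery b"
  proof -
    have "S * (S - \<rho>) < 0"
      using S strict[OF that] by (intro mult_pos_neg) auto
    then have "energy (Join a b) f / ?Q < \<rho>"
      using key Q by (simp add: pos_divide_less_eq del: ends.simps)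
    then show ?thesis
      using lam by linarith
  qed
qed

text \<open>
  The eigenvalue equation of the spider with one branch of length \<open>r + 1\<close> and further
  branches \<open>C\<close>: the gains of all branches sum up to 0, where
  \<open>gain \<rho> (r + 1) < 0\<close>.
\<close>

definition balanced :: "nat \<Rightarrow> nat multiset \<Rightarrow> real \<Rightarrow> bool" where
  "balanced r C \<rho> \<longleftrightarrow> 1 < \<rho> * real (r + 1) \<and> \<rho> * real r < 1 \<and> gains \<rho> C * (\<rho> * real (r + 1) - 1) = 1"

lemma balanced_pos: "balanced r C \<rho> \<Longrightarrow> 0 < \<rho>"
  unfolding balanced_def by (metis less_trans not_less_iff_gr_or_eq of_nat_0_less_iff zero_less_Suc
      Suc_eq_plus1 zero_less_mult_pos2 zero_less_one)

lemma continuous_on_gains: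
  "(\<And>\<rho> l. \<rho> \<in> S \<Longrightarrow> l \<in># C \<Longrightarrow> \<rho> * real l < 1) \<Longrightarrow> continuous_on S (\<lambda>\<rho>. gains \<rho> C)"
proof (induction C)
  case (add l C)
  have "continuous_on S (\<lambda>\<rho>. gain \<rho> l)"
    unfolding gain_def using add.prems by (intro continuous_intros) force
  then show ?case
    using add by (auto intro!: continuous_intros)
qed simp

lemma balanced_exists:
  assumes "r \<in># C" "\<And>l. l \<in># C \<Longrightarrow> l \<le> r"
  shows "\<exists>\<rho>. balanced r C \<rho>"
proof -
  \<comment> \<open>\<open>y\<close> is the eigenvalue of the path with \<open>2 * r + 1\<close>
    edges: there one branch of length \<open>r\<close> already balances the branch of length
    \<open>r + 1\<close>, and further branches only increase \<open>F y\<close>.\<close>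
  define x y where "x = 1 / real (r + 1)" and "y = 2 / (2 * real r + 1)"
  define F where "F \<rho> = gains \<rho> C * (\<rho> * real (r + 1) - 1)" for \<rho>
  have xy: "x \<le> y" "0 < x"
    by (simp_all add: x_def y_def field_simps)
  have yr: "y * real r < 1"
    by (simp add: y_def field_simps)
  have below: "\<rho> * real l < 1" if "\<rho> \<in> {x..y}" "l \<in># C" for \<rho> l
  proof -
    have "\<rho> * real l \<le> y * real r"
      using that xy assms(2)[OF that(2)] by (intro mult_mono) auto
    then show ?thesis
      using yr by linarith
  qed
  have cont: "continuous_on {x..y} F"
    unfolding F_def using below by (intro continuous_intros continuous_on_gains) auto
  have "F x = 0"
    by (simp add: F_def x_def)
  moreover have "1 \<le> F y"
  proof -
    obtain C' where C': "C = add_mset r C'"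
      using assms(1) by (auto dest: multi_member_split)
    have "0 \<le> gains y C'"
      using below[of y] xy C' by (intro gains_nonneg) auto
    then have "gain y r \<le> gains y C"
      by (simp add: C')
    moreover have "gain y r = 2 * real r + 1" "y * real (r + 1) - 1 = 1 / (2 * real r + 1)"
      by (simp_all add: gain_def y_def field_simps)
    ultimately show ?thesis
      by (simp add: F_def pos_le_divide_eq)
  qed
  ultimately obtain \<rho> where \<rho>: "x \<le> \<rho>" "\<rho> \<le> y" "F \<rho> = 1"
    using IVT'[of F x 1 y] cont xy by auto
  then have "\<rho> \<noteq> x"
    using \<open>F x = 0\<close> by auto
  then have "1 < \<rho> * real (r + 1)"
    using \<rho>(1) by (simp add: x_def field_simps)
  moreover have "\<rho> * real r < 1"
    using below[of \<rho> r] \<rho> assms(1) by simp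
  ultimately show ?thesis
    using \<rho>(3) by (auto simp: balanced_def F_def)
qed

lemma gains_mono:
  "\<rho> \<le> \<rho>' \<Longrightarrow> (\<And>l. l \<in># C \<Longrightarrow> \<rho>' * real l < 1) \<Longrightarrow> gains \<rho> C \<le> gains \<rho>' C"
proof (induction C)
  case (add l C)
  have "\<rho> * real l \<le> \<rho>' * real l" "\<rho>' * real l < 1"
    using add.prems by (auto intro: mult_right_mono)
  then have "gain \<rho> l \<le> gain \<rho>' l"
    by (auto simp: gain_def intro!: divide_left_mono mult_pos_pos)
  then show ?case
    using add by (simp add: add_mono)
qed simp

text \<open>The gains required by the equation, \<open>1 / (\<rho> * (r + 1) - 1)\<close>, fall with
  \<open>\<rho>\<close>, while those of a fixed multiset grow. Read contrapositively: if
  \<open>C'\<close> has smaller gains at the eigenvalue of \<open>C\<close>, then its own eigenvalue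
  is larger.\<close>

lemma balanced_le_imp_gains_le:
  assumes "balanced r C \<rho>" "balanced r C' \<rho>'" "\<rho>' \<le> \<rho>" "\<And>l. l \<in># C' \<Longrightarrow> l \<le> r"
  shows "gains \<rho> C \<le> gains \<rho> C'" "\<rho>' < \<rho> \<Longrightarrow> gains \<rho> C < gains \<rho> C'"
proof -
  have "\<rho> * real l < 1" if "l \<in># C'" for l
    using below_one_mono[OF balanced_pos[OF assms(1)]] assms(1,4) that by (auto simp: balanced_def)
  then have mono: "gains \<rho>' C' \<le> gains \<rho> C'"
    using assms(3) by (rule gains_mono[rotated])
  have tot: "gains \<rho> C = 1 / (\<rho> * real (r + 1) - 1)" "gains \<rho>' C' = 1 / (\<rho>' * real (r + 1) - 1)"
    "0 < \<rho> * real (r + 1) - 1" "0 < \<rho>' * real (r + 1) - 1"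
    using assms(1,2) by (auto simp: balanced_def eq_divide_eq)
  have "\<rho>' * real (r + 1) \<le> \<rho> * real (r + 1)"
    using assms(3) by (intro mult_right_mono) auto
  then have "gains \<rho> C \<le> gains \<rho>' C'"
    unfolding tot using tot(3,4) by (intro divide_left_mono) auto
  then show "gains \<rho> C \<le> gains \<rho> C'"
    using mono by linarith
  assume "\<rho>' < \<rho>"
  then have "\<rho>' * real (r + 1) < \<rho> * real (r + 1)"
    by (intro mult_strict_right_mono) auto
  then have "gains \<rho> C < gains \<rho>' C'"
    unfolding tot using tot(3,4) by (intro divide_strict_left_mono) auto
  then show "gains \<rho> C < gains \<rho> C'"
    using mono by linarith
qed

lemma reciprocal_concentrate:
  fixes p \<alpha> \<beta> :: real
  assumes "0 < p" "0 \<le> \<alpha>" "0 \<le> \<beta>"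
  shows "1 / (p + \<alpha>) + 1 / (p + \<beta>) \<le> 1 / p + 1 / (p + \<alpha> + \<beta>)"
    and "0 < \<alpha> \<Longrightarrow> 0 < \<beta> \<Longrightarrow> 1 / (p + \<alpha>) + 1 / (p + \<beta>) < 1 / p + 1 / (p + \<alpha> + \<beta>)"
proof -
  have pos: "0 < p + \<alpha>" "0 < p + \<beta>" "0 < p + \<alpha> + \<beta>"
    using assms by auto
  have "1 / p + 1 / (p + \<alpha> + \<beta>) - (1 / (p + \<alpha>) + 1 / (p + \<beta>)) =
      \<alpha> * \<beta> * (2 * p + \<alpha> + \<beta>) / (p * (p + \<alpha> + \<beta>) * ((p + \<alpha>) * (p + \<beta>)))"
  proof -
    have "1 / p + 1 / (p + \<alpha> + \<beta>) = (2 * p + \<alpha> + \<beta>) / (p * (p + \<alpha> + \<beta>))"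
      using assms(1) pos by (simp add: add_frac_eq)
    moreover have "1 / (p + \<alpha>) + 1 / (p + \<beta>) = (2 * p + \<alpha> + \<beta>) / ((p + \<alpha>) * (p + \<beta>))"
      using pos by (simp add: add_frac_eq)
    moreover have "(2 * p + \<alpha> + \<beta>) / (p * (p + \<alpha> + \<beta>)) - (2 * p + \<alpha> + \<beta>) / ((p + \<alpha>) * (p + \<beta>)) =
        ((2 * p + \<alpha> + \<beta>) * ((p + \<alpha>) * (p + \<beta>)) - (2 * p + \<alpha> + \<beta>) * (p * (p + \<alpha> + \<beta>))) /
        (p * (p + \<alpha> + \<beta>) * ((p + \<alpha>) * (p + \<beta>)))"
      using assms(1) pos by (intro diff_frac_eq) auto
    moreover have "(2 * p + \<alpha> + \<beta>) * ((p + \<alpha>) * (p + \<beta>)) - (2 * p + \<alpha> + \<beta>) * (p * (p + \<alpha> + \<beta>)) =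
        \<alpha> * \<beta> * (2 * p + \<alpha> + \<beta>)"
      by algebra
    ultimately show ?thesis
      by simp
  qed
  moreover have "0 \<le> \<alpha> * \<beta> * (2 * p + \<alpha> + \<beta>) / (p * (p + \<alpha> + \<beta>) * ((p + \<alpha>) * (p + \<beta>)))"
    using assms pos by (intro divide_nonneg_nonneg mult_nonneg_nonneg) auto
  ultimately show "1 / (p + \<alpha>) + 1 / (p + \<beta>) \<le> 1 / p + 1 / (p + \<alpha> + \<beta>)"
    by linarith
  assume "0 < \<alpha>" "0 < \<beta>"
  then have "0 < \<alpha> * \<beta> * (2 * p + \<alpha> + \<beta>) / (p * (p + \<alpha> + \<beta>) * ((p + \<alpha>) * (p + \<beta>)))"
    using assms pos by (intro divide_pos_pos mult_pos_pos) auto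
  then show "1 / (p + \<alpha>) + 1 / (p + \<beta>) < 1 / p + 1 / (p + \<alpha> + \<beta>)"
    using \<open>1 / p + 1 / (p + \<alpha> + \<beta>) - (1 / (p + \<alpha>) + 1 / (p + \<beta>)) = _\<close> by linarith
qed

text \<open>With all surplus branches on one side the bound becomes
  \<open>(1 - \<rho> * r) + (\<rho> * (r + 1) - 1) = \<rho>\<close>. If \<open>\<rho>\<close> is
  attained, neither detaching paths nor concentrating branches has lost anything, so both halves are
  spiders and one is a bare path. The central edge lengthens this path to \<open>r + 1\<close>,
  which is why \<open>C\<close> has one \<open>r\<close> less than the two halves together.\<close>

lemma steklov_reduction:
  assumes "good (Join a b)" "height a = r" "height b = r" "1 \<le> r"
    and C: "add_mset r C = branches a + branches b" and bal: "balanced r C \<rho>"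
  shows "steklov_lambda2 (graph_of (Join a b)) \<le> \<rho>"
    and "steklov_lambda2 (graph_of (Join a b)) = \<rho> \<Longrightarrow>
      \<exists>t. good t \<and> graph_of t = graph_of (Join a b) \<and> spidery t \<and> branches t = add_mset (r + 1) C"
proof -
  have \<rho>: "0 < \<rho>" "\<rho> * real r < 1"
    using bal balanced_pos by (auto simp: balanced_def)
  obtain A where A: "branches a = add_mset r A"
    using height_in_branches[of a] assms(2,4) by (auto dest: multi_member_split)
  obtain B where B: "branches b = add_mset r B"
    using height_in_branches[of b] assms(3,4) by (auto dest: multi_member_split)
  have C': "C = add_mset r (A + B)"
    using C by (simp add: A B)
  have below: "\<rho> * real l < 1" if "l \<in># A + B" for l
    using branches_bounds[of l a] branches_bounds[of l b] that A B assms(2,3) below_one_mono[OF \<rho>] by auto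
  define p \<alpha> \<beta> where "p = gain \<rho> r" and "\<alpha> = gains \<rho> A" and "\<beta> = gains \<rho> B"
  have p: "0 < p" "1 / p = 1 - \<rho> * real r"
    using gain_pos[OF \<rho>(2)] by (simp_all add: p_def gain_def)
  have ab: "0 \<le> \<alpha>" "0 \<le> \<beta>"
    using below by (auto simp: \<alpha>_def \<beta>_def intro: gains_nonneg)
  have "(p + \<alpha> + \<beta>) * (\<rho> * real (r + 1) - 1) = 1"
    using bal by (simp add: balanced_def C' p_def \<alpha>_def \<beta>_def add.assoc)
  then have "1 / (p + \<alpha> + \<beta>) = \<rho> * real (r + 1) - 1"
    using p(1) ab by (simp add: divide_eq_eq mult.commute)
  then have sum: "1 / p + 1 / (p + \<alpha> + \<beta>) = \<rho>"
    using p(2) by (simp add: algebra_simps)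
  have tot: "gains \<rho> (branches a) = p + \<alpha>" "gains \<rho> (branches b) = p + \<beta>"
    by (simp_all add: A B p_def \<alpha>_def \<beta>_def)
  have le: "1 / gains \<rho> (branches a) + 1 / gains \<rho> (branches b) \<le> \<rho>"
    using reciprocal_concentrate(1)[OF p(1) ab] by (simp add: tot sum)
  note upper = steklov_upper[OF assms(1-4) \<rho> le]
  show "steklov_lambda2 (graph_of (Join a b)) \<le> \<rho>"
    by (rule upper(1))
  assume eq: "steklov_lambda2 (graph_of (Join a b)) = \<rho>"
  then have sp: "spidery a" "spidery b"
    and ge: "\<not> 1 / gains \<rho> (branches a) + 1 / gains \<rho> (branches b) < \<rho>"
    using upper(2) by auto
  have "A = {#} \<or> B = {#}"
  proof (rule ccontr)
    assume "\<not> ?thesis"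
    then have "0 < \<alpha>" "0 < \<beta>"
      using below by (auto simp: \<alpha>_def \<beta>_def intro: gains_pos)
    then show False
      using ge reciprocal_concentrate(2)[OF p(1) ab] by (simp add: tot sum)
  qed
  then show "\<exists>t. good t \<and> graph_of t = graph_of (Join a b) \<and> spidery t \<and> branches t = add_mset (r + 1) C"
  proof
    assume "A = {#}"
    then have "branches (Join b a) = add_mset (r + 1) C" "spidery (Join b a)"
      using sp assms(2) by (simp_all add: A B C')
    moreover have "good (Join b a)"
      using assms(1) by auto
    ultimately show ?thesis
      using graph_of_Join_commute[of b a] by blast
  next
    assume "B = {#}"
    then have "branches (Join a b) = add_mset (r + 1) C" "spidery (Join a b)"
      using sp assms(3) by (simp_all add: A B C')
    then show ?thesis
      using assms(1) by blast
  qed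
qed

section \<open>The Steklov eigenvalue of a spider\<close>

text \<open>Cauchy-Schwarz for resistors in series: a unit link added to a chain of resistance
  \<open>h\<close> gives resistance \<open>h + 1\<close>.\<close>

lemma series_resistance:
  fixes h E x d :: real
  assumes "0 \<le> h" "0 \<le> E" "x\<^sup>2 \<le> h * E"
  shows "(x + d)\<^sup>2 \<le> (h + 1) * (E + d\<^sup>2)"
proof (cases "h = 0")
  case True
  then show ?thesis
    using assms by simp
next
  case False
  then have "0 < h"
    using assms(1) by simp
  have "2 * x * d \<le> h * d\<^sup>2 + x\<^sup>2 / h"
  proof -
    have "0 \<le> (h * d - x)\<^sup>2 / h"
      using \<open>0 < h\<close> by simp
    also have "\<dots> = h * d\<^sup>2 + x\<^sup>2 / h - 2 * x * d"
      using False by (simp add: power2_eq_square field_simps)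
    finally show ?thesis
      by simp
  qed
  moreover have "x\<^sup>2 / h \<le> E"
    using assms(3) \<open>0 < h\<close> by (simp add: pos_divide_le_eq mult.commute)
  ultimately show ?thesis
    using assms(3) by (simp add: power2_sum algebra_simps)
qed

text \<open>The path is measured together with a link from its apex up to an arbitrary value
  \<open>p\<close>. In this form the single vertex, with that one link, can serve as the base of the
  induction.\<close>

lemma path_energy:
  "good t \<Longrightarrow> size (branches t) \<le> 1 \<Longrightarrow>
    \<exists>e. (if height t = 0 then vset t else ends t) = {e} \<and>
      (\<forall>p. (f e - p)\<^sup>2 \<le> real (height t + 1) * (energy t f + (p - f (apex t))\<^sup>2))"
proof (induction t)
  case (Vertex a)
  then show ?case
    by (simp add: power2_commute)
next
  case (Join s t)
  have s: "branches s = {#}" "height s = 0" and t: "size (branches t) \<le> 1"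
    using Join.prems(2) height_in_branches[of s] by (auto simp: size_Diff_singleton_if split: if_splits)
  then obtain e where e: "(if height t = 0 then vset t else ends t) = {e}"
    "(f e - f (apex s))\<^sup>2 \<le> real (height t + 1) * (energy t f + (f (apex s) - f (apex t))\<^sup>2)"
    using Join by auto
  obtain c where c: "s = Vertex c"
    using s(2) by (auto simp: height_eq_0_iff)
  have h: "height (Join s t) = height t + 1"
    using s(2) by simp
  have "(f e - f (apex s))\<^sup>2 \<le> real (height (Join s t)) * energy (Join s t) f"
    unfolding h energy_Join[OF Join.prems(1)] using e(2) by (simp add: c)
  then have "(f e - f (apex s) + (f (apex s) - p))\<^sup>2 \<le>
      (real (height (Join s t)) + 1) * (energy (Join s t) f + (f (apex s) - p)\<^sup>2)" for p
    by (intro series_resistance) auto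
  then have "(f e - p)\<^sup>2 \<le> real (height (Join s t) + 1) * (energy (Join s t) f + (p - f (apex (Join s t)))\<^sup>2)" for p
    by (simp add: power2_commute add.commute)
  moreover have "(if height (Join s t) = 0 then vset (Join s t) else ends (Join s t)) = {e}"
    using e(1) by (simp add: c)
  ultimately show ?case
    by blast
qed

text \<open>The square is completed in the leaf value \<open>g\<close>; for center value
  \<open>p\<close> it vanishes at \<open>g = p * gain \<rho> l\<close>. Allowing
  \<open>\<rho> * l > 1\<close> covers the leg of length \<open>r + 1\<close>, where the gain is
  negative and the square enters with a minus sign.\<close>

lemma square_split:
  fixes \<rho> p g :: real
  assumes "\<rho> * real l \<noteq> 1" "1 \<le> l"
  shows "(g - p)\<^sup>2 / real l - \<rho> * g\<^sup>2 = - \<rho> * p\<^sup>2 * gain \<rho> l + (g - p * gain \<rho> l)\<^sup>2 / (real l * gain \<rho> l)"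
proof -
  define q where "q = 1 - \<rho> * real l"
  have q: "q \<noteq> 0" "\<rho> * real l = 1 - q" "gain \<rho> l = 1 / q" "real l \<noteq> 0"
    using assms by (simp_all add: q_def gain_def)
  have "real l * ((g - p)\<^sup>2 / real l - \<rho> * g\<^sup>2) = (g - p)\<^sup>2 - (\<rho> * real l) * g\<^sup>2"
    using q(4) by (simp add: right_diff_distrib)
  also have "\<dots> = q * g\<^sup>2 - 2 * g * p + p\<^sup>2"
    unfolding q(2) by (simp add: power2_eq_square algebra_simps)
  also have "\<dots> = - (1 - q) * p\<^sup>2 / q + q * (g - p / q)\<^sup>2"
    using q(1) by (simp add: power2_eq_square field_simps)
  also have "\<dots> = real l * (- \<rho> * p\<^sup>2 * gain \<rho> l + (g - p * gain \<rho> l)\<^sup>2 / (real l * gain \<rho> l))"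
    unfolding q(3) q(2)[symmetric] using q(1,4) by (simp add: right_diff_distrib mult.assoc mult.commute mult.left_commute)
  finally show ?thesis
    using q(4) by simp
qed

text \<open>The sum of the denominators in \<open>square_split\<close>. If the deviations of the
  leaf values add up to \<open>x\<close>, their squares together cost at least \<open>x^2\<close>
  divided by this sum.\<close>

definition stiffness :: "real \<Rightarrow> nat multiset \<Rightarrow> real" where
  "stiffness \<rho> N = (\<Sum>l \<in># N. real l * gain \<rho> l)"

lemma stiffness_simps [simp]:
  "stiffness \<rho> {#} = 0"
  "stiffness \<rho> (add_mset l N) = real l * gain \<rho> l + stiffness \<rho> N"
  by (simp_all add: stiffness_def)

lemma stiffness_le_gains:
  "(\<And>l. l \<in># N \<Longrightarrow> l \<le> r \<and> \<rho> * real l < 1) \<Longrightarrow> stiffness \<rho> N \<le> real r * gains \<rho> N"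
proof (induction N)
  case (add l N)
  then have "real l * gain \<rho> l \<le> real r * gain \<rho> l"
    by (intro mult_right_mono) (auto intro: less_imp_le gain_pos)
  then show ?case
    using add by (simp add: distrib_left add_mono)
qed simp

lemma stiffness_pos:
  "(\<And>l. l \<in># N \<Longrightarrow> 1 \<le> l \<and> \<rho> * real l < 1) \<Longrightarrow> N \<noteq> {#} \<Longrightarrow> 0 < stiffness \<rho> N"
proof (induction N)
  case (add l N)
  have "0 < real l * gain \<rho> l"
    using add.prems(1)[of l] by (intro mult_pos_pos gain_pos) auto
  then show ?case
    using add by (cases "N = {#}") auto
qed simp

lemma sedrakyan:
  fixes x y V W :: real
  assumes "0 < V" "0 < W"
  shows "(x + y)\<^sup>2 / (V + W) \<le> x\<^sup>2 / V + y\<^sup>2 / W"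
proof -
  have "x\<^sup>2 / V + y\<^sup>2 / W - (x + y)\<^sup>2 / (V + W) = (x * W - y * V)\<^sup>2 / (V * W * (V + W))"
    using assms by (simp add: divide_simps) (simp add: power2_eq_square algebra_simps)
  moreover have "0 \<le> (x * W - y * V)\<^sup>2 / (V * W * (V + W))"
    using assms by simp
  ultimately show ?thesis
    by linarith
qed

text \<open>\<open>square_split\<close> is summed over the legs. Of all the squares, Cauchy-Schwarz
  retains only what depends on the deviation of the total leaf sum.\<close>

lemma spidery_energy:
  assumes "0 < \<rho>"
  shows "good t \<Longrightarrow> spidery t \<Longrightarrow> \<rho> * real (height t) < 1 \<Longrightarrow>
    - \<rho> * (f (apex t))\<^sup>2 * gains \<rho> (branches t) +
      (sum f (ends t) - f (apex t) * gains \<rho> (branches t))\<^sup>2 / stiffness \<rho> (branches t)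
    \<le> energy t f - \<rho> * (\<Sum>v \<in> ends t. (f v)\<^sup>2)"
proof (induction t)
  case (Join s t)
  have disj: "vset s \<inter> vset t = {}" "good s" "good t"
    using Join.prems by auto
  define l where "l = height t + 1"
  have hs: "\<rho> * real (height s) < 1" and hl: "\<rho> * real l < 1"
    by (rule below_one_mono[OF assms Join.prems(3)], simp add: l_def)+
  define p where "p = f (apex s)"
  obtain e where e: "(if height t = 0 then vset t else ends t) = {e}"
    "\<And>p. (f e - p)\<^sup>2 \<le> real l * (energy t f + (p - f (apex t))\<^sup>2)"
    using path_energy[OF disj(3), of f] Join.prems(2) by (auto simp: l_def)
  have "e \<in> vset t"
    using e(1) ends_in_vset[of e t] by (auto split: if_splits)
  then have e_notin: "e \<notin> ends s"
    using disj(1) ends_in_vset[of e s] by auto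
  have ends: "ends (Join s t) = insert e (ends s)"
    using e(1) by auto
  have bt: "branches (Join s t) = add_mset l (branches s)"
    unfolding l_def by (rule branches_spidery_Join[OF Join.prems(2)])
  have k: "0 < gain \<rho> l" "0 < real l"
    using gain_pos[OF hl] by (simp_all add: l_def)
  define x1 x2 where "x1 = sum f (ends s) - p * gains \<rho> (branches s)" and "x2 = f e - p * gain \<rho> l"
  have flow: "(f e - p)\<^sup>2 / real l \<le> energy t f + (p - f (apex t))\<^sup>2"
    using e(2)[of p] k by (simp add: pos_divide_le_eq mult.commute)
  have branch: "(f e - p)\<^sup>2 / real l - \<rho> * (f e)\<^sup>2 = - \<rho> * p\<^sup>2 * gain \<rho> l + x2\<^sup>2 / (real l * gain \<rho> l)"
    unfolding x2_def using hl k by (intro square_split) (auto simp: l_def)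
  have rest: "- \<rho> * p\<^sup>2 * gains \<rho> (branches s) + x1\<^sup>2 / stiffness \<rho> (branches s)
      \<le> energy s f - \<rho> * (\<Sum>v \<in> ends s. (f v)\<^sup>2)"
    using Join.IH(1)[OF disj(2) _ hs] Join.prems(2) by (simp add: p_def x1_def)
  have split: "(x2 + x1)\<^sup>2 / (real l * gain \<rho> l + stiffness \<rho> (branches s)) \<le>
      x2\<^sup>2 / (real l * gain \<rho> l) + x1\<^sup>2 / stiffness \<rho> (branches s)"
  proof (cases "branches s = {#}")
    \<comment> \<open>Without branches the stiffness is 0 and division by it yields 0, in accordance
      with \<open>x1 = 0\<close>.\<close>
    case True
    then have "height s = 0"
      using height_in_branches[of s] by auto
    then have "x1 = 0"
      by (auto simp: x1_def height_eq_0_iff)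
    then show ?thesis
      using True by simp
  next
    case False
    have "0 < stiffness \<rho> (branches s)"
      using False branches_bounds[of _ s] below_one_mono[OF assms hs] by (intro stiffness_pos) auto
    then show ?thesis
      using k by (intro sedrakyan mult_pos_pos)
  qed
  have en: "energy (Join s t) f = energy s f + energy t f + (p - f (apex t))\<^sup>2"
    using energy_Join[OF Join.prems(1), of f] by (simp add: p_def)
  have sq: "(\<Sum>v \<in> ends (Join s t). (f v)\<^sup>2) = (f e)\<^sup>2 + (\<Sum>v \<in> ends s. (f v)\<^sup>2)"
    using e_notin by (simp add: ends del: ends.simps)
  have dev: "sum f (ends (Join s t)) - f (apex (Join s t)) * gains \<rho> (branches (Join s t)) = x2 + x1"
    using e_notin by (simp add: ends bt x1_def x2_def p_def algebra_simps del: ends.simps branches.simps)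
  have st: "stiffness \<rho> (branches (Join s t)) = real l * gain \<rho> l + stiffness \<rho> (branches s)"
    "gains \<rho> (branches (Join s t)) = gain \<rho> l + gains \<rho> (branches s)" "f (apex (Join s t)) = p"
    by (simp_all add: bt p_def del: branches.simps)
  show ?case
    unfolding dev unfolding st en sq distrib_left using flow branch rest split by linarith
qed simp

text \<open>The difficulty of the lower bound is the negative square of the long leg. Balance
  cancels the terms with the center value, and leaf sum 0 makes the deviation of the long leg
  opposite to the deviation \<open>x\<close> of all others. There remains
  \<open>x^2 / stiffness \<rho> C - x^2 / ((r + 1) * gains \<rho> C)\<close>, which is nonnegative
  because the lengths in \<open>C\<close> are at most \<open>r\<close>.\<close>

lemma steklov_spidery:
  assumes "good t" "spidery t" "branches t = add_mset (r + 1) C" "1 \<le> r" "r \<in># C" "\<forall>l \<in># C. l \<le> r"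
    and bal: "balanced r C \<rho>"
  shows "steklov_lambda2 (graph_of t) = \<rho>"
proof -
  obtain a b where ab: "good (Join a b)" "graph_of (Join a b) = graph_of t" "spidery (Join a b)"
    "height a = r" "height b = r" "branches a = C" "branches b = {#r#}"
    using spidery_central[OF assms(1-3,5,6,4)] by blast
  have \<rho>: "0 < \<rho>" "\<rho> * real r < 1" "1 < \<rho> * real (r + 1)" "gains \<rho> C * (\<rho> * real (r + 1) - 1) = 1"
    using bal balanced_pos by (auto simp: balanced_def)
  have "steklov_lambda2 (graph_of (Join a b)) \<le> \<rho>"
    by (rule steklov_reduction(1)[OF ab(1,4,5) assms(4) _ bal]) (simp add: ab(6,7))
  moreover have "\<rho> \<le> steklov_lambda2 (graph_of (Join a b))"
  proof -
    have disj: "vset a \<inter> vset b = {}" "good a" "good b"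
      using ab(1) by auto
    obtain e where "ends b = {e}"
      using path_energy[OF disj(3), of "\<lambda>_. 0"] ab(5,7) assms(4) by auto
    then have "e \<in> vset b"
      using ends_in_vset[of e b] by simp
    obtain v where "v \<in> ends a"
      using ends_nonempty[of a] ab(4) assms(4) by auto
    have e: "e \<notin> ends a" "v \<noteq> e"
      using \<open>e \<in> vset b\<close> \<open>v \<in> ends a\<close> disj(1) ends_in_vset[of _ a] by auto
    have ends: "ends (Join a b) = insert e (ends a)"
      using \<open>ends b = {e}\<close> ab(5) assms(4) by auto
    \<comment> \<open>Admissible data supported on two leaves, as required by
      \<open>steklov_ge\<close>.\<close>
    define f0 where "f0 x = (if x = e then - 1 else if x = v then 1 else 0 :: real)" for x
    have "sum f0 (ends a) = (\<Sum>x \<in> ends a. if x = v then 1 else 0)"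
      using e by (intro sum.cong) (auto simp: f0_def)
    then have "sum f0 (ends (Join a b)) = 0"
      using e \<open>v \<in> ends a\<close> by (simp add: ends f0_def del: ends.simps)
    moreover have "\<exists>x \<in> ends (Join a b). f0 x \<noteq> 0"
      using ends by (auto simp: f0_def)
    moreover have "\<rho> * (\<Sum>v \<in> ends (Join a b). (f v)\<^sup>2) \<le> energy (Join a b) f"
      if zero: "sum f (ends (Join a b)) = 0" for f
    proof -
      define p x where "p = f (apex a)" and "x = sum f (ends a) - p * gains \<rho> C"
      have en: "energy (Join a b) f = energy a f + energy b f + (p - f (apex b))\<^sup>2"
        using energy_Join[OF ab(1), of f] by (simp add: p_def)
      have sq: "(\<Sum>v \<in> ends (Join a b). (f v)\<^sup>2) = (f e)\<^sup>2 + (\<Sum>v \<in> ends a. (f v)\<^sup>2)"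
        using e by (simp add: ends del: ends.simps)
      have below: "\<rho> * real l < 1" if "l \<in># C" for l
        using that assms(6) below_one_mono[OF \<rho>(1,2)] by auto
      have g: "gain \<rho> (Suc r) = - gains \<rho> C"
      proof -
        have "gains \<rho> C = 1 / (\<rho> * real (r + 1) - 1)"
          using \<rho>(3,4) by (simp add: eq_divide_eq)
        also have "\<dots> = - (1 / (1 - \<rho> * real (r + 1)))"
          by (metis minus_diff_eq minus_divide_right)
        finally show ?thesis
          by (simp add: gain_def)
      qed
      obtain e' where e': "(if height b = 0 then vset b else ends b) = {e'}"
        "\<And>p. (f e' - p)\<^sup>2 \<le> real (height b + 1) * (energy b f + (p - f (apex b))\<^sup>2)"
        using path_energy[OF disj(3), of f] ab(7) by auto
      have "e' = e"
        using e'(1) ab(5) assms(4) \<open>ends b = {e}\<close> by simp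
      have "f e = - sum f (ends a)"
        using zero e by (simp add: ends del: ends.simps)
      then have "f e - p * gain \<rho> (r + 1) = - x"
        by (simp add: g x_def)
      moreover have "(f e - p)\<^sup>2 / real (r + 1) - \<rho> * (f e)\<^sup>2 =
          - \<rho> * p\<^sup>2 * gain \<rho> (r + 1) + (f e - p * gain \<rho> (r + 1))\<^sup>2 / (real (r + 1) * gain \<rho> (r + 1))"
        using \<rho>(3) by (intro square_split) auto
      ultimately have "(f e - p)\<^sup>2 / real (r + 1) - \<rho> * (f e)\<^sup>2 =
          \<rho> * p\<^sup>2 * gains \<rho> C - x\<^sup>2 / (real (r + 1) * gains \<rho> C)"
        by (simp add: g)
      moreover have "(f e - p)\<^sup>2 / real (r + 1) \<le> energy b f + (p - f (apex b))\<^sup>2"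
        using e'(2)[of p] ab(5) by (simp add: \<open>e' = e\<close> pos_divide_le_eq mult.commute)
      moreover have "- \<rho> * p\<^sup>2 * gains \<rho> C + x\<^sup>2 / stiffness \<rho> C \<le> energy a f - \<rho> * (\<Sum>v \<in> ends a. (f v)\<^sup>2)"
        using spidery_energy[OF \<rho>(1) disj(2), of f] ab(3,4,6) \<rho>(2) by (simp add: p_def x_def)
      moreover have "x\<^sup>2 / (real (r + 1) * gains \<rho> C) \<le> x\<^sup>2 / stiffness \<rho> C"
      proof (rule divide_left_mono)
        have pos: "0 < stiffness \<rho> C" "0 < gains \<rho> C"
          using assms(5) below branches_bounds[of _ a] ab(6)
          by (auto intro!: stiffness_pos gains_pos)
        have "stiffness \<rho> C \<le> real r * gains \<rho> C"
          using assms(6) below by (intro stiffness_le_gains) auto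
        also have "\<dots> \<le> real (r + 1) * gains \<rho> C"
          using pos by (intro mult_right_mono) auto
        finally show "stiffness \<rho> C \<le> real (r + 1) * gains \<rho> C" .
        show "0 < real (r + 1) * gains \<rho> C * stiffness \<rho> C"
          using pos by (intro mult_pos_pos) auto
      qed simp
      ultimately show ?thesis
        unfolding en sq distrib_left by linarith
    qed
    moreover have "height (Join a b) > 0" "leaves (graph_of (Join a b)) = ends (Join a b)"
      using leaves_graph_of[OF ab(1)] ab(4) assms(4) by simp_all
    ultimately show ?thesis
      by (intro steklov_ge[where e = f0] ab(1))
  qed
  ultimately show ?thesis
    using ab(2) by simp
qed

section \<open>Optimal branch lengths\<close>

definition two_level :: "nat \<Rightarrow> nat \<Rightarrow> nat \<Rightarrow> nat multiset" where
  "two_level q c t = replicate_mset t (c + 1) + replicate_mset (q - t) c"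

lemma sum_two_level: "t \<le> q \<Longrightarrow> sum_mset (two_level q c t) = q * c + t"
  by (auto simp: two_level_def le_iff_add algebra_simps)

lemma two_level_full: "two_level q c q = two_level q (c + 1) 0"
  by (simp add: two_level_def)

lemma two_level_unique:
  assumes "\<And>l. l \<in># N \<Longrightarrow> l = c \<or> l = c + 1" "size N = q" "sum_mset N = q * c + t"
  shows "N = two_level q c t"
  using assms
proof (induction N arbitrary: q t)
  case empty
  then show ?case
    by (simp add: two_level_def)
next
  case (add l N)
  then obtain q' where q': "q = Suc q'" "size N = q'"
    by auto
  have N: "\<And>l. l \<in># N \<Longrightarrow> l = c \<or> l = c + 1"
    using add.prems(1) by auto
  have le: "sum_mset N \<le> size N * c + size N" "size N * c \<le> sum_mset N"
    using N by (induction N) fastforce+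
  consider "l = c" | "l = c + 1"
    using add.prems(1) by auto
  then show ?case
  proof cases
    case 1
    then have "sum_mset N = q' * c + t"
      using add.prems(3) q' by simp
    then have "N = two_level q' c t" "t \<le> q'"
      using add.IH[OF N q'(2)] le(1) q'(2) by auto
    then show ?thesis
      using 1 q'(1) by (simp add: two_level_def Suc_diff_le)
  next
    case 2
    then have *: "sum_mset N + 1 = q' * c + t"
      using add.prems(3) q' by simp
    moreover from this have "t \<ge> 1"
      using le(2) q'(2) by auto
    ultimately obtain t' where t': "t = Suc t'" "sum_mset N = q' * c + t'"
      by (cases t) auto
    then have "N = two_level q' c t'"
      using add.IH[OF N q'(2)] by blast
    then show ?thesis
      using 2 q'(1) t'(1) by (simp add: two_level_def)
  qed
qed

text \<open>\<open>chord_slope\<close> and \<open>chord_base\<close> are the slope and the intercept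
  at 0 of the line through the points of \<open>gain \<rho>\<close> at \<open>c\<close> and
  \<open>c + 1\<close>.\<close>

definition chord_slope :: "real \<Rightarrow> nat \<Rightarrow> real" where
  "chord_slope \<rho> c = gain \<rho> (c + 1) - gain \<rho> c"

definition chord_base :: "real \<Rightarrow> nat \<Rightarrow> real" where
  "chord_base \<rho> c = real (c + 1) * gain \<rho> c - real c * gain \<rho> (c + 1)"

text \<open>The difference is a positive multiple of \<open>d * (d - 1)\<close> with
  \<open>d = l - c\<close>. For integers this product is never negative, and it vanishes only at the
  ends of the chord.\<close>

lemma gain_above_chord:
  assumes "0 < \<rho>" "\<rho> * real (c + 1) < 1" "\<rho> * real l < 1"
  shows "chord_base \<rho> c + chord_slope \<rho> c * real l \<le> gain \<rho> l"
    and "l \<noteq> c \<Longrightarrow> l \<noteq> c + 1 \<Longrightarrow> chord_base \<rho> c + chord_slope \<rho> c * real l < gain \<rho> l"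
proof -
  define u d where "u = 1 - \<rho> * real c" and "d = real l - real c"
  have u: "0 < u - \<rho>" "0 < u" "0 < u - \<rho> * d"
    using assms by (auto simp: u_def d_def algebra_simps)
  have g: "gain \<rho> c = 1 / u" "gain \<rho> (c + 1) = 1 / (u - \<rho>)" "gain \<rho> l = 1 / (u - \<rho> * d)"
    by (simp_all add: gain_def u_def d_def algebra_simps)
  have "x - (real (c + 1) * y - real c * z + (z - y) * real l) = x - y - d * (z - y)" for x y z
    by (simp add: d_def algebra_simps)
  then have "gain \<rho> l - (chord_base \<rho> c + chord_slope \<rho> c * real l) =
      1 / (u - \<rho> * d) - 1 / u - d * (1 / (u - \<rho>) - 1 / u)"
    unfolding chord_base_def chord_slope_def g by blast
  also have "1 / (u - \<rho> * d) - 1 / u = \<rho> * d / (u * (u - \<rho> * d))"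
    using u by (simp add: field_simps)
  also have "1 / (u - \<rho>) - 1 / u = \<rho> / (u * (u - \<rho>))"
    using u by (simp add: field_simps)
  also have "\<rho> * d / (u * (u - \<rho> * d)) - d * (\<rho> / (u * (u - \<rho>))) =
      \<rho>\<^sup>2 * (d * (d - 1)) / (u * (u - \<rho> * d) * (u - \<rho>))"
    using u by (simp add: divide_simps) (simp add: power2_eq_square algebra_simps)
  finally have id: "gain \<rho> l - (chord_base \<rho> c + chord_slope \<rho> c * real l) =
      \<rho>\<^sup>2 * (d * (d - 1)) / (u * (u - \<rho> * d) * (u - \<rho>))" .
  have den: "0 < u * (u - \<rho> * d) * (u - \<rho>)"
    using u by (intro mult_pos_pos)
  have strict: "0 < d * (d - 1)" if "l \<noteq> c" "l \<noteq> c + 1"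
  proof (cases "l < c")
    case True
    then have "d < 0" "d - 1 < 0"
      by (auto simp: d_def)
    then show ?thesis
      by (rule mult_neg_neg)
  next
    case False
    then have "real l > real c + 1"
      using that by linarith
    then have "0 < d" "0 < d - 1"
      by (auto simp: d_def)
    then show ?thesis
      by (rule mult_pos_pos)
  qed
  then have "0 \<le> d * (d - 1)"
    by (cases "l = c \<or> l = c + 1") (auto simp: d_def intro: less_imp_le)
  then have "0 \<le> \<rho>\<^sup>2 * (d * (d - 1)) / (u * (u - \<rho> * d) * (u - \<rho>))"
    using den by (intro divide_nonneg_pos[OF mult_nonneg_nonneg[OF zero_le_power2]])
  then show "chord_base \<rho> c + chord_slope \<rho> c * real l \<le> gain \<rho> l"
    unfolding id[symmetric] by simp
  assume "l \<noteq> c" "l \<noteq> c + 1"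
  then have "0 < \<rho>\<^sup>2 * (d * (d - 1)) / (u * (u - \<rho> * d) * (u - \<rho>))"
    using den strict by (intro divide_pos_pos[OF mult_pos_pos[OF zero_less_power[OF assms(1)]]])
  then show "chord_base \<rho> c + chord_slope \<rho> c * real l < gain \<rho> l"
    unfolding id[symmetric] by simp
qed

text \<open>The last factor is the increase of \<open>l * (1 - \<rho> * l)\<close> from
  \<open>c\<close> to \<open>c + 1\<close>, so its sign tells on which side of the optimal length
  the chord lies.\<close>

lemma chord_base_eq:
  assumes "\<rho> * real c < 1" "\<rho> * real (c + 1) < 1"
  shows "chord_base \<rho> c = gain \<rho> c * gain \<rho> (c + 1) * (1 - \<rho> * real (2 * c + 1))"
proof -
  define u v where "u = 1 - \<rho> * real c" and "v = 1 - \<rho> * real (c + 1)"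
  have uv: "u \<noteq> 0" "v \<noteq> 0"
    using assms by (auto simp: u_def v_def)
  have g: "gain \<rho> c = 1 / u" "gain \<rho> (c + 1) = 1 / v"
    by (simp_all only: gain_def u_def v_def)
  have "chord_base \<rho> c = (real (c + 1) * v - real c * u) / (u * v)"
    unfolding chord_base_def g using uv by (simp add: field_simps)
  also have "real (c + 1) * v - real c * u = 1 - \<rho> * real (2 * c + 1)"
    by (simp add: u_def v_def algebra_simps)
  finally show ?thesis
    unfolding g by simp
qed

lemma gains_above_chord:
  assumes "0 < \<rho>" "\<rho> * real (c + 1) < 1"
  shows "(\<And>l. l \<in># N \<Longrightarrow> \<rho> * real l < 1) \<Longrightarrow>
     chord_base \<rho> c * real (size N) + chord_slope \<rho> c * real (sum_mset N) \<le> gains \<rho> N \<and>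
     ((\<exists>l \<in># N. l \<noteq> c \<and> l \<noteq> c + 1) \<longrightarrow>
       chord_base \<rho> c * real (size N) + chord_slope \<rho> c * real (sum_mset N) < gains \<rho> N)"
proof (induction N)
  case (add l N)
  have IH: "chord_base \<rho> c * real (size N) + chord_slope \<rho> c * real (sum_mset N) \<le> gains \<rho> N"
    "(\<exists>l \<in># N. l \<noteq> c \<and> l \<noteq> c + 1) \<Longrightarrow>
       chord_base \<rho> c * real (size N) + chord_slope \<rho> c * real (sum_mset N) < gains \<rho> N"
    using add by auto
  have eq: "chord_base \<rho> c * real (size (add_mset l N)) + chord_slope \<rho> c * real (sum_mset (add_mset l N)) =
      (chord_base \<rho> c + chord_slope \<rho> c * real l) +
      (chord_base \<rho> c * real (size N) + chord_slope \<rho> c * real (sum_mset N))"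
    by (simp add: algebra_simps)
  have l: "\<rho> * real l < 1"
    using add.prems by simp
  show ?case
    unfolding eq gains_simps
    using IH gain_above_chord[OF assms l] by (auto intro: add_mono add_le_less_mono add_less_le_mono)
qed simp

lemma gains_replicate [simp]: "gains \<rho> (replicate_mset n l) = real n * gain \<rho> l"
  by (induction n) (simp_all add: algebra_simps)

lemma gains_two_level:
  assumes "t \<le> q"
  shows "gains \<rho> (two_level q c t) = chord_base \<rho> c * real q + chord_slope \<rho> c * real (q * c + t)"
  using assms by (simp add: two_level_def chord_base_def chord_slope_def of_nat_diff algebra_simps)

text \<open>
  For parts of given sum, the chord bound depends on their number only through the factor
  \<open>chord_base\<close>, whose sign decides whether fewer or more parts are better.
\<close>

lemma chord_optimal:
  assumes "0 < \<rho>" "\<rho> * real (c + 1) < 1" "\<And>l. l \<in># N \<Longrightarrow> \<rho> * real l < 1"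
    and "t \<le> q" "sum_mset N = q * c + t"
    and sign: "0 < chord_base \<rho> c \<and> q \<le> size N \<or> chord_base \<rho> c < 0 \<and> size N \<le> q"
  shows "gains \<rho> (two_level q c t) < gains \<rho> N \<or> N = two_level q c t"
proof (cases "size N = q \<and> (\<forall>l \<in># N. l = c \<or> l = c + 1)")
  case True
  then show ?thesis
    using two_level_unique[of N c q t] assms(5) by blast
next
  case False
  have "chord_base \<rho> c * real q \<le> chord_base \<rho> c * real (size N)"
    using sign by (auto intro: mult_left_mono mult_left_mono_neg)
  moreover have "chord_base \<rho> c * real q < chord_base \<rho> c * real (size N)" if "size N \<noteq> q"
    using sign that by (auto intro: mult_strict_left_mono mult_strict_left_mono_neg)
  ultimately have "gains \<rho> (two_level q c t) < gains \<rho> N"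
    using False gains_above_chord[OF assms(1,2), of N] assms(3)
    unfolding gains_two_level[OF assms(4)] assms(5)[symmetric] by fastforce
  then show ?thesis ..
qed

lemma chord_base_pos:
  assumes "0 < \<rho>" "\<rho> * real r < 1" "2 * c + 1 \<le> r"
  shows "0 < chord_base \<rho> c"
proof -
  have "\<rho> * real c < 1" "\<rho> * real (c + 1) < 1" "\<rho> * real (2 * c + 1) < 1"
    using assms(3) by (intro below_one_mono[OF assms(1,2)]; simp)+
  then show ?thesis
    using gain_pos by (simp add: chord_base_eq)
qed

lemma chord_base_neg:
  assumes "0 < \<rho>" "\<rho> * real r < 1" "1 < \<rho> * real (r + 1)" "r \<le> 2 * c" "c + 1 \<le> r"
  shows "chord_base \<rho> c < 0"
proof -
  have c: "\<rho> * real c < 1" "\<rho> * real (c + 1) < 1"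
    using assms(5) by (intro below_one_mono[OF assms(1,2)]; simp)+
  have "\<rho> * real (r + 1) \<le> \<rho> * real (2 * c + 1)"
    using assms(1,4) by (intro mult_left_mono) auto
  then have "1 - \<rho> * real (2 * c + 1) < 0"
    using assms(3) by linarith
  then show ?thesis
    unfolding chord_base_eq[OF c] using gain_pos[OF c(1)] gain_pos[OF c(2)]
    by (intro mult_pos_neg mult_pos_pos)
qed

text \<open>The average of the \<open>q\<close> parts exceeds \<open>s\<close> by less than
  \<open>s / q\<close>, hence \<open>q * (c - s) < s\<close>. For at least two parts this keeps
  \<open>c + 1\<close> within \<open>r\<close>, where the gains are positive and
  \<open>chord_base_neg\<close> applies.\<close>

lemma few_branches_bound:
  fixes q s M r :: nat
  assumes "q = M div s" "1 \<le> s" "2 * s \<le> r + 1" "2 \<le> q" "2 \<le> r" "M = q * c + t" "t < q"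
  shows "s \<le> c" "c + 1 \<le> r"
proof -
  have M: "q * s \<le> M" "M < q * s + s"
    using assms(1,2) dividend_less_div_times[of s M] by (auto simp: div_times_less_eq_dividend)
  have "q * s < q * (c + 1)"
    using M(1) assms(6,7) by simp
  then have "s < c + 1"
    by (rule mult_left_less_imp_less) simp
  then show "s \<le> c"
    by simp
  then obtain d where d: "c = s + d"
    by (auto simp: le_iff_add)
  have "2 * d \<le> q * d"
    using assms(4) by simp
  also have "\<dots> < s"
    using M(2) assms(6) by (simp add: d algebra_simps)
  finally show "c + 1 \<le> r"
    using assms(3,5) d by linarith
qed

text \<open>No integer lies strictly between the two roundings of \<open>M / s\<close>, so
  \<open>N\<close> has at least \<open>q_plus\<close> or at most \<open>M div s\<close> parts. In
  the first case the chord starts below \<open>s\<close>, its base is positive and fewer parts are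
  better; in the second it starts at \<open>s\<close> or above and, unless there is only one part,
  its base is negative and more parts are better.\<close>

lemma two_level_optimal:
  fixes q_minus q_plus s M r :: nat
  assumes \<rho>: "0 < \<rho>" "\<rho> * real r < 1" "1 < \<rho> * real (r + 1)"
    and s: "r \<le> 2 * s" "2 * s \<le> r + 1" "1 \<le> s"
    and N: "\<And>l. l \<in># N \<Longrightarrow> 1 \<le> l \<and> l \<le> r" "sum_mset N = M" "1 \<le> M"
    and qm: "q_minus = max 1 (M div s)" "M = q_minus * c_minus + t_minus" "t_minus < q_minus"
    and qp: "M \<le> q_plus * s" "q_plus * s < M + s" "M = q_plus * c_plus + t_plus" "t_plus < q_plus"
  shows "\<exists>X \<in> {two_level q_minus c_minus t_minus, two_level q_plus c_plus t_plus}.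
    gains \<rho> X < gains \<rho> N \<or> N = X"
proof (cases "q_plus \<le> size N")
  case True
  \<comment> \<open>Dividing \<open>M - 1\<close> instead of \<open>M\<close> yields a remainder
    \<open>t\<close> from 1 to \<open>q_plus\<close>, so that \<open>c < s\<close> even if all parts
    equal \<open>s\<close>. The multiset is the same by \<open>two_level_full\<close>.\<close>
  define c where "c = (M - 1) div q_plus"
  define t where "t = (M - 1) mod q_plus + 1"
  have ct: "M = q_plus * c + t" "t \<le> q_plus"
  proof -
    have "M - 1 = q_plus * c + (M - 1) mod q_plus"
      by (simp add: c_def)
    then show "M = q_plus * c + t"
      using N(3) by (simp add: t_def)
    show "t \<le> q_plus"
      using qp(4) by (simp add: t_def Suc_le_eq)
  qed
  have "c < s"
    unfolding c_def using qp(1) N(3) by (intro less_mult_imp_div_less) (simp add: mult.commute)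
  have "two_level q_plus c t = two_level q_plus c_plus t_plus"
  proof (cases "t = q_plus")
    case True
    then have "M = q_plus * (c + 1)"
      using ct by simp
    then have "c_plus = c + 1" "t_plus = 0"
      using qp(3,4) by (metis div_mult_self1_is_m div_less add.right_neutral bot_nat_0.not_eq_extremum
          div_mult_self4 mult.commute less_nat_zero_code add_left_cancel)+
    then show ?thesis
      using True two_level_full[of q_plus c] by simp
  next
    case False
    then have "t < q_plus"
      using ct(2) by simp
    then have "c_plus = c" "t_plus = t"
      using ct(1) qp(3,4) by (metis div_less div_mult_self4 add.right_neutral less_nat_zero_code mult.commute
          add_left_cancel)+
    then show ?thesis
      by simp
  qed
  moreover have "gains \<rho> (two_level q_plus c t) < gains \<rho> N \<or> N = two_level q_plus c t"
  proof (rule chord_optimal[OF \<rho>(1)])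
    show "\<rho> * real (c + 1) < 1"
      using \<open>c < s\<close> s by (intro below_one_mono[OF \<rho>(1,2)]) auto
    show "\<rho> * real l < 1" if "l \<in># N" for l
      using N(1)[OF that] by (intro below_one_mono[OF \<rho>(1,2)]) auto
    show "0 < chord_base \<rho> c \<and> q_plus \<le> size N \<or> chord_base \<rho> c < 0 \<and> size N \<le> q_plus"
      using True \<open>c < s\<close> s by (intro disjI1 conjI chord_base_pos[OF \<rho>(1,2)]) auto
  qed (use ct N(2) in auto)
  ultimately show ?thesis
    by auto
next
  case False
  have size: "1 \<le> size N"
    using N(2,3) by (cases N) auto
  have "sum_mset N \<le> r * size N"
    using N(1) by (induction N) (auto simp: add_mono)
  have "(q_plus - 1) * s < M"
    using qp(2) N(3) by (simp only: diff_mult_distrib)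
  then have "q_plus - 1 \<le> M div s"
    using s(3) by (simp add: less_eq_div_iff_mult_less_eq)
  then have le: "size N \<le> M div s"
    using False by simp
  then have q: "q_minus = M div s"
    using qm(1) size by simp
  have "gains \<rho> (two_level q_minus c_minus t_minus) < gains \<rho> N \<or> N = two_level q_minus c_minus t_minus"
  proof (cases "q_minus = 1")
    \<comment> \<open>A single part leaves nothing to compare, and \<open>c_minus + 1\<close> might
      exceed \<open>r\<close> here.\<close>
    case True
    then have "size N = 1"
      using le q size by simp
    then obtain l where "N = {#l#}"
      using size_1_singleton_mset by blast
    moreover have "c_minus = M" "t_minus = 0"
      using True qm(2,3) by simp_all
    ultimately show ?thesis
      using True N(2) by (simp add: two_level_def)
  next
    case q2: False
    \<comment> \<open>For \<open>r = 1\<close> all parts are 1, so their number is \<open>M\<close>,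
      which is at least \<open>q_plus\<close>.\<close>
    have "r \<noteq> 1"
    proof
      assume "r = 1"
      then have "s = 1" "sum_mset N \<le> size N"
        using s \<open>sum_mset N \<le> r * size N\<close> by auto
      then show False
        using N(2) qp(2) False by simp
    qed
    then have "2 \<le> r" "2 \<le> q_minus"
      using s q2 qm(3) by auto
    then have c: "s \<le> c_minus" "c_minus + 1 \<le> r"
      using few_branches_bound[OF q s(3) s(2) _ _ qm(2,3)] by auto
    show ?thesis
    proof (rule chord_optimal[OF \<rho>(1)])
      show "\<rho> * real (c_minus + 1) < 1"
        using c by (intro below_one_mono[OF \<rho>(1,2)]) auto
      show "\<rho> * real l < 1" if "l \<in># N" for l
        using N(1)[OF that] by (intro below_one_mono[OF \<rho>(1,2)]) auto
      show "0 < chord_base \<rho> c_minus \<and> q_minus \<le> size N \<or> chord_base \<rho> c_minus < 0 \<and> size N \<le> q_minus"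
        using c s le q by (intro disjI2 conjI chord_base_neg[OF \<rho>]) auto
    qed (use qm N(2) in auto)
  qed
  then show ?thesis
    by auto
qed

text \<open>A part above \<open>r\<close> would raise the diameter and a part 0 would be no leg. The
  part \<open>c + 1\<close> occurs only for a positive remainder, which matters at the upper end of
  the range.\<close>

lemma two_level_parts:
  fixes q_minus q_plus s M r :: nat
  assumes s: "r \<le> 2 * s" "2 * s \<le> r + 1" "1 \<le> s" "1 \<le> M"
    and qm: "q_minus = max 1 (M div s)" "M = q_minus * c_minus + t_minus" "t_minus < q_minus"
    and qp: "M \<le> q_plus * s" "q_plus * s < M + s" "M = q_plus * c_plus + t_plus" "t_plus < q_plus"
    and X: "X = two_level q_minus c_minus t_minus \<or> X = two_level q_plus c_plus t_plus"
  shows "sum_mset X = M" "\<And>l. l \<in># X \<Longrightarrow> 1 \<le> l \<and> l \<le> r"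
proof -
  show "sum_mset X = M"
    using X sum_two_level[of t_minus q_minus c_minus] sum_two_level[of t_plus q_plus c_plus] qm(2,3) qp(3,4)
    by auto
  have l_cases: "l = c \<or> l = c + 1 \<and> 0 < t" if "l \<in># two_level q c t" for l q c t
    using that by (auto simp: two_level_def split: if_splits)
  have plus: "1 \<le> l \<and> l \<le> r" if "l \<in># two_level q_plus c_plus t_plus" for l
  proof -
    have "q_plus \<le> M"
    proof (rule ccontr)
      assume "\<not> ?thesis"
      then have "M + 1 \<le> q_plus"
        by simp
      then have "(M + 1) * s \<le> q_plus * s"
        by (rule mult_right_mono) simp
      then have "M * s + s \<le> q_plus * s"
        by simp
      then have "M * s < M"
        using qp(2) by linarith
      then show False
        using s(3) by simp
    qed
    then have "c_plus \<noteq> 0"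
      using qp(3,4) by (intro notI) simp
    moreover have "q_plus * c_plus + t_plus \<le> q_plus * s"
      using qp(1,3) by simp
    then have "c_plus \<le> s" "0 < t_plus \<Longrightarrow> c_plus < s"
      using qp(4) mult_less_cancel1[of q_plus c_plus s] mult_le_cancel1[of q_plus c_plus s] by linarith+
    ultimately show ?thesis
      using l_cases[OF that] s by auto
  qed
  have minus: "1 \<le> l \<and> l \<le> r" if "l \<in># two_level q_minus c_minus t_minus" for l
  proof -
    have "q_minus \<le> M"
      using qm(1) s(4) by simp
    then have "c_minus \<noteq> 0"
      using qm(2,3) by (intro notI) simp
    moreover have "c_minus + 1 \<le> r \<or> c_minus \<le> r \<and> t_minus = 0"
    proof (cases "q_minus = 1")
      case True
      then have "M div s \<le> 1"
        using qm(1) by simp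
      then have "M < 2 * s"
        using s(3) by (simp add: div_less_iff_less_mult flip: less_Suc_eq_le)
      then show ?thesis
        using True qm(2,3) s(2) by simp
    next
      case False
      then have q: "q_minus = M div s" "2 \<le> q_minus"
        using qm(1,3) by (auto simp: max_def split: if_splits)
      show ?thesis
      proof (cases "r = 1")
        case True
        then have "s = 1"
          using s by simp
        then have "q_minus = M"
          using q(1) by simp
        then have "M * c_minus + t_minus = M * 1"
          using qm(2) by simp
        moreover from this have "M * c_minus \<le> M * 1"
          by linarith
        then have "c_minus \<le> 1"
          using s(4) by simp
        ultimately have "c_minus = 1 \<and> t_minus = 0"
          using \<open>c_minus \<noteq> 0\<close> by (cases "c_minus = 1") auto
        then show ?thesis
          using True by simp
      next
        case False
        then show ?thesis
          using few_branches_bound(2)[OF q(1) s(3) s(2) q(2) _ qm(2,3)] s by simp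
      qed
    qed
    ultimately show ?thesis
      using l_cases[OF that] by auto
  qed
  show "1 \<le> l \<and> l \<le> r" if "l \<in># X" for l
    using X minus plus that by blast
qed

section \<open>Maximizers\<close>

text \<open>Only these properties of the candidates enter the argument, so \<open>M = 0\<close> and
  \<open>M \<ge> 1\<close> are treated alike. In \<open>optimal\<close> the better candidate may
  depend on \<open>\<rho>\<close>; this is why two of them can survive.\<close>

locale candidates =
  fixes r M :: nat and cand :: "nat multiset set"
  assumes r: "1 \<le> r"
    and parts: "\<And>X l. X \<in> cand \<Longrightarrow> l \<in># X \<Longrightarrow> 1 \<le> l \<and> l \<le> r"
    and sum_cand: "\<And>X. X \<in> cand \<Longrightarrow> sum_mset X = M"
    and optimal: "\<And>\<rho> N. 0 < \<rho> \<Longrightarrow> \<rho> * real r < 1 \<Longrightarrow> 1 < \<rho> * real (r + 1) \<Longrightarrow>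
      (\<And>l. l \<in># N \<Longrightarrow> 1 \<le> l \<and> l \<le> r) \<Longrightarrow> sum_mset N = M \<Longrightarrow>
      \<exists>X \<in> cand. gains \<rho> X < gains \<rho> N \<or> N = X"
begin

definition spider_of :: "'a pair_pre_digraph \<Rightarrow> nat multiset \<Rightarrow> bool" where
  "spider_of T X \<longleftrightarrow> (\<exists>t. good t \<and> T = graph_of t \<and> spidery t \<and> branches t = add_mset (r + 1) (add_mset r X))"

definition level :: "nat multiset \<Rightarrow> real" where
  "level X = (SOME \<rho>. balanced r (add_mset r X) \<rho>)"

lemma balanced_level: "X \<in> cand \<Longrightarrow> balanced r (add_mset r X) (level X)"
  unfolding level_def by (rule someI_ex) (rule balanced_exists, auto dest: parts)

lemma spider_of_class:
  assumes "X \<in> cand" "spider_of T X"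
  shows "tree_class (M + 2 * r + 2) (2 * r + 1) T" "steklov_lambda2 T = level X"
proof -
  obtain t where t: "good t" "T = graph_of t" "spidery t" "branches t = add_mset (r + 1) (add_mset r X)"
    using assms(2) by (auto simp: spider_of_def)
  have le: "\<forall>l \<in># add_mset r X. l \<le> r"
    using parts[OF assms(1)] by auto
  show "tree_class (M + 2 * r + 2) (2 * r + 1) T"
  proof -
    have "sum_mset (add_mset r X) + r + 2 = M + 2 * r + 2"
      using sum_cand[OF assms(1)] by simp
    then show ?thesis
      using spidery_tree_class[OF t(1,3,4) _ le r] by (simp only: t(2)) simp
  qed
  show "steklov_lambda2 T = level X"
    unfolding t(2) by (rule steklov_spidery[OF t(1,3,4) r _ le balanced_level[OF assms(1)]]) simp
qed

lemma spider_of_isomorphic: "spider_of S X \<Longrightarrow> spider_of T X \<Longrightarrow> graph_isomorphic S T"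
  by (auto simp: spider_of_def intro: spidery_graph_isomorphic)

lemma nat_spider_of:
  assumes "X \<in> cand"
  shows "\<exists>T :: nat pair_pre_digraph. spider_of T X"
proof -
  obtain ls where ls: "mset ls = X"
    using ex_mset by blast
  have "\<forall>l \<in> set ((r + 1) # r # ls). 1 \<le> l"
    using parts[OF assms] r by (auto simp flip: ls)
  then show ?thesis
    using nat_spidery_tree[of "(r + 1) # r # ls"] ls by (auto simp: spider_of_def)
qed

text \<open>The comparison takes place at the balance value \<open>\<rho>\<close> of the tree's own
  branches, which bounds its eigenvalue. A candidate with smaller gains there has a larger level.
  Otherwise the branches form a candidate themselves, whose level is \<open>\<rho>\<close>, and
  attaining it forces the spider.\<close>

lemma tree_class_bound:
  assumes "tree_class (M + 2 * r + 2) (2 * r + 1) T"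
  shows "\<exists>X \<in> cand. steklov_lambda2 T < level X \<or> steklov_lambda2 T = level X \<and> spider_of T X"
proof -
  obtain t where t: "good t" "T = graph_of t"
    using rtree_of_undirected_tree assms by (auto simp: tree_class_def)
  then have "diam t = 2 * r + 1" "card (vset t) = M + 2 * r + 2"
    using assms by (simp_all add: tree_class_graph_of)
  then obtain a b where ab: "good (Join a b)" "graph_of (Join a b) = graph_of t" "height a = r" "height b = r"
    using central_link[OF t(1)] by blast
  obtain A where A: "branches a = add_mset r A"
    using height_in_branches[of a] ab(3) r by (auto dest: multi_member_split)
  obtain B where B: "branches b = add_mset r B"
    using height_in_branches[of b] ab(4) r by (auto dest: multi_member_split)
  define N where "N = A + B"
  have "vset (Join a b) = vset t"
    using ab(2) by (simp add: graph_of_eq_iff)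
  then have "card (vset a) + card (vset b) = M + 2 * r + 2"
    using card_vset_Join[OF ab(1)] \<open>card (vset t) = _\<close> by simp
  then have sumN: "sum_mset N = M"
    using sum_branches[of a] sum_branches[of b] ab(1) by (simp add: A B N_def)
  have partsN: "1 \<le> l \<and> l \<le> r" if "l \<in># N" for l
    using that branches_bounds[of l a] branches_bounds[of l b] ab(3,4) by (auto simp: N_def A B)
  obtain \<rho> where bal: "balanced r (add_mset r N) \<rho>"
    using balanced_exists[of r "add_mset r N"] partsN by auto
  then have \<rho>: "0 < \<rho>" "\<rho> * real r < 1" "1 < \<rho> * real (r + 1)"
    using balanced_pos[OF bal] by (auto simp: balanced_def)
  have C: "add_mset r (add_mset r N) = branches a + branches b"
    by (simp add: A B N_def)
  note red = steklov_reduction[OF ab(1,3,4) r C bal]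
  obtain X where X: "X \<in> cand" "gains \<rho> X < gains \<rho> N \<or> N = X"
    using optimal[OF \<rho> partsN sumN] by blast
  have leX: "l \<le> r" if "l \<in># add_mset r X" for l
    using that parts[OF X(1)] by auto
  have leN: "l \<le> r" if "l \<in># add_mset r N" for l
    using that partsN by auto
  show ?thesis
  proof (cases "N = X")
    case True
    \<comment> \<open>Two different roots of one balance equation would make the gains of
      \<open>X\<close> strictly smaller than themselves.\<close>
    have "\<rho> = level X"
      using balanced_le_imp_gains_le(2)[OF bal balanced_level[OF X(1)] _ leX]
        balanced_le_imp_gains_le(2)[OF balanced_level[OF X(1)] bal _ leN] True
      by (metis less_irrefl linorder_neqE_linordered_idom less_imp_le)
    then have "steklov_lambda2 T < level X \<or> steklov_lambda2 T = level X \<and> spider_of T X"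
      using red True ab(2) t(2) unfolding spider_of_def by (metis order_le_less)
    then show ?thesis
      using X(1) by blast
  next
    case False
    then have "\<not> level X \<le> \<rho>"
      using balanced_le_imp_gains_le(1)[OF bal balanced_level[OF X(1)] _ leX] X(2) by fastforce
    then have "steklov_lambda2 T < level X"
      using red(1) ab(2) t(2) by simp
    then show ?thesis
      using X(1) by blast
  qed
qed

lemma maximizer_is_candidate:
  assumes "lambda2_maximizer (M + 2 * r + 2) (2 * r + 1) T"
  shows "\<exists>X \<in> cand. (\<forall>Y \<in> cand. level Y \<le> level X) \<and> spider_of T X"
proof -
  have ge: "level Y \<le> steklov_lambda2 T" if "Y \<in> cand" for Y
    using nat_spider_of[OF that] spider_of_class[OF that] assms by (metis lambda2_maximizer_def)
  obtain X where "X \<in> cand" "steklov_lambda2 T < level X \<or> steklov_lambda2 T = level X \<and> spider_of T X"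
    using tree_class_bound assms by (auto simp: lambda2_maximizer_def)
  then show ?thesis
    using ge by (metis not_less)
qed

lemma candidate_is_maximizer:
  assumes "X \<in> cand" "\<And>Y. Y \<in> cand \<Longrightarrow> level Y \<le> level X" "spider_of T X"
  shows "lambda2_maximizer (M + 2 * r + 2) (2 * r + 1) T"
  unfolding lambda2_maximizer_def
proof (intro conjI allI impI)
  show "tree_class (M + 2 * r + 2) (2 * r + 1) T"
    using spider_of_class(1)[OF assms(1,3)] .
  fix S :: "nat pair_pre_digraph"
  assume "tree_class (M + 2 * r + 2) (2 * r + 1) S"
  then obtain Y where "Y \<in> cand" "steklov_lambda2 S \<le> level Y"
    using tree_class_bound by (metis order_le_less)
  then show "steklov_lambda2 S \<le> steklov_lambda2 T"
    using assms(2) spider_of_class(2)[OF assms(1,3)] by fastforce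
qed

lemma unique_maximizer:
  assumes "X \<in> cand" "\<And>Y. Y \<in> cand \<Longrightarrow> Y \<noteq> X \<Longrightarrow> level Y < level X"
  shows "\<exists>T0 :: nat pair_pre_digraph. lambda2_maximizer (M + 2 * r + 2) (2 * r + 1) T0 \<and>
    (\<forall>T :: 'a pair_pre_digraph. lambda2_maximizer (M + 2 * r + 2) (2 * r + 1) T \<longrightarrow> graph_isomorphic T T0)"
proof -
  obtain T0 :: "nat pair_pre_digraph" where T0: "spider_of T0 X"
    using nat_spider_of[OF assms(1)] by blast
  moreover have "lambda2_maximizer (M + 2 * r + 2) (2 * r + 1) T0"
    using assms by (intro candidate_is_maximizer[OF assms(1) _ T0]) (metis less_imp_le order_refl)
  moreover have "graph_isomorphic T T0"
    if "lambda2_maximizer (M + 2 * r + 2) (2 * r + 1) T" for T :: "'a pair_pre_digraph"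
    using maximizer_is_candidate[OF that] assms T0 spider_of_isomorphic by (metis not_less)
  ultimately show ?thesis
    by blast
qed

end

section \<open>The candidates for positive and for vanishing \<open>M\<close>\<close>

lemma two_level_candidates:
  fixes q_minus q_plus s M r :: nat
  assumes "1 \<le> r" "r \<le> 2 * s" "2 * s \<le> r + 1" "1 \<le> s" "1 \<le> M"
    and "q_minus = max 1 (M div s)" "M = q_minus * c_minus + t_minus" "t_minus < q_minus"
    and "M \<le> q_plus * s" "q_plus * s < M + s" "M = q_plus * c_plus + t_plus" "t_plus < q_plus"
  shows "candidates r M {two_level q_minus c_minus t_minus, two_level q_plus c_plus t_plus}"
proof
  show "1 \<le> l \<and> l \<le> r"
    if "X \<in> {two_level q_minus c_minus t_minus, two_level q_plus c_plus t_plus}" "l \<in># X" for X l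
    using two_level_parts(2)[OF assms(2-12)] that by auto
  show "sum_mset X = M"
    if "X \<in> {two_level q_minus c_minus t_minus, two_level q_plus c_plus t_plus}" for X
    using two_level_parts(1)[OF assms(2-12)] that by auto
  show "\<exists>X \<in> {two_level q_minus c_minus t_minus, two_level q_plus c_plus t_plus}. gains \<rho> X < gains \<rho> N \<or> N = X"
    if "0 < \<rho>" "\<rho> * real r < 1" "1 < \<rho> * real (r + 1)"
      "\<And>l. l \<in># N \<Longrightarrow> 1 \<le> l \<and> l \<le> r" "sum_mset N = M" for \<rho> N
    using two_level_optimal[OF that(1-3) assms(2-4) that(4,5) assms(5-12)] .
qed (rule assms(1))

lemma candidates_empty: "1 \<le> r \<Longrightarrow> candidates r 0 {{#}}"
proof
  show "\<exists>X \<in> {{#}}. gains \<rho> X < gains \<rho> N \<or> N = X"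
    if "\<And>l. l \<in># N \<Longrightarrow> 1 \<le> l \<and> l \<le> r" "sum_mset N = 0" for \<rho> :: real and N
  proof -
    have "N = {#}"
      using that by (cases N) force+
    then show ?thesis
      by simp
  qed
qed auto

lemma spider_is_spidery:
  assumes "\<forall>l \<in> set ls. 1 \<le> l" "ls \<noteq> []"
  shows "\<exists>t. good t \<and> spider ls = graph_of t \<and> spidery t \<and> branches t = mset ls"
  using assms spider_eq_graph_of[OF assms] good_spider_tree[OF order_refl assms(1)]
    branches_spider_tree[OF order_refl assms(1)] spidery_spider_tree
  by (metis take_all_iff order_refl)

lemma almost_seesaw_spider_of:
  assumes "candidates r M cand" "1 \<le> c" "1 \<le> r"
  shows "candidates.spider_of r (almost_seesaw r (q + 2) c t) (two_level q c t)"
proof -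
  let ?ls = "[r + 1, r] @ replicate t (c + 1) @ replicate (q - t) c"
  have "\<forall>l \<in> set ?ls. 1 \<le> l"
    using assms(2,3) by auto
  then have "\<exists>t'. good t' \<and> spider ?ls = graph_of t' \<and> spidery t' \<and> branches t' = mset ?ls"
    by (rule spider_is_spidery) simp
  moreover have "almost_seesaw r (q + 2) c t = spider ?ls"
    by (simp add: almost_seesaw_def)
  moreover have "mset ?ls = add_mset (r + 1) (add_mset r (two_level q c t))"
    by (simp add: two_level_def)
  ultimately show ?thesis
    unfolding candidates.spider_of_def[OF assms(1)] by simp
qed

lemma path_graph_spider_of:
  assumes "candidates r M cand" "1 \<le> r"
  shows "candidates.spider_of r (path_graph (2 * r + 2)) {#}"
proof -
  let ?t = "Join (stem r (map (\<lambda>i. r - Suc i) [0..<r])) (stem (r + 1) (map (\<lambda>i. r + 2 + i) [0..<r]))"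
  have "good ?t"
    by (auto simp: distinct_map inj_on_def)
  moreover have "spidery ?t" "branches ?t = add_mset (r + 1) (add_mset r {#})"
    using assms(2) by auto
  ultimately show ?thesis
    unfolding candidates.spider_of_def[OF assms(1)] path_graph_eq_graph_of by blast
qed

section \<open>Ties between the two candidates\<close>

lemma size_mult_bound: "(\<And>l. l \<in># X \<Longrightarrow> l \<le> r) \<Longrightarrow> sum_mset X \<le> r * size X"
  by (induction X) (auto simp: add_mono)

lemma size_le_gains:
  assumes "0 < \<rho>"
  shows "(\<And>l. l \<in># X \<Longrightarrow> \<rho> * real l < 1) \<Longrightarrow> real (size X) \<le> gains \<rho> X"
proof (induction X)
  case (add l X)
  have "1 \<le> gain \<rho> l"
    using add.prems[of l] assms by (simp add: gain_def)
  then show ?case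
    using add by simp
qed simp

text \<open>
  The costs of the two candidates differ by a rational function of \<open>\<rho>\<close> that, for a fixed
  residue \<open>e\<close> of the number of spare vertices, does not depend on the number of branches;
  this quadratic polynomial is its numerator.
\<close>

definition tie_poly :: "nat \<Rightarrow> nat \<Rightarrow> real poly" where
  "tie_poly s e = [:- 1, 3 * real s, 2 * real e - (real s + 1) * (2 * real s - 1):]"

text \<open>Apart from parts \<open>s\<close>, one multiset has \<open>e\<close> parts
  \<open>s + 1\<close> and the other \<open>s - e\<close> parts \<open>s - 1\<close>, so
  \<open>q\<close> cancels in the difference of the gains. Clearing denominators and inserting
  \<open>x = 1 - \<rho> * s\<close> yields \<open>tie_poly\<close>.\<close>

lemma tie_imp_root:
  assumes "0 < \<rho>" "\<rho> * real (s + 1) < 1" "e < s" "s \<le> q"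
    and "gains \<rho> (two_level q s e) = gains \<rho> (two_level (q + 1) (s - 1) (q + 1 - (s - e)))"
  shows "poly (tie_poly s e) \<rho> = 0"
proof -
  define x where "x = 1 - \<rho> * real s"
  have x: "0 < x - \<rho>" "0 < x" "0 < x + \<rho>"
    using assms(1,2) by (auto simp: x_def algebra_simps)
  have g: "gain \<rho> s = 1 / x" "gain \<rho> (s + 1) = 1 / (x - \<rho>)" "gain \<rho> (s - 1) = 1 / (x + \<rho>)"
    using assms(3) by (simp_all add: gain_def x_def of_nat_diff algebra_simps)
  have "two_level (q + 1) (s - 1) (q + 1 - (s - e)) =
      replicate_mset (q + 1 - (s - e)) s + replicate_mset (s - e) (s - 1)"
    using assms(3,4) by (simp add: two_level_def)
  then have "real e * gain \<rho> (s + 1) + (real q - real e) * gain \<rho> s =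
      (real q + 1 - (real s - real e)) * gain \<rho> s + (real s - real e) * gain \<rho> (s - 1)"
    using assms(3-5) by (simp add: two_level_def of_nat_diff)
  then have "real e / (x - \<rho>) - (real s - real e) / (x + \<rho>) + (real s - 1 - 2 * real e) / x = 0"
    unfolding g by (simp add: field_simps) argo
  then have "(x - \<rho>) * (x + \<rho>) * x *
      (real e / (x - \<rho>) - (real s - real e) / (x + \<rho>) + (real s - 1 - 2 * real e) / x) = 0"
    by simp
  moreover have "p * m * x * (a / p - b / m + c / x) = a * (m * x) - b * (p * x) + c * (p * m)"
    if "p \<noteq> 0" "m \<noteq> 0" for a b c p m :: real
    using that x(2) by (simp add: field_simps)
  then have "(x - \<rho>) * (x + \<rho>) * x *
      (real e / (x - \<rho>) - (real s - real e) / (x + \<rho>) + (real s - 1 - 2 * real e) / x) =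
      real e * ((x + \<rho>) * x) - (real s - real e) * ((x - \<rho>) * x) +
      (real s - 1 - 2 * real e) * ((x - \<rho>) * (x + \<rho>))"
    using x by simp
  ultimately show ?thesis
    by (simp add: tie_poly_def x_def algebra_simps power2_eq_square)
qed

text \<open>Ties come from finitely many polynomials, one for each residue \<open>e\<close>, so the
  tie values above \<open>1 / (r + 1)\<close> keep a distance from it. The eigenvalue does not: as
  every part is at most \<open>r\<close> and has gain at least 1, balance gives
  \<open>M * (\<rho> * (r + 1) - 1) \<le> r\<close>.\<close>

lemma eventually_unique:
  fixes r :: nat
  assumes "1 \<le> r"
  shows "\<exists>N :: nat. \<forall>M \<ge> N. \<exists>T0 :: nat pair_pre_digraph. lambda2_maximizer (M + 2 * r + 2) (2 * r + 1) T0 \<and>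
    (\<forall>T :: 'a pair_pre_digraph. lambda2_maximizer (M + 2 * r + 2) (2 * r + 1) T \<longrightarrow> graph_isomorphic T T0)"
proof -
  define s where "s = (r + 1) div 2"
  have s: "r \<le> 2 * s" "2 * s \<le> r + 1" "1 \<le> s"
    using assms by (auto simp: s_def)
  define Z where "Z = (\<Union>e<s. {\<rho>. poly (tie_poly s e) \<rho> = 0})"
  have "finite Z"
    unfolding Z_def by (intro finite_UN_I poly_roots_finite) (auto simp: tie_poly_def)
  \<comment> \<open>The element 2 keeps the set nonempty, so that \<open>Min\<close> is meaningful,
    and it exceeds \<open>1 / (r + 1)\<close> as well.\<close>
  define Z' where "Z' = insert 2 {\<rho> \<in> Z. 1 < \<rho> * real (r + 1)}"
  define d where "d = Min Z'"
  have Z': "finite Z'" "Z' \<noteq> {}"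
    using \<open>finite Z\<close> by (auto simp: Z'_def)
  have "1 < 2 * real (r + 1)"
    by simp
  then have d: "1 < d * real (r + 1)"
    unfolding d_def using Min_in[OF Z'] by (auto simp: Z'_def)
  obtain N0 :: nat where N0: "real r < real N0 * (d * real (r + 1) - 1)"
    using reals_Archimedean3[of "d * real (r + 1) - 1"] d by auto
  show ?thesis
  \<comment> \<open>The bound \<open>s * s\<close> ensures \<open>q \<ge> s\<close>, so that
    \<open>e\<close> is also the remainder on division by \<open>q\<close>, and \<open>q + 1\<close>
    parts need only the lengths \<open>s - 1\<close> and \<open>s\<close>.\<close>
  proof (intro exI[of _ "max N0 (s * s + 1)"] allI impI)
    fix M assume "max N0 (s * s + 1) \<le> M"
    then have M: "N0 \<le> M" "s * s \<le> M" "1 \<le> M"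
      by auto
    define q e where "q = M div s" and "e = M mod s"
    have e: "M = q * s + e" "e < s"
      using s(3) by (simp_all add: q_def e_def)
    have "s * s div s \<le> M div s"
      using M(2) by (rule div_le_mono)
    then have q: "s \<le> q" "q = max 1 (M div s)"
      using s(3) by (simp_all add: q_def)
    show "\<exists>T0 :: nat pair_pre_digraph. lambda2_maximizer (M + 2 * r + 2) (2 * r + 1) T0 \<and>
      (\<forall>T :: 'a pair_pre_digraph. lambda2_maximizer (M + 2 * r + 2) (2 * r + 1) T \<longrightarrow> graph_isomorphic T T0)"
    proof (cases "e = 0")
      \<comment> \<open>If \<open>s\<close> divides \<open>M\<close>, the two candidates
        coincide.\<close>
      case True
      have M': "M = q * s + 0" "0 < q"
        using e(1) True q(1) s(3) by simp_all
      have le: "M \<le> q * s" "q * s < M + s"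
        using M' s(3) by simp_all
      have "candidates r M {two_level q s 0, two_level q s 0}"
        by (rule two_level_candidates[OF assms s M(3) q(2) M' le M'])
      then interpret candidates r M "{two_level q s 0}"
        by simp
      show ?thesis
        by (rule unique_maximizer[of "two_level q s 0"]) auto
    next
      case False
      let ?X = "two_level q s e" and ?Y = "two_level (q + 1) (s - 1) (q + 1 - (s - e))"
      have M_plus: "M = (q + 1) * (s - 1) + (q + 1 - (s - e))"
      proof -
        obtain k where "s = e + k" "0 < k"
          using e(2) by (metis less_imp_add_positive)
        moreover obtain j where "q = s + j"
          using q(1) by (auto simp: le_iff_add)
        ultimately show ?thesis
          by (cases k) (simp_all add: e(1) algebra_simps)
      qed
      have lt: "e < q" "q + 1 - (s - e) < q + 1" "M \<le> (q + 1) * s" "(q + 1) * s < M + s"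
        using e q(1) False by simp_all
      interpret candidates r M "{?X, ?Y}"
        by (rule two_level_candidates[OF assms s M(3) q(2) e(1) lt(1,3,4) M_plus lt(2)])
      have "level ?X \<noteq> level ?Y"
      proof
        assume eq: "level ?X = level ?Y"
        define \<rho> where "\<rho> = level ?X"
        have bal: "balanced r (add_mset r ?X) \<rho>" "balanced r (add_mset r ?Y) \<rho>"
          using balanced_level[of ?X] balanced_level[of ?Y] eq by (simp_all add: \<rho>_def)
        have \<rho>: "0 < \<rho>" "\<rho> * real r < 1" "1 < \<rho> * real (r + 1)"
          using balanced_pos[OF bal(1)] bal(1) by (auto simp: balanced_def)
        have "gains \<rho> (add_mset r ?X) * (\<rho> * real (r + 1) - 1) = gains \<rho> (add_mset r ?Y) * (\<rho> * real (r + 1) - 1)"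
          using bal unfolding balanced_def by metis
        then have "gains \<rho> (add_mset r ?X) = gains \<rho> (add_mset r ?Y)"
          using \<rho>(3) by simp
        then have "gains \<rho> ?X = gains \<rho> ?Y"
          by simp
        \<comment> \<open>\<open>0 < e < s\<close> excludes \<open>s = 1\<close>, and then
          \<open>s + 1 \<le> r\<close>.\<close>
        moreover have "\<rho> * real (s + 1) < 1"
          using False e(2) s by (intro below_one_mono[OF \<rho>(1,2)]) linarith
        ultimately have "poly (tie_poly s e) \<rho> = 0"
          using e(2) q(1) \<rho>(1) by (intro tie_imp_root)
        then have "\<rho> \<in> Z'"
          using \<rho>(3) e(2) by (auto simp: Z'_def Z_def)
        then have "d \<le> \<rho>"
          unfolding d_def using Z'(1) by simp
        then have "d * real (r + 1) \<le> \<rho> * real (r + 1)"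
          by (intro mult_right_mono) auto
        then have "real N0 * (d * real (r + 1) - 1) \<le> real M * (\<rho> * real (r + 1) - 1)"
          using M(1) d by (intro mult_mono) auto
        also have "\<dots> \<le> real r * gains \<rho> (add_mset r ?X) * (\<rho> * real (r + 1) - 1)"
        proof (rule mult_right_mono)
          have le: "l \<le> r" if "l \<in># add_mset r ?X" for l
            using that parts[of ?X l] by auto
          have "M \<le> sum_mset (add_mset r ?X)"
            using sum_cand[of ?X] by simp
          also have "\<dots> \<le> r * size (add_mset r ?X)"
            using le by (rule size_mult_bound)
          finally have "real M \<le> real r * real (size (add_mset r ?X))"
            by (simp only: flip: of_nat_mult)
          also have "\<dots> \<le> real r * gains \<rho> (add_mset r ?X)"
            using le by (intro mult_left_mono size_le_gains[OF \<rho>(1)] below_one_mono[OF \<rho>(1,2)]) auto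
          finally show "real M \<le> real r * gains \<rho> (add_mset r ?X)" .
        qed (use \<rho>(3) in simp)
        also have "\<dots> = real r"
          using bal(1) by (simp only: balanced_def mult.assoc)
        finally show False
          using N0 by simp
      qed
      then consider "level ?X < level ?Y" | "level ?Y < level ?X"
        by linarith
      then show ?thesis
      proof cases
        case 1
        then show ?thesis
          by (intro unique_maximizer[of ?Y]) auto
      next
        case 2
        then show ?thesis
          by (intro unique_maximizer[of ?X]) auto
      qed
    qed
  qed
qed

theorem theorem1p2:
  fixes r D :: nat
  assumes "D = 2 * r + 1" and "D \<ge> 3"
  shows
    "(\<forall>n M s q_minus q_plus :: nat.
       n \<ge> D + 1 \<and> M = n - 2 * r - 2 \<and> s = nat \<lceil>real r / 2\<rceil> \<and>
       q_minus = max 1 (nat \<lfloor>real M / real s\<rfloor>) \<and> q_plus = nat \<lceil>real M / real s\<rceil> \<longrightarrow>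
       (M = 0 \<longrightarrow>
          lambda2_maximizer n D (path_graph (D + 1)) \<and>
          (\<forall>T :: 'a pair_pre_digraph.
             lambda2_maximizer n D T \<longrightarrow> graph_isomorphic T (path_graph (D + 1)))) \<and>
       (M \<ge> 1 \<longrightarrow>
          (\<forall>c_minus t_minus c_plus t_plus :: nat.
             M = q_minus * c_minus + t_minus \<and> t_minus < q_minus \<and>
             M = q_plus * c_plus + t_plus \<and> t_plus < q_plus \<longrightarrow>
             (\<forall>T :: 'a pair_pre_digraph. lambda2_maximizer n D T \<longrightarrow>
                graph_isomorphic T (almost_seesaw r (q_minus + 2) c_minus t_minus) \<or>
                graph_isomorphic T (almost_seesaw r (q_plus + 2) c_plus t_plus)) \<and>
             (steklov_lambda2 (almost_seesaw r (q_minus + 2) c_minus t_minus) \<noteq>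
              steklov_lambda2 (almost_seesaw r (q_plus + 2) c_plus t_plus) \<longrightarrow>
              (\<exists>T0 :: nat pair_pre_digraph. lambda2_maximizer n D T0 \<and>
                 (\<forall>T :: 'a pair_pre_digraph.
                    lambda2_maximizer n D T \<longrightarrow> graph_isomorphic T T0)))))) \<and>
     (\<exists>N :: nat. \<forall>n \<ge> N. \<exists>T0 :: nat pair_pre_digraph. lambda2_maximizer n D T0 \<and>
       (\<forall>T :: 'a pair_pre_digraph. lambda2_maximizer n D T \<longrightarrow> graph_isomorphic T T0))"
proof (intro conjI allI impI; (elim conjE)?)
  have r: "1 \<le> r"
    using assms by simp
  show "lambda2_maximizer n D (path_graph (D + 1))"
    if "D + 1 \<le> n" "M = n - 2 * r - 2" "M = 0" for n M :: nat
  proof -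
    interpret candidates r 0 "{{#}}"
      by (rule candidates_empty[OF r])
    show ?thesis
      using candidate_is_maximizer[OF _ _ path_graph_spider_of[OF candidates_axioms r]] that assms(1) by simp
  qed
  show "graph_isomorphic T (path_graph (D + 1))"
    if "D + 1 \<le> n" "M = n - 2 * r - 2" "M = 0" "lambda2_maximizer n D T" for n M :: nat and T :: "'a pair_pre_digraph"
  proof -
    interpret candidates r 0 "{{#}}"
      by (rule candidates_empty[OF r])
    have "n = 0 + 2 * r + 2"
      using that(1-3) assms(1) by simp
    then have "spider_of T {#}"
      using maximizer_is_candidate[of T] that(4) assms(1) by auto
    then show ?thesis
      using spider_of_isomorphic[OF _ path_graph_spider_of[OF candidates_axioms r]] assms(1) by simp
  qed
  fix n M s q_minus q_plus c_minus t_minus c_plus t_plus :: nat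
  assume n: "D + 1 \<le> n" "M = n - 2 * r - 2" and s_def: "s = nat \<lceil>real r / 2\<rceil>"
    and q_minus: "q_minus = max 1 (nat \<lfloor>real M / real s\<rfloor>)" and q_plus: "q_plus = nat \<lceil>real M / real s\<rceil>"
    and M: "1 \<le> M"
    and minus: "M = q_minus * c_minus + t_minus" "t_minus < q_minus"
    and plus: "M = q_plus * c_plus + t_plus" "t_plus < q_plus"
  have nM: "n = M + 2 * r + 2"
    using n assms(1) by simp
  have s: "r \<le> 2 * s" "2 * s \<le> r + 1" "1 \<le> s"
    unfolding s_def using r by linarith+
  have qm: "q_minus = max 1 (M div s)"
    by (simp add: q_minus floor_divide_of_nat_eq)
  have "real M / real s \<le> real q_plus" "real q_plus < real M / real s + 1"
    using M s unfolding q_plus by (auto simp: of_nat_nat ceiling_correct) (smt (verit) ceiling_correct divide_nonneg_nonneg of_int_0_le_iff of_nat_0_le_iff zero_le_ceiling)+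
  then have "real M \<le> real q_plus * real s" "real q_plus * real s < real M + real s"
    using s(3) by (simp_all add: field_simps)
  then have qp: "M \<le> q_plus * s" "q_plus * s < M + s"
    by (simp_all only: flip: of_nat_mult of_nat_add)
  let ?X = "two_level q_minus c_minus t_minus" and ?Y = "two_level q_plus c_plus t_plus"
  interpret candidates r M "{?X, ?Y}"
    by (rule two_level_candidates[OF r s M qm minus qp plus])
  \<comment> \<open>\<open>t < q\<close> leaves at least one part of length \<open>c\<close>, so the
    bound on the parts applies to \<open>c\<close> itself.\<close>
  have pos: "1 \<le> c" if "two_level q c t \<in> {?X, ?Y}" "t < q" for q c t
    using parts[OF that(1), of c] that(2) by (simp add: two_level_def)
  have X: "spider_of (almost_seesaw r (q_minus + 2) c_minus t_minus) ?X"
    using pos[of q_minus c_minus t_minus] minus(2)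
    by (intro almost_seesaw_spider_of[OF candidates_axioms _ r]) auto
  have Y: "spider_of (almost_seesaw r (q_plus + 2) c_plus t_plus) ?Y"
    using pos[of q_plus c_plus t_plus] plus(2)
    by (intro almost_seesaw_spider_of[OF candidates_axioms _ r]) auto
  show "graph_isomorphic T (almost_seesaw r (q_minus + 2) c_minus t_minus) \<or>
      graph_isomorphic T (almost_seesaw r (q_plus + 2) c_plus t_plus)"
    if "lambda2_maximizer n D T" for T :: "'a pair_pre_digraph"
    using maximizer_is_candidate[of T] that X Y spider_of_isomorphic by (auto simp: nM assms(1))
  assume "steklov_lambda2 (almost_seesaw r (q_minus + 2) c_minus t_minus) \<noteq>
      steklov_lambda2 (almost_seesaw r (q_plus + 2) c_plus t_plus)"
  then have "level ?X \<noteq> level ?Y"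
    using spider_of_class(2)[OF _ X] spider_of_class(2)[OF _ Y] by auto
  then consider "level ?X < level ?Y" | "level ?Y < level ?X"
    by linarith
  then show "\<exists>T0 :: nat pair_pre_digraph. lambda2_maximizer n D T0 \<and>
      (\<forall>T :: 'a pair_pre_digraph. lambda2_maximizer n D T \<longrightarrow> graph_isomorphic T T0)"
    unfolding nM assms(1)
  proof cases
    case 1
    then show "\<exists>T0 :: nat pair_pre_digraph. lambda2_maximizer (M + 2 * r + 2) (2 * r + 1) T0 \<and>
      (\<forall>T :: 'a pair_pre_digraph. lambda2_maximizer (M + 2 * r + 2) (2 * r + 1) T \<longrightarrow> graph_isomorphic T T0)"
      by (intro unique_maximizer[of ?Y]) auto
  next
    case 2
    then show "\<exists>T0 :: nat pair_pre_digraph. lambda2_maximizer (M + 2 * r + 2) (2 * r + 1) T0 \<and>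
      (\<forall>T :: 'a pair_pre_digraph. lambda2_maximizer (M + 2 * r + 2) (2 * r + 1) T \<longrightarrow> graph_isomorphic T T0)"
      by (intro unique_maximizer[of ?X]) auto
  qed
next
  have "1 \<le> r"
    using assms by simp
  then obtain N where N: "\<And>M. N \<le> M \<Longrightarrow> \<exists>T0 :: nat pair_pre_digraph. lambda2_maximizer (M + 2 * r + 2) (2 * r + 1) T0 \<and>
    (\<forall>T :: 'a pair_pre_digraph. lambda2_maximizer (M + 2 * r + 2) (2 * r + 1) T \<longrightarrow> graph_isomorphic T T0)"
    using eventually_unique by blast
  show "\<exists>N :: nat. \<forall>n \<ge> N. \<exists>T0 :: nat pair_pre_digraph. lambda2_maximizer n D T0 \<and>
       (\<forall>T :: 'a pair_pre_digraph. lambda2_maximizer n D T \<longrightarrow> graph_isomorphic T T0)"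
  proof (intro exI[of _ "N + 2 * r + 2"] allI impI)
    fix n assume "N + 2 * r + 2 \<le> n"
    then have "N \<le> n - 2 * r - 2" "n = (n - 2 * r - 2) + 2 * r + 2"
      by simp_all
    then show "\<exists>T0 :: nat pair_pre_digraph. lambda2_maximizer n D T0 \<and>
       (\<forall>T :: 'a pair_pre_digraph. lambda2_maximizer n D T \<longrightarrow> graph_isomorphic T T0)"
      using N[of "n - 2 * r - 2"] assms(1) by metis
  qed
qed

end
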